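(* Let $\mathbb{K}$ be a field and let $K_n$ ($n\ge 2$) be a weighted oriented complete graph such that $N^+_{K_n}(V^+)\ne V(K_n)$. Then for any $k\ge 1$, $$\operatorname{reg}(I(K_n)^{(k)})=\max\Big\{\max_{(x_i,x_j)\in E(K_n)}\{r_{ij}(k)\}+2,\ \max_{x_i\in V(K_n)}\{r_i(k)\}+1\Big\},$$ where $$r_{ij}(k)=\max\{w(x_j)+1,\ w(x) \mid x\in N^+_{K_n}(x_i)\cap N^+_{K_n}(x_j)\}(k-1)+\sum_{x\in N^+_{K_n}(x_i)\cap N^+_{K_n}[x_j]}(w(x)-1)$$ and $$r_i(k)=\max\{w(x)\mid x\in N^+_{K_n}(x_i)\}(k-1)+\sum_{x\in N^+_{K_n}(x_i)}(w(x)-1).$$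
   Context: A weighted oriented graph is a triple $D=(V(D),E(D),w)$ with finite vertex set $V(D)=\{x_1,\dots,x_n\}$, a set $E(D)$ of directed edges (where $(u,v)$ is an edge from $u$ to $v$), without loops or parallel edges (at most one of $(u,v),(v,u)$ is in $E(D)$), and a weight function $w$ from $V(D)$ to the positive integers. A vertex is a source if no edge ends at it; by convention $w(v)=1$ whenever $v$ is a source. A weighted oriented complete graph $K_n$ is a weighted oriented graph on $\{x_1,\dots,x_n\}$ in which for each pair $i\ne j$ exactly one of $(x_i,x_j),(x_j,x_i)$ is an edge. $V^+=\{x: w(x)\ge 2\}$. $N^+_{K_n}(x)=\{y:(x,y)\in E(K_n)\}$, $N^+_{K_n}[x]=N^+_{K_n}(x)\cup\{x\}$, and $N^+_{K_n}(V^+)=\bigcup_{x\in V^+}N^+_{K_n}(x)$. Convention: $\max\{w(x)\mid x\in A\}=1$ if $A=\emptyset$ (used in $r_i(k)$); in $r_{ij}(k)$ the maximum is over $w(x_j)+1$ together with all $w(x)$, $x\in N^+_{K_n}(x_i)\cap N^+_{K_n}(x_j)$. The edge ideal is $I(K_n)=(x_ix_j^{w(x_j)}:(x_i,x_j)\in E(K_n))\subset R=\mathbb{K}[x_1,\dots,x_n]$. The $k$-th symbolic power of an ideal $I$ is $I^{(k)}=\bigcap_{P\in \operatorname{Ass}(R/I)}(I^kR_P\cap R)$. $\operatorname{reg}(I)=\max\{j-i : \beta_{i,j}(I)\ne 0\}$ is the Castelnuovo–Mumford regularity. *)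

theory Defs
  imports
    Complex_Main
    "HOL-Library.Poly_Mapping"
    "HOL-Library.Cardinality"
    "HOL-Computational_Algebra.Fraction_Field"
begin

section \<open>Weighted oriented graphs\<close>

text \<open>
  The vertex set is the whole (finite) type of vertices. Edges form a set of ordered pairs, so the
  only parallel edges that have to be excluded are antiparallel ones.
\<close>

definition is_source :: "('v \<times> 'v) set \<Rightarrow> 'v \<Rightarrow> bool" where
  "is_source E v \<longleftrightarrow> (\<forall>u. (u, v) \<notin> E)"

definition weighted_oriented_graph :: "('v::finite \<times> 'v) set \<Rightarrow> ('v \<Rightarrow> nat) \<Rightarrow> bool" where
  "weighted_oriented_graph E w \<longleftrightarrow>
     (\<forall>u. (u, u) \<notin> E) \<and>
     (\<forall>u v. \<not> ((u, v) \<in> E \<and> (v, u) \<in> E)) \<and>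
     (\<forall>v. w v \<ge> 1) \<and>
     (\<forall>v. is_source E v \<longrightarrow> w v = 1)"

definition weighted_oriented_complete_graph :: "('v::finite \<times> 'v) set \<Rightarrow> ('v \<Rightarrow> nat) \<Rightarrow> bool" where
  "weighted_oriented_complete_graph E w \<longleftrightarrow>
     weighted_oriented_graph E w \<and>
     (\<forall>u v. u \<noteq> v \<longrightarrow> ((u, v) \<in> E \<and> (v, u) \<notin> E) \<or> ((v, u) \<in> E \<and> (u, v) \<notin> E))"

definition out_nbrs :: "('v \<times> 'v) set \<Rightarrow> 'v \<Rightarrow> 'v set" where
  "out_nbrs E x = {y. (x, y) \<in> E}"

definition closed_out_nbrs :: "('v \<times> 'v) set \<Rightarrow> 'v \<Rightarrow> 'v set" where
  "closed_out_nbrs E x = out_nbrs E x \<union> {x}"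

definition V_plus :: "('v \<Rightarrow> nat) \<Rightarrow> 'v set" where
  "V_plus w = {x. w x \<ge> 2}"

definition out_nbrs_set :: "('v \<times> 'v) set \<Rightarrow> 'v set \<Rightarrow> 'v set" where
  "out_nbrs_set E A = (\<Union>x\<in>A. out_nbrs E x)"

text \<open>The subtractions below are on \<^typ>\<open>nat\<close>; they are used only with weights and \<^term>\<open>k\<close> at least 1.\<close>

definition r_edge :: "('v \<times> 'v) set \<Rightarrow> ('v \<Rightarrow> nat) \<Rightarrow> nat \<Rightarrow> 'v \<Rightarrow> 'v \<Rightarrow> nat" where
  "r_edge E w k i j =
     Max (insert (w j + 1) (w ` (out_nbrs E i \<inter> out_nbrs E j))) * (k - 1)
     + (\<Sum>x \<in> out_nbrs E i \<inter> closed_out_nbrs E j. w x - 1)"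

definition r_vertex :: "('v \<times> 'v) set \<Rightarrow> ('v \<Rightarrow> nat) \<Rightarrow> nat \<Rightarrow> 'v \<Rightarrow> nat" where
  "r_vertex E w k i =
     (if out_nbrs E i = {} then 1 else Max (w ` out_nbrs E i)) * (k - 1)
     + (\<Sum>x \<in> out_nbrs E i. w x - 1)"


section \<open>Ideals, associated primes and symbolic powers\<close>

text \<open>Ideals of a commutative ring are the submodules of the ring over itself.\<close>

global_interpretation ideal: module "(*) :: 'a::comm_ring_1 \<Rightarrow> 'a \<Rightarrow> 'a"
  by unfold_locales (simp_all add: algebra_simps)

abbreviation is_ideal :: "'a::comm_ring_1 set \<Rightarrow> bool" where
  "is_ideal \<equiv> ideal.subspace"

abbreviation ideal_gen :: "'a::comm_ring_1 set \<Rightarrow> 'a set" where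
  "ideal_gen \<equiv> ideal.span"

definition ideal_mult :: "'a::comm_ring_1 set \<Rightarrow> 'a set \<Rightarrow> 'a set" where
  "ideal_mult I J = ideal_gen {a * b | a b. a \<in> I \<and> b \<in> J}"

primrec ideal_power :: "'a::comm_ring_1 set \<Rightarrow> nat \<Rightarrow> 'a set" where
  "ideal_power I 0 = UNIV"
| "ideal_power I (Suc k) = ideal_mult I (ideal_power I k)"

definition prime_ideal :: "'a::comm_ring_1 set \<Rightarrow> bool" where
  "prime_ideal P \<longleftrightarrow> is_ideal P \<and> P \<noteq> UNIV \<and> (\<forall>a b. a * b \<in> P \<longrightarrow> a \<in> P \<or> b \<in> P)"

text \<open>\<open>Ass(R/I)\<close>: the primes of the form \<open>ann(f + I)\<close>.\<close>

definition Ass :: "'a::comm_ring_1 set \<Rightarrow> 'a set set" where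
  "Ass I = {P. prime_ideal P \<and> (\<exists>f. P = {r. r * f \<in> I})}"

text \<open>For a domain \<open>R\<close> and a prime \<open>P\<close>, the localization \<open>R\<^sub>P\<close> is taken inside the fraction field.\<close>

definition localization :: "'a::idom set \<Rightarrow> 'a fract set" where
  "localization P = {Fract a s | a s. s \<notin> P}"

definition extended_ideal :: "'a::idom set \<Rightarrow> 'a set \<Rightarrow> 'a fract set" where
  "extended_ideal J P =
     {(\<Sum>i<m. c i * Fract (a i) 1) | (m::nat) c a. (\<forall>i<m. c i \<in> localization P \<and> a i \<in> J)}"

definition contraction :: "'a::idom fract set \<Rightarrow> 'a set" where
  "contraction J = {f. Fract f 1 \<in> J}"

definition symbolic_power :: "'a::idom set \<Rightarrow> nat \<Rightarrow> 'a set" where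
  "symbolic_power I k = (\<Inter>P \<in> Ass I. contraction (extended_ideal (ideal_power I k) P))"


section \<open>The polynomial ring and edge ideals\<close>

text \<open>
  Exponent vectors are \<^typ>\<open>'v \<Rightarrow>\<^sub>0 nat\<close>. The linear order on \<^typ>\<open>'v\<close> that is required
  from here on only serves to obtain the library's proof that the polynomial ring is a domain.
\<close>

type_synonym ('v, 'k) mpoly = "('v \<Rightarrow>\<^sub>0 nat) \<Rightarrow>\<^sub>0 'k"

definition Var :: "'v \<Rightarrow> ('v, 'k::field) mpoly" where
  "Var x = Poly_Mapping.single (Poly_Mapping.single x 1) 1"

definition edge_ideal :: "('v::{finite,linorder} \<times> 'v) set \<Rightarrow> ('v \<Rightarrow> nat) \<Rightarrow> ('v, 'k::field) mpoly set" where
  "edge_ideal E w = ideal_gen {Var x * Var y ^ w y | x y. (x, y) \<in> E}"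

definition monom_deg :: "('v::finite \<Rightarrow>\<^sub>0 nat) \<Rightarrow> nat" where
  "monom_deg m = (\<Sum>v\<in>UNIV. Poly_Mapping.lookup m v)"

text \<open>Zero is homogeneous of every degree, and it is the only element of negative degree.\<close>

definition homogeneous :: "int \<Rightarrow> ('v::finite, 'k::field) mpoly \<Rightarrow> bool" where
  "homogeneous d f \<longleftrightarrow> (\<forall>m \<in> Poly_Mapping.keys f. int (monom_deg m) = d)"

definition irrelevant_ideal :: "('v::finite, 'k::field) mpoly set" where
  "irrelevant_ideal = ideal_gen (range Var)"


section \<open>Minimal graded free resolutions, Betti numbers and regularity\<close>

text \<open>
  A record \<open>F\<close> of this type describes a sequence of graded free modules and matrices
  \<open>\<dots> \<rightarrow> F\<^sub>2 \<rightarrow> F\<^sub>1 \<rightarrow> F\<^sub>0 \<rightarrow> R\<close>, where \<open>F\<^sub>i\<close> is the direct sum of the \<open>R(-res_shift F i l)\<close>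
  over \<open>l < res_rank F i\<close>.
  The matrix \<open>res_diff F i\<close> is that of \<open>F\<^sub>i\<^sub>+\<^sub>1 \<rightarrow> F\<^sub>i\<close> (first index: row), and
  \<open>res_aug F\<close> is the single row of \<open>F\<^sub>0 \<rightarrow> R\<close>.
\<close>

record 'a free_res =
  res_rank :: "nat \<Rightarrow> nat"
  res_shift :: "nat \<Rightarrow> nat \<Rightarrow> int"
  res_aug :: "nat \<Rightarrow> 'a"
  res_diff :: "nat \<Rightarrow> nat \<Rightarrow> nat \<Rightarrow> 'a"

definition free_module :: "('a::comm_ring_1) free_res \<Rightarrow> nat \<Rightarrow> (nat \<Rightarrow> 'a) set" where
  "free_module F i = {u. \<forall>l \<ge> res_rank F i. u l = 0}"

definition apply_aug :: "('a::comm_ring_1) free_res \<Rightarrow> (nat \<Rightarrow> 'a) \<Rightarrow> 'a" where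
  "apply_aug F u = (\<Sum>l < res_rank F 0. u l * res_aug F l)"

definition apply_diff :: "('a::comm_ring_1) free_res \<Rightarrow> nat \<Rightarrow> (nat \<Rightarrow> 'a) \<Rightarrow> (nat \<Rightarrow> 'a)" where
  "apply_diff F i u =
     (\<lambda>p. if p < res_rank F i then \<Sum>l < res_rank F (Suc i). res_diff F i p l * u l else 0)"

definition free_resolution :: "('a::comm_ring_1) set \<Rightarrow> 'a free_res \<Rightarrow> bool" where
  "free_resolution I F \<longleftrightarrow>
     apply_aug F ` free_module F 0 = I \<and>
     {u \<in> free_module F 0. apply_aug F u = 0} = apply_diff F 0 ` free_module F (Suc 0) \<and>
     (\<forall>i. {u \<in> free_module F (Suc i). apply_diff F i u = (\<lambda>_. 0)}
            = apply_diff F (Suc i) ` free_module F (Suc (Suc i)))"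

text \<open>All maps are homogeneous of degree 0 with respect to the shifts.\<close>

definition graded_res :: "('v::finite, 'k::field) mpoly free_res \<Rightarrow> bool" where
  "graded_res F \<longleftrightarrow>
     (\<forall>l < res_rank F 0. homogeneous (res_shift F 0 l) (res_aug F l)) \<and>
     (\<forall>i. \<forall>p < res_rank F i. \<forall>l < res_rank F (Suc i).
        homogeneous (res_shift F (Suc i) l - res_shift F i p) (res_diff F i p l))"

text \<open>The image of \<open>F\<^sub>i\<^sub>+\<^sub>1\<close> lies in \<open>(x\<^sub>1, \<dots>, x\<^sub>n) F\<^sub>i\<close>.\<close>

definition minimal_res :: "('v::finite, 'k::field) mpoly free_res \<Rightarrow> bool" where
  "minimal_res F \<longleftrightarrow>
     (\<forall>i. \<forall>p < res_rank F i. \<forall>l < res_rank F (Suc i). res_diff F i p l \<in> irrelevant_ideal)"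

definition minimal_graded_free_resolution ::
    "('v::finite, 'k::field) mpoly set \<Rightarrow> ('v, 'k) mpoly free_res \<Rightarrow> bool" where
  "minimal_graded_free_resolution I F \<longleftrightarrow> free_resolution I F \<and> graded_res F \<and> minimal_res F"

text \<open>
  The minimal graded free resolution of a homogeneous ideal is unique up to isomorphism, so the
  choice made here does not matter. The resolution is that of \<open>I\<close>, not of \<open>R/I\<close>.
\<close>

definition betti :: "('v::finite, 'k::field) mpoly set \<Rightarrow> nat \<Rightarrow> int \<Rightarrow> nat" where
  "betti I i j =
     (let F = (SOME F. minimal_graded_free_resolution I F)
      in card {l. l < res_rank F i \<and> res_shift F i l = j})"

definition reg :: "('v::finite, 'k::field) mpoly set \<Rightarrow> int" where
  "reg I = Max {j - int i | i j. betti I i j \<noteq> 0}"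

end

theory Submission
  imports Defs "HOL-Library.Function_Algebras"
begin

text \<open>
  Since \<open>N\<^sup>+(V\<^sup>+) \<noteq> V\<close>, the associated primes of \<open>I\<close> are the \<open>P\<^sub>i\<close> generated by all variables
  except \<open>x\<^sub>i\<close>, and \<open>I\<^bsup>(k)\<^esup>\<close> is the intersection of the \<open>k\<close>-th powers of the \<open>P\<^sub>i\<close>-primary components
  \<open>(x\<^sub>j\<^bsup>w(x\<^sub>j)\<^esup> : i \<rightarrow> j) + (x\<^sub>j : j \<rightarrow> i)\<close>. Hence \<open>R/I\<^bsup>(k)\<^esup>\<close> is Cohen--Macaulay of dimension 1, the sum
  \<open>l\<close> of all variables is a nonzerodivisor on it over every field, and \<open>reg I\<^bsup>(k)\<^esup> = t + 1\<close> where \<open>t\<close> is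
  the top degree of \<open>R/(I\<^bsup>(k)\<^esup> + (l))\<close>.

  The monomials outside \<open>I\<^bsup>(k)\<^esup>\<close> form rays in the directions of the variables. Off its direction the
  ray of \<open>i\<close> has degree at most \<open>r\<^sub>i(k)\<close>, and the rays of \<open>i\<close> and \<open>j\<close> meet in degrees up to
  \<open>r\<^sub>i\<^sub>j(k)\<close>; this makes \<open>t\<close> the maximum of the \<open>r\<^sub>i(k)\<close> and the \<open>r\<^sub>i\<^sub>j(k) + 1\<close>.

  Regularity is compared with the shifts of a resolution along \<open>0 \<rightarrow> Z \<rightarrow> F \<rightarrow> M \<rightarrow> 0\<close> by the
  Bayer--Stillman criterion for the linear forms \<open>l, x\<^sub>2, \<dots>, x\<^sub>n\<close>, which passes from \<open>M\<close> to \<open>Z\<close> and back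
  with a shift by 1, so that no derived functors are needed.
\<close>

section \<open>Graded families and linear regularity\<close>

text \<open>The usual criterion takes generic linear forms, which a finite field may not have. Here
  \<open>linear_form\<close> suffices: each ray of standard monomials is unbounded in one variable
  only, and that variable occurs in the form. It has to come first among the forms, since R/J has
  depth 1 and no single variable is regular on it.

  The definition of \<open>betti\<close> chooses a resolution, so one must be constructed. A
  regularity bound r gives finite generation of each syzygy module: its finite-dimensional pieces up
  to degree r generate the rest. Each step raises regularity and depth (the counter
  \<open>p\<close>) by one. Once the depth exceeds the number of forms, regularity holds for every
  bound, and a descent from there shows that some shift attains the maximum.

  As for the formula: r_i(k) is the largest degree of a monomial on the ray of i that is free of
  x_i, and in the top degree such a monomial is no multiple of l modulo the ideal. For a monomial
  x^a on two rays, of degree r_ij(k), the candidate is the part of l x^a on one of them, one degree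
  higher; hence 2 is added for edges and 1 for vertices.\<close>

definition fam_sum :: "(int \<Rightarrow> 'm::ab_group_add set) \<Rightarrow> (int \<Rightarrow> 'm set) \<Rightarrow> int \<Rightarrow> 'm set" (infixl \<open>\<oplus>\<close> 65) where
  "(X \<oplus> Y) d = {x + y | x y. x \<in> X d \<and> y \<in> Y d}"

definition shift_image :: "('m \<Rightarrow> 'm) \<Rightarrow> (int \<Rightarrow> 'm set) \<Rightarrow> int \<Rightarrow> 'm set" (infixr \<open>\<bullet>\<close> 75) where
  "(f \<bullet> X) d = f ` X (d - 1)"

text \<open>Quotients are never formed: the module (X + B)/B stays a pair of families, and dividing
  it by f means replacing B by \<open>B \<oplus> f \<bullet> X\<close>.\<close>

primrec adjoin :: "(int \<Rightarrow> 'm::ab_group_add set) \<Rightarrow> (int \<Rightarrow> 'm set) \<Rightarrow> ('m \<Rightarrow> 'm) list \<Rightarrow> int \<Rightarrow> 'm set" where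
  "adjoin X B [] = B"
| "adjoin X B (f # fs) = adjoin X (B \<oplus> f \<bullet> X) fs"

primrec regular_seq :: "(int \<Rightarrow> 'm::ab_group_add set) \<Rightarrow> (int \<Rightarrow> 'm set) \<Rightarrow> ('m \<Rightarrow> 'm) list \<Rightarrow> bool" where
  "regular_seq X B [] \<longleftrightarrow> True"
| "regular_seq X B (f # fs) \<longleftrightarrow>
     (\<forall>d. \<forall>x\<in>X d. f x \<in> B (d + 1) \<longrightarrow> x \<in> B d) \<and> regular_seq X (B \<oplus> f \<bullet> X) fs"

text \<open>
  For a family \<open>B\<close> of subgroups, this is a property of the graded module \<open>(X + B)/B\<close>: it is
  \<open>r\<close>-regular in the sense of the Bayer--Stillman criterion for the linear forms \<open>fs\<close>, and the
  first \<open>p\<close> of these forms are a regular sequence on it.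
\<close>

primrec linear_regular :: "(int \<Rightarrow> 'm::ab_group_add set) \<Rightarrow> (int \<Rightarrow> 'm set) \<Rightarrow> ('m \<Rightarrow> 'm) list \<Rightarrow> nat \<Rightarrow> int \<Rightarrow> bool" where
  "linear_regular X B [] p r \<longleftrightarrow> (\<forall>d. 0 < p \<or> r < d \<longrightarrow> X d \<subseteq> B d)"
| "linear_regular X B (f # fs) p r \<longleftrightarrow>
     (\<forall>d. 0 < p \<or> r < d \<longrightarrow> (\<forall>x\<in>X d. f x \<in> B (d + 1) \<longrightarrow> x \<in> B d)) \<and>
     linear_regular X (B \<oplus> f \<bullet> X) fs (p - 1) r"

lemma fam_sumI: "x \<in> X d \<Longrightarrow> y \<in> Y d \<Longrightarrow> x + y \<in> (X \<oplus> Y) d"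
  by (auto simp: fam_sum_def)

lemma shift_imageI: "x \<in> X d \<Longrightarrow> f x \<in> (f \<bullet> X) (d + 1)"
  by (auto simp: shift_image_def)

lemma fam_sumE:
  assumes "z \<in> (X \<oplus> Y) d"
  obtains x y where "x \<in> X d" "y \<in> Y d" "z = x + y"
  using assms by (auto simp: fam_sum_def)

lemma fam_sum_shiftE:
  assumes "z \<in> (X \<oplus> f \<bullet> Y) d"
  obtains x y where "x \<in> X d" "y \<in> Y (d - 1)" "z = x + f y"
  using assms by (auto simp: fam_sum_def shift_image_def)

lemma extend_iff: "z \<in> (D \<oplus> f \<bullet> X) d \<longleftrightarrow> (\<exists>y\<in>X (d - 1). z - f y \<in> D d)"
proof
  assume "z \<in> (D \<oplus> f \<bullet> X) d"
  then show "\<exists>y\<in>X (d - 1). z - f y \<in> D d"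
    by (elim fam_sum_shiftE) (metis add_diff_cancel_right')
next
  assume "\<exists>y\<in>X (d - 1). z - f y \<in> D d"
  then obtain y where "y \<in> X (d - 1)" "z - f y \<in> D d" by blast
  then have "(z - f y) + f y \<in> (D \<oplus> f \<bullet> X) d"
    by (intro fam_sumI) (auto simp: shift_image_def)
  then show "z \<in> (D \<oplus> f \<bullet> X) d" by simp
qed

lemma fam_sum_assoc: "X \<oplus> Y \<oplus> Z = X \<oplus> (Y \<oplus> Z)"
proof (intro ext set_eqI iffI)
  fix d z
  assume "z \<in> (X \<oplus> Y \<oplus> Z) d"
  then show "z \<in> (X \<oplus> (Y \<oplus> Z)) d"
    unfolding fam_sum_def by clarsimp (metis add.assoc)
next
  fix d z
  assume "z \<in> (X \<oplus> (Y \<oplus> Z)) d"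
  then show "z \<in> (X \<oplus> Y \<oplus> Z) d"
    unfolding fam_sum_def by clarsimp (metis add.assoc)
qed

lemma fam_sum_commute: "X \<oplus> Y = Y \<oplus> X"
  unfolding fam_sum_def by (intro ext) (use add.commute in blast)

lemma fam_sum_right_commute: "X \<oplus> Y \<oplus> Z = X \<oplus> Z \<oplus> Y"
  unfolding fam_sum_assoc fam_sum_commute[of Y Z] ..

lemma linear_regular_mono:
  "linear_regular X B fs p r \<Longrightarrow> q \<le> p \<Longrightarrow> r \<le> s \<Longrightarrow> linear_regular X B fs q s"
proof (induction fs arbitrary: B p q)
  case Nil
  then show ?case by fastforce
next
  case (Cons f fs)
  have "linear_regular X (B \<oplus> f \<bullet> X) fs (q - 1) s"
    using Cons.IH[of "B \<oplus> f \<bullet> X" "p - 1" "q - 1"] Cons.prems by auto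
  moreover have "0 < p \<or> r < d" if "0 < q \<or> s < d" for d
    using that Cons.prems by auto
  ultimately show ?case
    using Cons.prems(1) unfolding linear_regular.simps by blast
qed

text \<open>The test \<open>0 < p\<close> stays true down to the empty list, so every condition
  holds in every degree, whatever p and r are. This starts the descent along a resolution.\<close>

lemma linear_regular_long:
  "linear_regular X B fs p r \<Longrightarrow> length fs < p \<Longrightarrow> linear_regular X B fs q s"
  by (induction fs arbitrary: B p q) auto

text \<open>Only the clause for the empty list matters: modulo all forms nothing is left above
  degree r, so r bounds the degrees of generators.\<close>

lemma linear_regular_adjoin:
  "linear_regular X B fs p r \<Longrightarrow> r < d \<Longrightarrow> X d \<subseteq> adjoin X B fs d"
  by (induction fs arbitrary: B p) auto

text \<open>The comparison arguments use only that the forms act additively and commute; the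
  instance is multiplication of vectors by linear forms.\<close>

locale commuting_operators =
  fixes Ops :: "('m::ab_group_add \<Rightarrow> 'm) set"
  assumes op_add: "f \<in> Ops \<Longrightarrow> f (x + y) = f x + f y"
    and op_comm: "f \<in> Ops \<Longrightarrow> g \<in> Ops \<Longrightarrow> f (g x) = g (f x)"
begin

definition graded :: "(int \<Rightarrow> 'm set) \<Rightarrow> bool" where
  "graded X \<longleftrightarrow> (\<forall>d. 0 \<in> X d \<and> (\<forall>x\<in>X d. - x \<in> X d \<and> (\<forall>y\<in>X d. x + y \<in> X d))) \<and>
     (\<forall>f\<in>Ops. \<forall>d. \<forall>x\<in>X d. f x \<in> X (d + 1))"

section \<open>Graded families of subgroups\<close>

lemma op_0: "f \<in> Ops \<Longrightarrow> f 0 = 0"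
  using op_add[of f 0 0] by simp

lemma op_minus: "f \<in> Ops \<Longrightarrow> f (- x) = - f x"
  using op_add[of f x "- x"] op_0[of f] by (simp add: eq_neg_iff_add_eq_0 add.commute)

lemma op_diff: "f \<in> Ops \<Longrightarrow> f (x - y) = f x - f y"
  using op_add[of f x "- y"] op_minus[of f y] by simp

lemma graded_0: "graded X \<Longrightarrow> 0 \<in> X d"
  and graded_add: "graded X \<Longrightarrow> x \<in> X d \<Longrightarrow> y \<in> X d \<Longrightarrow> x + y \<in> X d"
  and graded_minus: "graded X \<Longrightarrow> x \<in> X d \<Longrightarrow> - x \<in> X d"
  and graded_op: "graded X \<Longrightarrow> f \<in> Ops \<Longrightarrow> x \<in> X d \<Longrightarrow> f x \<in> X (d + 1)"
  unfolding graded_def by blast+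

lemma graded_diff: "graded X \<Longrightarrow> x \<in> X d \<Longrightarrow> y \<in> X d \<Longrightarrow> x - y \<in> X d"
  using graded_add[of X x d "- y"] graded_minus[of X y d] by simp

lemma graded_op': "graded X \<Longrightarrow> f \<in> Ops \<Longrightarrow> x \<in> X (d - 1) \<Longrightarrow> f x \<in> X d"
  using graded_op[of X f x "d - 1"] by simp

lemma graded_fam_sum:
  assumes "graded X" "graded Y"
  shows "graded (X \<oplus> Y)"
  unfolding graded_def
proof (intro conjI allI ballI)
  fix d
  show "0 \<in> (X \<oplus> Y) d"
    using fam_sumI[of 0 X d 0 Y] assms by (simp add: graded_0)
  fix x assume "x \<in> (X \<oplus> Y) d"
  then obtain a b where x: "a \<in> X d" "b \<in> Y d" "x = a + b"
    by (rule fam_sumE)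
  show "- x \<in> (X \<oplus> Y) d"
    using fam_sumI[of "- a" X d "- b" Y] x assms by (simp add: graded_minus)
  fix y assume "y \<in> (X \<oplus> Y) d"
  then obtain a' b' where y: "a' \<in> X d" "b' \<in> Y d" "y = a' + b'"
    by (rule fam_sumE)
  show "x + y \<in> (X \<oplus> Y) d"
    using fam_sumI[of "a + a'" X d "b + b'" Y] x y assms by (simp add: graded_add ac_simps)
next
  fix f d x assume f: "f \<in> Ops" and "x \<in> (X \<oplus> Y) d"
  then obtain a b where x: "a \<in> X d" "b \<in> Y d" "x = a + b"
    by (elim fam_sumE)
  show "f x \<in> (X \<oplus> Y) (d + 1)"
    using fam_sumI[of "f a" X "d + 1" "f b" Y] x f assms by (simp add: graded_op op_add)
qed

lemma graded_shift_image:
  assumes X: "graded X" and f: "f \<in> Ops"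
  shows "graded (f \<bullet> X)"
  unfolding graded_def
proof (intro conjI allI ballI)
  fix d
  show "0 \<in> (f \<bullet> X) d"
    using graded_0[OF X] op_0[OF f] by (force simp: shift_image_def)
  fix x assume "x \<in> (f \<bullet> X) d"
  then obtain a where x: "a \<in> X (d - 1)" "x = f a"
    by (auto simp: shift_image_def)
  show "- x \<in> (f \<bullet> X) d"
    using graded_minus[OF X x(1)] x(2) op_minus[OF f, of a] unfolding shift_image_def by (metis imageI)
  fix y assume "y \<in> (f \<bullet> X) d"
  then obtain b where y: "b \<in> X (d - 1)" "y = f b"
    by (auto simp: shift_image_def)
  show "x + y \<in> (f \<bullet> X) d"
    using graded_add[OF X x(1) y(1)] x(2) y(2) op_add[OF f, of a b] unfolding shift_image_def by (metis imageI)
next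
  fix g d x assume g: "g \<in> Ops" and "x \<in> (f \<bullet> X) d"
  then obtain a where x: "a \<in> X (d - 1)" "x = f a"
    by (auto simp: shift_image_def)
  show "g x \<in> (f \<bullet> X) (d + 1)"
    using graded_op'[OF X g x(1)] x op_comm[OF g f] by (auto simp: shift_image_def)
qed

lemma graded_extend: "graded X \<Longrightarrow> graded B \<Longrightarrow> f \<in> Ops \<Longrightarrow> graded (B \<oplus> f \<bullet> X)"
  by (intro graded_fam_sum graded_shift_image)

lemma fam_sum_right: "graded X \<Longrightarrow> y \<in> Y d \<Longrightarrow> y \<in> (X \<oplus> Y) d"
  using fam_sumI[of 0 X d y Y] by (simp add: graded_0)

lemma fam_sum_left: "graded Y \<Longrightarrow> x \<in> X d \<Longrightarrow> x \<in> (X \<oplus> Y) d"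
  using fam_sumI[of x X d 0 Y] by (simp add: graded_0)

lemma extend_left: "graded X \<Longrightarrow> f \<in> Ops \<Longrightarrow> x \<in> B d \<Longrightarrow> x \<in> (B \<oplus> f \<bullet> X) d"
  by (intro fam_sum_left graded_shift_image)

lemma extend_right: "graded B \<Longrightarrow> x \<in> X d \<Longrightarrow> f x \<in> (B \<oplus> f \<bullet> X) (d + 1)"
  by (intro fam_sum_right shift_imageI)

text \<open>Agreement of B and C in the tested degrees suffices: a test in degree d looks at d and d
  + 1 only, and membership in \<open>B \<oplus> f \<bullet> X\<close> in degree d is decided by B in
  the same degree.\<close>

lemma linear_regular_cong_imp:
  assumes X: "graded X"
  shows "set fs \<subseteq> Ops \<Longrightarrow>
    (\<And>d x. 0 < p \<or> r < d \<Longrightarrow> x \<in> X d \<Longrightarrow> x \<in> B d \<longleftrightarrow> x \<in> C d) \<Longrightarrow>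
    linear_regular X B fs p r \<Longrightarrow> linear_regular X C fs p r"
proof (induction fs arbitrary: B C p)
  case Nil
  then show ?case by fastforce
next
  case (Cons f fs)
  note eq = Cons.prems(2)
  have f: "f \<in> Ops"
    using Cons.prems(1) by simp
  have "x \<in> (B \<oplus> f \<bullet> X) d \<longleftrightarrow> x \<in> (C \<oplus> f \<bullet> X) d" if d: "0 < p - 1 \<or> r < d" and x: "x \<in> X d" for d x
  proof -
    have *: "x - f y \<in> B d \<longleftrightarrow> x - f y \<in> C d" if "y \<in> X (d - 1)" for y
      using eq[of d "x - f y"] d graded_diff[OF X x graded_op'[OF X f that]] by auto
    then show ?thesis
      unfolding extend_iff by blast
  qed
  then have "linear_regular X (C \<oplus> f \<bullet> X) fs (p - 1) r"
    using Cons.IH[of "p - 1" "B \<oplus> f \<bullet> X" "C \<oplus> f \<bullet> X"] Cons.prems by auto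
  moreover have "x \<in> C d" if d: "0 < p \<or> r < d" and x: "x \<in> X d" "f x \<in> C (d + 1)" for d x
  proof -
    have "f x \<in> B (d + 1)"
      using eq[of "d + 1" "f x"] d x graded_op[OF X f x(1)] by auto
    then have "x \<in> B d"
      using Cons.prems(3) d x by auto
    then show ?thesis
      using eq d x by auto
  qed
  ultimately show ?case
    by simp
qed

lemma linear_regular_cong:
  assumes "graded X" "set fs \<subseteq> Ops"
    and "\<And>d x. 0 < p \<or> r < d \<Longrightarrow> x \<in> X d \<Longrightarrow> x \<in> B d \<longleftrightarrow> x \<in> C d"
  shows "linear_regular X B fs p r \<longleftrightarrow> linear_regular X C fs p r"
  using linear_regular_cong_imp[OF assms(1,2), of p r B C]
    linear_regular_cong_imp[OF assms(1,2), of p r C B] assms(3) by blast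

text \<open>The map induces an isomorphism of X modulo B with Y modulo C that commutes with the
  forms.\<close>

lemma linear_regular_transport:
  assumes add: "\<And>x y. \<phi> (x + y) = \<phi> x + \<phi> y"
    and comm: "\<And>f x. f \<in> Ops \<Longrightarrow> \<phi> (f x) = f (\<phi> x)"
    and X: "graded X" and im: "\<And>d. \<phi> ` X d = Y d"
  shows "set fs \<subseteq> Ops \<Longrightarrow> (\<And>d x. x \<in> X d \<Longrightarrow> x \<in> B d \<longleftrightarrow> \<phi> x \<in> C d) \<Longrightarrow>
    linear_regular X B fs p r \<longleftrightarrow> linear_regular Y C fs p r"
proof (induction fs arbitrary: B C p)
  case Nil
  then show ?case
    by (auto simp flip: im simp: subset_iff)
next
  case (Cons f fs)
  note eq = Cons.prems(2)
  have f: "f \<in> Ops"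
    using Cons.prems(1) by simp
  have \<phi>_diff: "\<phi> (x - y) = \<phi> x - \<phi> y" for x y
    using add[of "x - y" y] by (simp add: algebra_simps)
  have "x \<in> (B \<oplus> f \<bullet> X) d \<longleftrightarrow> \<phi> x \<in> (C \<oplus> f \<bullet> Y) d" if x: "x \<in> X d" for d x
  proof -
    have *: "x - f y \<in> B d \<longleftrightarrow> \<phi> x - f (\<phi> y) \<in> C d" if "y \<in> X (d - 1)" for y
      using eq[OF graded_diff[OF X x graded_op'[OF X f that]]] comm[OF f] \<phi>_diff by auto
    show ?thesis
      unfolding extend_iff im[symmetric] using * by auto
  qed
  then have "linear_regular X (B \<oplus> f \<bullet> X) fs (p - 1) r \<longleftrightarrow> linear_regular Y (C \<oplus> f \<bullet> Y) fs (p - 1) r"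
    using Cons.IH[of "B \<oplus> f \<bullet> X" "C \<oplus> f \<bullet> Y"] Cons.prems by auto
  moreover have "(f x \<in> B (d + 1) \<longrightarrow> x \<in> B d) \<longleftrightarrow> (f (\<phi> x) \<in> C (d + 1) \<longrightarrow> \<phi> x \<in> C d)" if x: "x \<in> X d" for d x
    using eq[OF x] eq[OF graded_op[OF X f x]] comm[OF f] by simp
  ultimately show ?case
    unfolding linear_regular.simps im[symmetric] ball_simps by blast
qed

text \<open>
  \<open>Z\<close> is the syzygy module of \<open>F/(Z + W)\<close> over \<open>F/W\<close>. The comparison of \<open>Z/(W + fF)\<close> with
  \<open>Z/(W + fZ)\<close> is the exact sequence of \<open>Tor(-, F/fF)\<close>.
\<close>

lemma syzygy_extend:
  assumes W: "graded W" and Z: "graded Z" and f: "f \<in> Ops"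
    and ZF: "\<And>d. Z d \<subseteq> F d"
    and colon: "\<And>x. x \<in> F (d - 1) \<Longrightarrow> f x \<in> (Z \<oplus> W) d \<Longrightarrow> x \<in> (Z \<oplus> W) (d - 1)"
    and z: "z \<in> Z d"
  shows "z \<in> (W \<oplus> f \<bullet> F) d \<longleftrightarrow> z \<in> (W \<oplus> f \<bullet> Z) d"
proof
  assume "z \<in> (W \<oplus> f \<bullet> F) d"
  then obtain u x where x: "u \<in> W d" "x \<in> F (d - 1)" "z = u + f x"
    by (rule fam_sum_shiftE)
  then have "f x = z + - u"
    by (simp add: algebra_simps)
  also have "\<dots> \<in> (Z \<oplus> W) d"
    using z graded_minus[OF W x(1)] by (rule fam_sumI)
  finally obtain z' u' where x': "z' \<in> Z (d - 1)" "u' \<in> W (d - 1)" "x = z' + u'"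
    using colon[OF x(2)] by (auto elim: fam_sumE)
  then have "z = (u + f u') + f z'"
    using x by (simp add: op_add[OF f] algebra_simps)
  moreover have "u + f u' \<in> W d"
    using graded_add[OF W x(1) graded_op'[OF W f x'(2)]] .
  ultimately show "z \<in> (W \<oplus> f \<bullet> Z) d"
    using x'(1) by (auto simp: fam_sum_def shift_image_def)
next
  assume "z \<in> (W \<oplus> f \<bullet> Z) d"
  then show "z \<in> (W \<oplus> f \<bullet> F) d"
    using ZF by (fastforce simp: fam_sum_def shift_image_def)
qed

text \<open>Induction over the forms treats Z modulo \<open>W \<oplus> f \<bullet> F\<close>, and
  \<open>syzygy_extend\<close> replaces this by Z modulo \<open>W \<oplus> f \<bullet> Z\<close>
  wherever f is injective on F/(Z + W). Since f is regular on F/W, it is injective on Z modulo W in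
  all degrees; this is the gain of one in depth. For the empty list the gain is the inclusion of Z
  in \<open>adjoin F W fs\<close>, which expresses minimality.\<close>

lemma linear_regular_syzygy:
  assumes F: "graded F" and Z: "graded Z" and ZF: "\<And>d. Z d \<subseteq> F d"
  shows "graded W \<Longrightarrow> set fs \<subseteq> Ops \<Longrightarrow> regular_seq F W fs \<Longrightarrow>
    (\<And>d. Z d \<subseteq> adjoin F W fs d) \<Longrightarrow>
    linear_regular F (Z \<oplus> W) fs p r \<Longrightarrow> linear_regular Z W fs (Suc p) (r + 1)"
proof (induction fs arbitrary: W p)
  case Nil
  then show ?case by simp
next
  case (Cons f fs)
  note W = Cons.prems(1)
  have f: "f \<in> Ops"
    using Cons.prems(2) by simp
  have "linear_regular Z (W \<oplus> f \<bullet> F) fs (Suc (p - 1)) (r + 1)"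
    using Cons.IH[of "W \<oplus> f \<bullet> F" "p - 1"] Cons.prems graded_extend[OF F W f] by (simp add: fam_sum_assoc)
  then have "linear_regular Z (W \<oplus> f \<bullet> F) fs p (r + 1)"
    by (rule linear_regular_mono) auto
  \<comment> \<open>Injectivity of f on F/(Z + W) is used in degree d - 1, which is why the bound
    becomes r + 1.\<close>
  moreover have "z \<in> (W \<oplus> f \<bullet> F) d \<longleftrightarrow> z \<in> (W \<oplus> f \<bullet> Z) d" if "0 < p \<or> r + 1 < d" "z \<in> Z d" for d z
  proof (rule syzygy_extend[OF W Z f ZF _ that(2)])
    fix x assume x: "x \<in> F (d - 1)" "f x \<in> (Z \<oplus> W) d"
    then show "x \<in> (Z \<oplus> W) (d - 1)"
      using Cons.prems(5) that(1) by (auto dest!: spec[where x = "d - 1"])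
  qed
  ultimately have "linear_regular Z (W \<oplus> f \<bullet> Z) fs p (r + 1)"
    using linear_regular_cong[OF Z, of fs p "r + 1" "W \<oplus> f \<bullet> F" "W \<oplus> f \<bullet> Z"] Cons.prems(2) by auto
  moreover have "z \<in> W d" if "z \<in> Z d" "f z \<in> W (d + 1)" for d z
    using Cons.prems(3) that ZF by auto
  ultimately show ?case
    by simp
qed

text \<open>The way back needs generators of F modulo W in degrees at most s and some regularity
  bound r to start from. The difficulty is the injectivity of f on F/(Z + W) above s; once it is
  known, \<open>syzygy_extend\<close> allows the induction over the forms.\<close>

lemma linear_regular_of_syzygy:
  assumes F: "graded F" and Z: "graded Z" and ZF: "\<And>d. Z d \<subseteq> F d"
  shows "graded W \<Longrightarrow> set fs \<subseteq> Ops \<Longrightarrow> regular_seq F W fs \<Longrightarrow>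
    (\<And>d. s < d \<Longrightarrow> F d \<subseteq> adjoin F W fs d) \<Longrightarrow> linear_regular F (Z \<oplus> W) fs 0 r \<Longrightarrow>
    linear_regular Z W fs 0 (s + 1) \<Longrightarrow> linear_regular F (Z \<oplus> W) fs 0 s"
proof (induction fs arbitrary: W)
  case Nil
  then show ?case
    using fam_sum_right[OF Z, of _ W] by force
next
  case (Cons f fs)
  note W = Cons.prems(1)
  have f: "f \<in> Ops" and fs: "set fs \<subseteq> Ops"
    using Cons.prems(2) by simp_all
  note ZW = graded_fam_sum[OF Z W]
  have reg: "linear_regular Z (W \<oplus> f \<bullet> Z) fs 0 (s + 1)"
    using Cons.prems(6) by simp
  \<comment> \<open>Descending induction on d: above r the claim is part of the hypothesis.\<close>
  have colon: "s < d \<longrightarrow> (\<forall>x\<in>F d. f x \<in> (Z \<oplus> W) (d + 1) \<longrightarrow> x \<in> (Z \<oplus> W) d)" for d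
  proof (induction "nat (r + 1 - d)" arbitrary: d rule: less_induct)
    case less
    show ?case
    proof (intro impI ballI)
      fix x assume d: "s < d" and x: "x \<in> F d" "f x \<in> (Z \<oplus> W) (d + 1)"
      show "x \<in> (Z \<oplus> W) d"
      proof (cases "r < d")
        case True
        then show ?thesis
          using Cons.prems(5) x by auto
      next
        case False
        obtain z u where z: "z \<in> Z (d + 1)" "u \<in> W (d + 1)" "f x = z + u"
          using x(2) by (rule fam_sumE)
        \<comment> \<open>Regularity of Z modulo \<open>W \<oplus> f \<bullet> Z\<close> detects z
          by the next form g. Multiplying the relation for f x by g puts g x one degree higher,
          where the induction hypothesis applies; this yields the required membership of g z. If no
          form is left, the quotient itself vanishes in this degree.\<close>
        have "z \<in> (W \<oplus> f \<bullet> Z) (d + 1)"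
        proof (cases fs)
          case Nil
          then show ?thesis
            using reg z(1) d by (simp add: subset_iff)
        next
          case (Cons g gs)
          have g: "g \<in> Ops"
            using fs Cons by simp
          have zx: "f (g x) = g z + g u"
            using z(3) op_comm[OF f g] op_add[OF g] by metis
          then have "f (g x) \<in> (Z \<oplus> W) (d + 1 + 1)"
            using graded_op[OF Z g z(1)] graded_op[OF W g z(2)] by (auto intro: fam_sumI)
          moreover have "nat (r + 1 - (d + 1)) < nat (r + 1 - d)"
            using False by simp
          ultimately have "g x \<in> (Z \<oplus> W) (d + 1)"
            using less[of "d + 1"] d graded_op[OF F g x(1)] by auto
          then obtain z' u' where z': "z' \<in> Z (d + 1)" "u' \<in> W (d + 1)" "g x = z' + u'"
            by (rule fam_sumE)
          have "g z = (f u' - g u) + f z'"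
            using zx z'(3) by (simp add: op_add[OF f] algebra_simps)
          moreover have "f u' - g u \<in> W (d + 1 + 1)"
            using graded_diff[OF W graded_op[OF W f z'(2)] graded_op[OF W g z(2)]] .
          ultimately have "g z \<in> (W \<oplus> f \<bullet> Z) (d + 1 + 1)"
            using z'(1) fam_sumI shift_imageI by metis
          then show ?thesis
            using reg Cons z(1) d by auto
        qed
        then obtain u' z' where z': "u' \<in> W (d + 1)" "z' \<in> Z d" "z = u' + f z'"
          by (auto elim: fam_sum_shiftE)
        have "f (x - z') = u' + u"
          using z(3) z'(3) by (simp add: op_diff[OF f])
        then have "f (x - z') \<in> W (d + 1)"
          using graded_add[OF W z'(1) z(2)] by simp
        moreover have "x - z' \<in> F d"
          using graded_diff[OF F x(1)] z'(2) ZF by auto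
        ultimately have "x - z' \<in> W d"
          using Cons.prems(3) by simp
        then have "z' + (x - z') \<in> (Z \<oplus> W) d"
          using z'(2) fam_sumI by blast
        then show ?thesis by simp
      qed
    qed
  qed
  have "z \<in> (W \<oplus> f \<bullet> Z) d \<longleftrightarrow> z \<in> (W \<oplus> f \<bullet> F) d" if "s + 1 < d" "z \<in> Z d" for d z
    using syzygy_extend[OF W Z f ZF _ that(2)] colon[of "d - 1"] that(1) by auto
  then have "linear_regular Z (W \<oplus> f \<bullet> F) fs 0 (s + 1)"
    using linear_regular_cong[OF Z fs, of 0 "s + 1" "W \<oplus> f \<bullet> Z" "W \<oplus> f \<bullet> F"] reg by auto
  then have "linear_regular F (Z \<oplus> (W \<oplus> f \<bullet> F)) fs 0 s"
    using Cons.IH[of "W \<oplus> f \<bullet> F"] Cons.prems graded_extend[OF F W f] by (simp add: fam_sum_assoc)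
  then show ?case
    using colon by (simp add: fam_sum_assoc)
qed

text \<open>Regular sequences may be permuted only by a Nakayama argument, hence the lower bound on
  the degrees of F. It is needed because regularity is easily checked with
  \<open>linear_form\<close> last, while on R/J this form has to act first.\<close>

lemma regular_seq_rotate:
  assumes F: "graded F" and bounded: "\<And>d. d < d0 \<Longrightarrow> F d \<subseteq> {0}" and g: "g \<in> Ops"
  shows "graded B \<Longrightarrow> set fs \<subseteq> Ops \<Longrightarrow> regular_seq F B (fs @ [g]) \<Longrightarrow> regular_seq F B (g # fs)"
proof (induction fs arbitrary: B)
  case Nil
  then show ?case by simp
next
  case (Cons f fs)
  note B = Cons.prems(1)
  have f: "f \<in> Ops"
    using Cons.prems(2) by simp
  have f_reg: "f x \<in> B (d + 1) \<Longrightarrow> x \<in> B d" if "x \<in> F d" for x d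
    using Cons.prems(3) that by simp
  have IH: "regular_seq F (B \<oplus> f \<bullet> F) (g # fs)"
    using Cons.IH[of "B \<oplus> f \<bullet> F"] Cons.prems graded_extend[OF F B f] by simp
  then have g_reg: "g x \<in> (B \<oplus> f \<bullet> F) (d + 1) \<Longrightarrow> x \<in> (B \<oplus> f \<bullet> F) d" if "x \<in> F d" for x d
    using that by simp
  \<comment> \<open>An element killed by g modulo B is f times an element killed by g, one degree
    lower; the degrees of F are bounded below.\<close>
  have 1: "\<forall>x\<in>F d. g x \<in> B (d + 1) \<longrightarrow> x \<in> B d" for d
  proof (induction "nat (d - d0 + 1)" arbitrary: d rule: less_induct)
    case less
    show ?case
    proof (intro ballI impI)
      fix x assume x: "x \<in> F d" "g x \<in> B (d + 1)"
      show "x \<in> B d"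
      proof (cases "d < d0")
        case True
        then show ?thesis
          using bounded[of d] x graded_0[OF B] by auto
      next
        case False
        have "x \<in> (B \<oplus> f \<bullet> F) d"
          using g_reg[OF x(1)] extend_left[where B = B, OF F f x(2)] by simp
        then obtain b y where y: "b \<in> B d" "y \<in> F (d - 1)" "x = b + f y"
          by (rule fam_sum_shiftE)
        have "f (g y) = g x - g b"
          using y(3) by (simp add: op_add[OF g] op_comm[OF f g])
        also have "\<dots> \<in> B (d + 1)"
          using graded_diff[OF B x(2) graded_op[OF B g y(1)]] .
        finally have "g y \<in> B d"
          using f_reg[OF graded_op'[OF F g y(2)]] by simp
        moreover have "nat (d - 1 - d0 + 1) < nat (d - d0 + 1)"
          using False by simp
        ultimately have "y \<in> B (d - 1)"
          using less[of "d - 1"] y(2) by auto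
        then show ?thesis
          using graded_add[OF B y(1) graded_op'[OF B f]] y(3) by simp
      qed
    qed
  qed
  \<comment> \<open>A relation f x = b + g y makes y divisible by f modulo B, because g is regular
    modulo f; then f cancels.\<close>
  have 2: "x \<in> (B \<oplus> g \<bullet> F) d" if x: "x \<in> F d" "f x \<in> (B \<oplus> g \<bullet> F) (d + 1)" for x d
  proof -
    obtain b y where y: "b \<in> B (d + 1)" "y \<in> F d" "f x = b + g y"
      using x(2) by (auto elim: fam_sum_shiftE)
    have "g y = - b + f x"
      using y(3) by simp
    also have "\<dots> \<in> (B \<oplus> f \<bullet> F) (d + 1)"
      using fam_sumI[of "- b" B "d + 1" "f x" "f \<bullet> F"] graded_minus[OF B y(1)] shift_imageI[where X = F, OF x(1)] by simp
    finally have "y \<in> (B \<oplus> f \<bullet> F) d"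
      using g_reg[OF y(2)] by simp
    then obtain b' z where z: "b' \<in> B d" "z \<in> F (d - 1)" "y = b' + f z"
      by (rule fam_sum_shiftE)
    have "f (x - g z) = b + g b'"
      using y(3) z(3) by (simp add: op_add[OF g] op_diff[OF f] op_comm[OF f g])
    also have "\<dots> \<in> B (d + 1)"
      using graded_add[OF B y(1) graded_op[OF B g z(1)]] .
    finally have "x - g z \<in> B d"
      using f_reg[OF graded_diff[OF F x(1) graded_op'[OF F g z(2)]]] by simp
    then have "(x - g z) + g z \<in> (B \<oplus> g \<bullet> F) d"
      using z(2) by (intro fam_sumI) (auto simp: shift_image_def)
    then show ?thesis by simp
  qed
  show ?case
    using 1 2 IH by (auto simp: fam_sum_right_commute)
qed

lemma graded_adjoin: "graded X \<Longrightarrow> graded B \<Longrightarrow> set fs \<subseteq> Ops \<Longrightarrow> graded (adjoin X B fs)"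
  by (induction fs arbitrary: B) (auto simp: graded_extend)

lemma adjoin_base: "graded X \<Longrightarrow> graded B \<Longrightarrow> set fs \<subseteq> Ops \<Longrightarrow> x \<in> B d \<Longrightarrow> x \<in> adjoin X B fs d"
  by (induction fs arbitrary: B) (auto simp: graded_extend extend_left)

lemma adjoin_generator:
  "graded X \<Longrightarrow> graded B \<Longrightarrow> set fs \<subseteq> Ops \<Longrightarrow> f \<in> set fs \<Longrightarrow> x \<in> X d \<Longrightarrow> f x \<in> adjoin X B fs (d + 1)"
proof (induction fs arbitrary: B)
  case (Cons g fs)
  have "graded (B \<oplus> g \<bullet> X)"
    using Cons.prems by (simp add: graded_extend)
  then show ?case
    using Cons extend_right[where B = B and X = X and x = x and d = d and f = f] adjoin_base[OF Cons.prems(1), of "B \<oplus> g \<bullet> X" fs] by auto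
qed simp

lemma linear_regular_bounded:
  assumes X: "graded X"
  shows "set fs \<subseteq> Ops \<Longrightarrow> (\<And>d. r < d \<Longrightarrow> X d \<subseteq> B d) \<Longrightarrow> linear_regular X B fs 0 r"
proof (induction fs arbitrary: B)
  case (Cons f fs)
  have "X d \<subseteq> (B \<oplus> f \<bullet> X) d" if "r < d" for d
    using Cons.prems extend_left[OF X] that by (meson list.set_intros(1) subset_iff)
  then have "linear_regular X (B \<oplus> f \<bullet> X) fs 0 r"
    using Cons by simp
  moreover have "x \<in> B d" if "r < d" "x \<in> X d" for d x
    using Cons.prems(2) that by blast
  ultimately show ?case by simp
qed simp

lemma graded_sum: "graded X \<Longrightarrow> (\<And>i. i \<in> I \<Longrightarrow> x i \<in> X d) \<Longrightarrow> (\<Sum>i\<in>I. x i) \<in> X d"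
  by (induction I rule: infinite_finite_induct) (auto simp: graded_0 graded_add)

end

lemma adjoin_least:
  assumes "\<And>x y. x \<in> S \<Longrightarrow> y \<in> S \<Longrightarrow> x + y \<in> S"
  shows "B d \<subseteq> S \<Longrightarrow> (\<And>f x. f \<in> set fs \<Longrightarrow> x \<in> X (d - 1) \<Longrightarrow> f x \<in> S) \<Longrightarrow> adjoin X B fs d \<subseteq> S"
proof (induction fs arbitrary: B)
  case (Cons f fs)
  have "(B \<oplus> f \<bullet> X) d \<subseteq> S"
    using Cons.prems by (auto elim!: fam_sum_shiftE intro!: assms)
  then show ?case
    using Cons.IH[of "B \<oplus> f \<bullet> X"] Cons.prems by simp
qed simp

section \<open>Polynomials and monomial ideals\<close>

abbreviation coeff :: "('a \<Rightarrow>\<^sub>0 'b::zero) \<Rightarrow> 'a \<Rightarrow> 'b" where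
  "coeff \<equiv> Poly_Mapping.lookup"

abbreviation keys :: "('a \<Rightarrow>\<^sub>0 'b::zero) \<Rightarrow> 'a set" where
  "keys \<equiv> Poly_Mapping.keys"

abbreviation single :: "'a \<Rightarrow> 'b \<Rightarrow> ('a \<Rightarrow>\<^sub>0 'b::zero)" where
  "single \<equiv> Poly_Mapping.single"

lemma poly_mapping_sum_single: "(\<Sum>m\<in>keys f. single m (coeff f m)) = f"
  by (rule poly_mapping_eqI)
    (auto simp: lookup_sum lookup_single "when_def" sum.delta in_keys_iff)

lemma mult_eq_sum: "f * g = (\<Sum>a\<in>keys f. \<Sum>b\<in>keys g. single (a + b) (coeff f a * coeff g b))"
proof -
  have "f * g = (\<Sum>a\<in>keys f. single a (coeff f a)) * (\<Sum>b\<in>keys g. single b (coeff g b))"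
    by (simp add: poly_mapping_sum_single)
  then show ?thesis
    by (simp add: sum_product mult_single)
qed

lemma coeff_mult: "coeff (f * g) m = (\<Sum>a\<in>keys f. \<Sum>b\<in>keys g. if a + b = m then coeff f a * coeff g b else 0)"
  by (subst mult_eq_sum) (simp add: lookup_sum lookup_single "when_def")

text \<open>An exponent that arises from one pair only cannot cancel. In
  \<open>avoid_primary\<close> it is applied to a pair chosen to be extremal.\<close>

lemma coeff_mult_unique:
  assumes "\<And>a b. a \<in> keys f \<Longrightarrow> b \<in> keys g \<Longrightarrow> a + b = a0 + b0 \<Longrightarrow> a = a0 \<and> b = b0"
  shows "coeff (f * g) (a0 + b0) = coeff f a0 * coeff g b0"
proof -
  have "coeff (f * g) (a0 + b0) =
      (\<Sum>a\<in>keys f. \<Sum>b\<in>keys g. if a = a0 then (if b = b0 then coeff f a0 * coeff g b0 else 0) else 0)"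
    unfolding coeff_mult using assms by (intro sum.cong refl) auto
  also have "\<dots> = (\<Sum>a\<in>keys f. if a = a0 then (\<Sum>b\<in>keys g. if b = b0 then coeff f a0 * coeff g b0 else 0) else 0)"
    by (intro sum.cong) auto
  also have "\<dots> = coeff f a0 * coeff g b0"
    by (auto simp: in_keys_iff)
  finally show ?thesis .
qed

lemma coeff_single_mult_add:
  fixes a m :: "'a::cancel_comm_monoid_add"
  shows "coeff (single a c * f) (a + m) = c * coeff f m"
  by (subst coeff_mult_unique) (auto split: if_splits)

lemma coeff_single_mult_eq_0:
  "(\<And>b. m \<noteq> a + b) \<Longrightarrow> coeff (single a c * f) m = 0"
  unfolding coeff_mult by (intro sum.neutral ballI) (auto split: if_splits)

text \<open>Projection onto the span of the monomials in S: for a fixed degree it is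
  \<open>hom_comp\<close>, for a ray it produces the witness in the top degree that belongs to an
  edge.\<close>

definition restrict :: "'a set \<Rightarrow> ('a \<Rightarrow>\<^sub>0 'b::comm_monoid_add) \<Rightarrow> 'a \<Rightarrow>\<^sub>0 'b" where
  "restrict S f = (\<Sum>m\<in>keys f \<inter> S. single m (coeff f m))"

lemma coeff_restrict: "coeff (restrict S f) m = (if m \<in> S then coeff f m else 0)"
proof -
  have "coeff (restrict S f) m = (\<Sum>a\<in>keys f \<inter> S. if a = m then coeff f m else 0)"
    by (auto simp: restrict_def lookup_sum lookup_single "when_def" intro!: sum.cong)
  then show ?thesis
    by (auto simp: sum.delta in_keys_iff)
qed

lemma keys_restrict: "keys (restrict S f) = keys f \<inter> S"
  by (auto simp: in_keys_iff coeff_restrict split: if_splits)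

lemma restrict_zero [simp]: "restrict S 0 = 0"
  by (rule poly_mapping_eqI) (simp add: coeff_restrict)

lemma restrict_add: "restrict S (f + g) = restrict S f + restrict S g"
  by (rule poly_mapping_eqI) (simp add: coeff_restrict lookup_add)

lemma restrict_sum: "restrict S (\<Sum>i\<in>A. f i) = (\<Sum>i\<in>A. restrict S (f i))"
  by (induction A rule: infinite_finite_induct) (simp_all add: restrict_add)

lemma restrict_compl: "restrict S f + restrict (- S) f = f"
  by (rule poly_mapping_eqI) (simp add: coeff_restrict lookup_add)

lemma restrict_id: "keys f \<subseteq> S \<Longrightarrow> restrict S f = f"
  by (rule poly_mapping_eqI) (auto simp: coeff_restrict in_keys_iff)

lemma restrict_empty: "keys f \<inter> S = {} \<Longrightarrow> restrict S f = 0"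
  by (rule poly_mapping_eqI) (auto simp: coeff_restrict in_keys_iff)

lemma monom_deg_add: "monom_deg (a + b) = monom_deg a + monom_deg b"
  by (simp add: monom_deg_def lookup_add sum.distrib)

lemma monom_deg_single [simp]: "monom_deg (single v n) = n"
  by (simp add: monom_deg_def lookup_single "when_def")

lemma monom_deg_zero [simp]: "monom_deg 0 = 0"
  by (simp add: monom_deg_def)

lemma monom_deg_eq_0: "monom_deg m = 0 \<longleftrightarrow> m = 0"
  by (auto simp: monom_deg_def intro!: poly_mapping_eqI)

lemma finite_monom_deg: "finite {m :: 'v::finite \<Rightarrow>\<^sub>0 nat. int (monom_deg m) = d}"
proof -
  have "coeff m v \<le> monom_deg m" for m :: "'v \<Rightarrow>\<^sub>0 nat" and v
    unfolding monom_deg_def by (intro member_le_sum) auto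
  then have "coeff ` {m :: 'v \<Rightarrow>\<^sub>0 nat. int (monom_deg m) = d} \<subseteq> {g. \<forall>v. (v \<in> (UNIV :: 'v set) \<longrightarrow> g v \<in> {..nat d}) \<and> (v \<notin> UNIV \<longrightarrow> g v = 0)}"
    by auto
  moreover have "finite \<dots>"
    by (intro finite_set_of_finite_funs) auto
  ultimately have "finite (coeff ` {m :: 'v \<Rightarrow>\<^sub>0 nat. int (monom_deg m) = d})"
    by (rule finite_subset)
  then show ?thesis
    by (rule finite_imageD) (auto intro!: inj_onI poly_mapping_eqI dest: fun_cong)
qed

abbreviation var_exp :: "'v \<Rightarrow> 'v \<Rightarrow>\<^sub>0 nat" where
  "var_exp v \<equiv> single v 1"

lemma exp_split:
  fixes m :: "'v \<Rightarrow>\<^sub>0 nat"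
  assumes "n \<le> coeff m v"
  obtains m' where "m = single v n + m'"
proof
  show "m = single v n + (m - single v n)"
    using assms by (intro poly_mapping_eqI) (auto simp: lookup_add lookup_minus lookup_single "when_def")
qed

lemma exp_nonzero:
  fixes m :: "'v \<Rightarrow>\<^sub>0 nat"
  assumes "m \<noteq> 0"
  obtains v where "0 < coeff m v"
  using assms by (metis poly_mapping_eqI lookup_zero gr0I)

lemma homogeneous_0 [simp]: "homogeneous d 0"
  by (simp add: homogeneous_def)

lemma homogeneous_add: "homogeneous d f \<Longrightarrow> homogeneous d g \<Longrightarrow> homogeneous d (f + g)"
  using keys_add[of f g] by (auto simp: homogeneous_def)

lemma homogeneous_uminus: "homogeneous d f \<Longrightarrow> homogeneous d (- f)"
  by (auto simp: homogeneous_def in_keys_iff)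

lemma homogeneous_sum: "(\<And>i. i \<in> A \<Longrightarrow> homogeneous d (f i)) \<Longrightarrow> homogeneous d (\<Sum>i\<in>A. f i)"
  by (induction A rule: infinite_finite_induct) (auto simp: homogeneous_add)

lemma homogeneous_mult: "homogeneous d f \<Longrightarrow> homogeneous e g \<Longrightarrow> homogeneous (d + e) (f * g)"
  using keys_mult[of f g] by (fastforce simp: homogeneous_def monom_deg_add)

lemma homogeneous_single: "homogeneous (int (monom_deg m)) (single m c)"
  by (simp add: homogeneous_def)

lemma homogeneous_const: "homogeneous 0 (single 0 c)"
  by (simp add: homogeneous_def)

lemma homogeneous_Var: "homogeneous 1 (Var v)"
  by (simp add: homogeneous_def Var_def)

lemma homogeneous_neg: "homogeneous d f \<Longrightarrow> d < 0 \<Longrightarrow> f = 0"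
  by (rule poly_mapping_eqI) (force simp: homogeneous_def in_keys_iff)

section \<open>Homogeneous components\<close>

definition hom_comp :: "int \<Rightarrow> ('v::finite, 'k::field) mpoly \<Rightarrow> ('v, 'k) mpoly" where
  "hom_comp d = restrict {m. int (monom_deg m) = d}"

lemma coeff_hom_comp: "coeff (hom_comp d f) m = (if int (monom_deg m) = d then coeff f m else 0)"
  by (simp add: hom_comp_def coeff_restrict)

lemma hom_comp_zero [simp]: "hom_comp d 0 = 0"
  by (simp add: hom_comp_def)

lemma hom_comp_add: "hom_comp d (f + g) = hom_comp d f + hom_comp d g"
  by (simp add: hom_comp_def restrict_add)

lemma hom_comp_sum: "hom_comp d (\<Sum>i\<in>A. f i) = (\<Sum>i\<in>A. hom_comp d (f i))"
  by (simp add: hom_comp_def restrict_sum)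

lemma homogeneous_hom_comp: "homogeneous d (hom_comp d f)"
  by (simp add: homogeneous_def hom_comp_def keys_restrict)

lemma hom_comp_id: "homogeneous d f \<Longrightarrow> hom_comp d f = f"
  by (auto simp: homogeneous_def hom_comp_def intro!: restrict_id)

lemma hom_comp_mult:
  assumes "homogeneous e g"
  shows "hom_comp d (g * f) = g * hom_comp (d - e) f"
proof -
  let ?S = "{m :: 'a \<Rightarrow>\<^sub>0 nat. int (monom_deg m) = d - e}"
  have "hom_comp d (g * f) = hom_comp d (g * hom_comp (d - e) f) + hom_comp d (g * restrict (- ?S) f)"
    using restrict_compl[of ?S f] unfolding hom_comp_def[of "d - e"]
    by (metis hom_comp_add distrib_left)
  also have "hom_comp d (g * hom_comp (d - e) f) = g * hom_comp (d - e) f"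
    using homogeneous_mult[OF assms homogeneous_hom_comp[of "d - e" f]] by (simp add: hom_comp_id)
  also have "hom_comp d (g * restrict (- ?S) f) = 0"
    unfolding hom_comp_def using keys_mult[of g "restrict (- ?S) f"] assms
    by (intro restrict_empty) (force simp: keys_restrict homogeneous_def monom_deg_add)
  finally show ?thesis by simp
qed

lemma finite_hom_comp_nonzero: "finite {d. hom_comp d f \<noteq> 0}"
proof (rule finite_subset)
  show "{d. hom_comp d f \<noteq> 0} \<subseteq> (\<lambda>m. int (monom_deg m)) ` keys f"
  proof
    fix d assume "d \<in> {d. hom_comp d f \<noteq> 0}"
    then have "keys f \<inter> {m. int (monom_deg m) = d} \<noteq> {}"
      using restrict_empty[of f "{m. int (monom_deg m) = d}"] by (auto simp: hom_comp_def)
    then show "d \<in> (\<lambda>m. int (monom_deg m)) ` keys f" by auto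
  qed
qed simp

lemma sum_hom_comp:
  assumes "finite D" "{d. hom_comp d f \<noteq> 0} \<subseteq> D"
  shows "(\<Sum>d\<in>D. hom_comp d f) = f"
proof (rule poly_mapping_eqI)
  fix m
  have "coeff f m = 0" if "int (monom_deg m) \<notin> D"
  proof -
    have "hom_comp (int (monom_deg m)) f = 0"
      using that assms(2) by blast
    then show ?thesis
      using coeff_hom_comp[of "int (monom_deg m)" f m] by simp
  qed
  then show "coeff (\<Sum>d\<in>D. hom_comp d f) m = coeff f m"
    using assms(1) by (auto simp: lookup_sum coeff_hom_comp sum.delta)
qed

lemma ideal_subspace_iff:
  "is_ideal I \<longleftrightarrow> 0 \<in> I \<and> (\<forall>f\<in>I. \<forall>g\<in>I. f + g \<in> I) \<and> (\<forall>c. \<forall>f\<in>I. c * f \<in> I)"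
  unfolding ideal.subspace_def by blast

lemma coeff_zero_mult: "coeff (f * g) (0 :: 'v::finite \<Rightarrow>\<^sub>0 nat) = coeff f 0 * coeff g 0"
proof -
  have "a = 0 \<and> b = 0" if "a + b = 0 + 0" for a b :: "'v \<Rightarrow>\<^sub>0 nat"
    using arg_cong[OF that, of monom_deg] by (simp add: monom_deg_add monom_deg_eq_0)
  then have "coeff (f * g) (0 + 0) = coeff f 0 * coeff g 0"
    by (intro coeff_mult_unique)
  then show ?thesis by simp
qed

lemma monomial_in_ideal_gen_Var: "m \<noteq> 0 \<Longrightarrow> single m c \<in> irrelevant_ideal"
proof -
  assume "m \<noteq> 0"
  then obtain v where "0 < coeff m v" by (rule exp_nonzero)
  then obtain m' where "m = single v 1 + m'"
    using exp_split[of 1 m v] by (auto simp: Suc_le_eq)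
  then have "single m c = single m' c * Var v"
    by (simp add: Var_def mult_single add.commute)
  then show ?thesis
    unfolding irrelevant_ideal_def by (metis ideal.span_base ideal.span_scale rangeI)
qed

text \<open>Turns minimality of a resolution into a condition on constant terms, the form in which
  it is used.\<close>

lemma irrelevant_ideal_iff: "f \<in> irrelevant_ideal \<longleftrightarrow> coeff f 0 = 0"
proof
  assume "f \<in> irrelevant_ideal"
  then show "coeff f 0 = 0"
    unfolding irrelevant_ideal_def
  proof (induction rule: ideal.span_induct_alt)
    case (step c x y)
    then have "coeff x 0 = 0"
      by (auto simp: Var_def lookup_single "when_def" simp flip: monom_deg_eq_0)
    with step show ?case
      by (simp add: lookup_add coeff_zero_mult)
  qed simp
next
  assume "coeff f 0 = 0"
  then have "single m (coeff f m) \<in> irrelevant_ideal" for m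
    by (cases "m = 0") (simp_all add: monomial_in_ideal_gen_Var, simp add: irrelevant_ideal_def ideal.span_zero)
  then have "(\<Sum>m\<in>keys f. single m (coeff f m)) \<in> irrelevant_ideal"
    unfolding irrelevant_ideal_def by (intro ideal.span_sum)
  then show "f \<in> irrelevant_ideal"
    by (simp add: poly_mapping_sum_single)
qed

text \<open>Monomial ideals are given by their standard monomials: if U is closed under divisors,
  this is the monomial ideal with complement U, and intersections of ideals are unions of such
  U.\<close>

definition avoid :: "'a set \<Rightarrow> ('a \<Rightarrow>\<^sub>0 'b::zero) set" where
  "avoid U = {f. keys f \<inter> U = {}}"

lemma avoid_iff: "f \<in> avoid U \<longleftrightarrow> (\<forall>m\<in>U. coeff f m = 0)"
  by (auto simp: avoid_def in_keys_iff)

lemma avoidD: "f \<in> avoid U \<Longrightarrow> m \<in> U \<Longrightarrow> coeff f m = 0"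
  by (simp add: avoid_iff)

lemma single_avoid: "single m c \<in> avoid U \<longleftrightarrow> c = 0 \<or> m \<notin> U"
  by (auto simp: avoid_def)

lemma avoid_add: "f \<in> avoid U \<Longrightarrow> g \<in> avoid U \<Longrightarrow> f + g \<in> avoid U"
  by (simp add: avoid_iff lookup_add)

lemma avoid_diff: "(f :: _ \<Rightarrow>\<^sub>0 _::ab_group_add) \<in> avoid U \<Longrightarrow> g \<in> avoid U \<Longrightarrow> f - g \<in> avoid U"
  by (simp add: avoid_iff lookup_minus)

lemma restrict_avoid: "f \<in> avoid U \<Longrightarrow> restrict S f \<in> avoid U"
  by (simp add: avoid_iff coeff_restrict)

lemma avoid_mult:
  assumes "\<And>a b. a + b \<in> U \<Longrightarrow> b \<in> U" "f \<in> avoid U"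
  shows "g * f \<in> avoid U"
  using assms keys_mult[of g f] unfolding avoid_def by fastforce

lemma is_ideal_avoid:
  assumes "\<And>a b. a + b \<in> U \<Longrightarrow> b \<in> U"
  shows "is_ideal (avoid U :: (('a::comm_monoid_add) \<Rightarrow>\<^sub>0 ('b::comm_ring_1)) set)"
  unfolding ideal_subspace_iff
proof (intro conjI allI ballI)
  show "0 \<in> avoid U"
    by (simp add: avoid_iff)
qed (use assms in \<open>auto intro: avoid_add avoid_mult\<close>)

text \<open>Among the exponents of f in U take c with least degree off x_i and, among those, least
  x_i-exponent; let x_i^e be the lowest power of x_i in p. No other pair of exponents of p and f has
  the same sum, so that coefficient of p f survives. The characteristic and the size of the field do
  not enter, and p may be \<open>linear_form\<close> for every i.\<close>

lemma avoid_primary: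
  fixes p f :: "('v::finite, 'k::field) mpoly"
  assumes closed: "\<And>a b. a + b \<in> U \<Longrightarrow> b \<in> U"
    and ray: "\<And>m e. m \<in> U \<Longrightarrow> single i e + m \<in> U"
    and p: "single i e0 \<in> keys p" and pf: "p * f \<in> avoid U"
  shows "f \<in> avoid U"
proof (rule ccontr)
  assume "f \<notin> avoid U"
  define N :: "('v \<Rightarrow>\<^sub>0 nat) \<Rightarrow> nat" where "N m = (\<Sum>j\<in>-{i}. coeff m j)" for m
  have N_add: "N (a + b) = N a + N b" for a b
    by (simp add: N_def lookup_add sum.distrib)
  have N_single: "N (single i e) = 0" for e
    by (simp add: N_def lookup_single "when_def")
  have N_0: "m = single i (coeff m i)" if "N m = 0" for m
    using that by (intro poly_mapping_eqI) (auto simp: N_def lookup_single "when_def")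
  define K where "K = keys f \<inter> U"
  obtain k where "k \<in> K"
    using \<open>f \<notin> avoid U\<close> by (auto simp: K_def avoid_def)
  then obtain c0 where c0: "c0 \<in> K" "\<And>b. b \<in> K \<Longrightarrow> N c0 \<le> N b"
    using ex_has_least_nat[of "\<lambda>c. c \<in> K" k N] by blast
  then obtain c where c: "c \<in> K" "N c = N c0" and c_min: "\<And>b. b \<in> K \<Longrightarrow> N b = N c0 \<Longrightarrow> coeff c i \<le> coeff b i"
    using ex_has_least_nat[of "\<lambda>c. c \<in> K \<and> N c = N c0" c0 "\<lambda>c. coeff c i"] by blast
  define e where "e = (LEAST e. single i e \<in> keys p)"
  have e: "single i e \<in> keys p"
    unfolding e_def using p by (rule LeastI)
  have e_min: "e \<le> e'" if "single i e' \<in> keys p" for e'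
    unfolding e_def using that by (rule Least_le)
  have "a = single i e \<and> b = c" if ab: "a \<in> keys p" "b \<in> keys f" "a + b = single i e + c" for a b
  proof -
    have "single i e + c \<in> U"
      using c(1) ray by (simp add: K_def)
    then have "b \<in> K"
      using ab closed[of a b] by (simp add: K_def)
    have "N a + N b = N c0"
      using arg_cong[OF ab(3), of N] c(2) by (simp add: N_add N_single)
    \<comment> \<open>Divisor closure has put b into U, so its degree off x_i is at least that of c;
      hence a is a power of x_i alone.\<close>
    then have "N a = 0" "N b = N c0"
      using c0(2)[OF \<open>b \<in> K\<close>] by auto
    have "a = single i (coeff a i)"
      using \<open>N a = 0\<close> by (rule N_0)
    then have "e \<le> coeff a i"
      using e_min ab(1) by metis
    moreover have "coeff c i \<le> coeff b i"
      using c_min \<open>b \<in> K\<close> \<open>N b = N c0\<close> by simp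
    moreover have "coeff a i + coeff b i = e + coeff c i"
      using arg_cong[OF ab(3), of "\<lambda>m. coeff m i"] by (simp add: lookup_add)
    ultimately have "coeff a i = e" by simp
    then have "a = single i e"
      using \<open>a = single i (coeff a i)\<close> by simp
    then show ?thesis
      using ab(3) by simp
  qed
  then have "coeff (p * f) (single i e + c) = coeff p (single i e) * coeff f c"
    by (rule coeff_mult_unique)
  moreover have "coeff p (single i e) \<noteq> 0" "coeff f c \<noteq> 0"
    using e c(1) by (simp_all add: K_def in_keys_iff)
  moreover have "coeff (p * f) (single i e + c) = 0"
    using pf ray c(1) by (auto simp: avoid_iff K_def)
  ultimately show False by simp
qed

definition linear_form :: "('v::finite, 'k::field) mpoly" where
  "linear_form = (\<Sum>v\<in>UNIV. Var v)"

lemma homogeneous_linear_form: "homogeneous 1 linear_form"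
  unfolding linear_form_def by (intro homogeneous_sum homogeneous_Var)

lemma single_eq_iff: "c \<noteq> 0 \<Longrightarrow> single u c = single v c \<longleftrightarrow> u = v"
  by (metis lookup_single_eq lookup_single_not_eq)

lemma linear_form_key: "single v 1 \<in> keys (linear_form :: ('v::finite, 'k::field) mpoly)"
proof -
  have "coeff (Var u :: ('v, 'k) mpoly) (single v 1) = (if u = v then 1 else 0)" for u
    unfolding Var_def lookup_single "when_def" by (subst single_eq_iff) simp_all
  then have "coeff (linear_form :: ('v, 'k) mpoly) (single v 1) = 1"
    unfolding linear_form_def lookup_sum by simp
  then show ?thesis
    by (simp add: in_keys_iff)
qed

text \<open>Monomials that x_v does not divide are dropped, so this is a quotient only if there are
  none.\<close>

definition divide_Var :: "'v \<Rightarrow> ('v, 'k::field) mpoly \<Rightarrow> ('v, 'k) mpoly" where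
  "divide_Var v = Poly_Mapping.map_key (\<lambda>m. single v 1 + m)"

lemma coeff_divide_Var: "coeff (divide_Var v f) m = coeff f (single v 1 + m)"
  unfolding divide_Var_def by (subst map_key.rep_eq) (auto simp: inj_def)

lemma Var_mult_divide_Var:
  assumes "\<And>m. m \<in> keys f \<Longrightarrow> 0 < coeff m v"
  shows "Var v * divide_Var v f = f"
proof (rule poly_mapping_eqI)
  fix m
  show "coeff (Var v * divide_Var v f) m = coeff f m"
  proof (cases "0 < coeff m v")
    case True
    then obtain m' where "m = single v 1 + m'"
      using exp_split[of 1 m v] by (auto simp: Suc_le_eq)
    then show ?thesis
      by (simp add: Var_def coeff_single_mult_add coeff_divide_Var)
  next
    case False
    then have "m \<noteq> single v 1 + b" for b
      by (auto simp: lookup_add)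
    then show ?thesis
      using False assms[of m] by (auto simp: Var_def coeff_single_mult_eq_0 in_keys_iff)
  qed
qed

lemma homogeneous_divide_Var: "homogeneous d f \<Longrightarrow> homogeneous (d - 1) (divide_Var v f)"
  unfolding homogeneous_def
proof
  fix m assume f: "\<forall>m\<in>keys f. int (monom_deg m) = d" and "m \<in> keys (divide_Var v f)"
  then have "single v 1 + m \<in> keys f"
    by (simp add: in_keys_iff coeff_divide_Var)
  with f show "int (monom_deg m) = d - 1"
    by (fastforce simp: monom_deg_add)
qed

section \<open>Graded free modules\<close>

type_synonym ('v, 'k) mvec = "nat \<Rightarrow> ('v, 'k) mpoly"

definition scale :: "('v, 'k::field) mpoly \<Rightarrow> ('v, 'k) mvec \<Rightarrow> ('v, 'k) mvec" where
  "scale p u = (\<lambda>l. p * u l)"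

lemma scale_apply: "scale p u l = p * u l"
  by (simp add: scale_def)

global_interpretation vec: module "scale :: ('v, 'k::field) mpoly \<Rightarrow> _"
  by unfold_locales (auto intro: ext simp only: scale_apply plus_fun_apply distrib_left distrib_right mult.assoc mult_1_left)

lemma vector_space_scale_const:
  "vector_space (\<lambda>c. scale (single 0 c :: ('v, 'k::field) mpoly))"
  by unfold_locales
    (auto intro: ext simp: scale_apply single_add distrib_left distrib_right mult_single simp flip: mult.assoc)
lemma lambda_zero [simp]: "(\<lambda>x. 0) = 0"
  by (simp add: zero_fun_def)

lemma sum_fun_apply: "(\<Sum>i\<in>A. f i) x = (\<Sum>i\<in>A. f i x)"
  for f :: "'i \<Rightarrow> 'a \<Rightarrow> 'b::comm_monoid_add"
  by (induction A rule: infinite_finite_induct) simp_all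

definition linear_ops :: "(('v::finite, 'k::field) mvec \<Rightarrow> ('v, 'k) mvec) set" where
  "linear_ops = {scale p | p. homogeneous 1 p}"

global_interpretation lin: commuting_operators "linear_ops :: (('v::finite, 'k::field) mvec \<Rightarrow> _) set"
  by unfold_locales
    (auto simp: linear_ops_def scale_apply distrib_left mult.left_commute intro: ext)

lemma scale_linear_ops: "homogeneous 1 p \<Longrightarrow> scale p \<in> linear_ops"
  by (auto simp: linear_ops_def)

text \<open>Elements of R^n are sequences that vanish from n on, so that free modules of all ranks
  share one type.\<close>

definition free_vecs :: "nat \<Rightarrow> ('v, 'k::field) mvec set" where
  "free_vecs n = {u. \<forall>l\<ge>n. u l = 0}"

definition free_part :: "nat \<Rightarrow> (nat \<Rightarrow> int) \<Rightarrow> int \<Rightarrow> ('v::finite, 'k::field) mvec set" where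
  "free_part n sh d = {u \<in> free_vecs n. \<forall>l<n. homogeneous (d - sh l) (u l)}"

definition vec_comp :: "(nat \<Rightarrow> int) \<Rightarrow> int \<Rightarrow> ('v::finite, 'k::field) mvec \<Rightarrow> ('v, 'k) mvec" where
  "vec_comp sh d u = (\<lambda>l. hom_comp (d - sh l) (u l))"

definition graded_submodule :: "nat \<Rightarrow> (nat \<Rightarrow> int) \<Rightarrow> ('v::finite, 'k::field) mvec set \<Rightarrow> bool" where
  "graded_submodule n sh Z \<longleftrightarrow> vec.subspace Z \<and> Z \<subseteq> free_vecs n \<and> (\<forall>u\<in>Z. \<forall>d. vec_comp sh d u \<in> Z)"

definition part :: "nat \<Rightarrow> (nat \<Rightarrow> int) \<Rightarrow> ('v::finite, 'k::field) mvec set \<Rightarrow> int \<Rightarrow> ('v, 'k) mvec set" where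
  "part n sh Z d = Z \<inter> free_part n sh d"

abbreviation zero_part :: "int \<Rightarrow> ('v, 'k::field) mvec set" where
  "zero_part \<equiv> \<lambda>d. {0}"

lemma graded_zero_part [simp]: "lin.graded zero_part"
  unfolding lin.graded_def using lin.op_0 by fastforce

lemma fam_sum_zero [simp]: "X \<oplus> (\<lambda>d. {0}) = X" "(\<lambda>d. {0}) \<oplus> X = X"
  by (auto simp: fam_sum_def fun_eq_iff)

lemma subspace_free_vecs: "vec.subspace (free_vecs n)"
  by (auto simp: vec.subspace_def free_vecs_def scale_def)

lemma free_vecsD: "u \<in> free_vecs n \<Longrightarrow> n \<le> l \<Longrightarrow> u l = 0"
  by (simp add: free_vecs_def)

lemma free_part_homogeneous: "u \<in> free_part n sh d \<Longrightarrow> homogeneous (d - sh l) (u l)"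
  by (cases "l < n") (auto simp: free_part_def free_vecs_def)

lemma free_part_free_vecs: "u \<in> free_part n sh d \<Longrightarrow> u \<in> free_vecs n"
  by (simp add: free_part_def)

lemma scale_free_part:
  assumes "homogeneous e p" "u \<in> free_part n sh d"
  shows "scale p u \<in> free_part n sh (d + e)"
proof -
  have "homogeneous (d + e - sh l) (p * u l)" for l
    using homogeneous_mult[OF assms(1) free_part_homogeneous[OF assms(2), of l]] by (simp add: algebra_simps)
  then show ?thesis
    using assms(2) by (simp add: free_part_def free_vecs_def scale_def)
qed

lemma graded_free_part: "lin.graded (free_part n sh)"
  unfolding lin.graded_def
proof (intro conjI allI ballI)
  fix f :: "('a, 'b) mvec \<Rightarrow> ('a, 'b) mvec" and x :: "('a, 'b) mvec" and d
  assume "f \<in> linear_ops" "x \<in> free_part n sh d"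
  then show "f x \<in> free_part n sh (d + 1)"
    by (auto simp: linear_ops_def intro: scale_free_part)
qed (auto simp: free_part_def free_vecs_def homogeneous_uminus homogeneous_add)

lemma graded_part:
  assumes "graded_submodule n sh Z"
  shows "lin.graded (part n sh Z)"
proof -
  have Z: "vec.subspace Z"
    using assms by (simp add: graded_submodule_def)
  show ?thesis
    unfolding lin.graded_def
  proof (intro conjI allI ballI)
    fix f :: "('a, 'b) mvec \<Rightarrow> ('a, 'b) mvec" and x :: "('a, 'b) mvec" and d
    assume f: "f \<in> linear_ops" and x: "x \<in> part n sh Z d"
    then have "f x \<in> Z"
      using vec.subspace_scale[OF Z] by (auto simp: linear_ops_def part_def)
    then show "f x \<in> part n sh Z (d + 1)"
      using lin.graded_op[OF graded_free_part f] x by (auto simp: part_def)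
  qed (use Z in \<open>auto simp: part_def vec.subspace_0 vec.subspace_neg vec.subspace_add
         intro: graded_free_part lin.graded_0 lin.graded_minus lin.graded_add\<close>)
qed

lemma vec_comp_free_part: "u \<in> free_vecs n \<Longrightarrow> vec_comp sh d u \<in> free_part n sh d"
  by (auto simp: free_part_def free_vecs_def vec_comp_def homogeneous_hom_comp)

lemma vec_comp_part: "graded_submodule n sh Z \<Longrightarrow> u \<in> Z \<Longrightarrow> vec_comp sh d u \<in> part n sh Z d"
  by (auto simp: graded_submodule_def part_def vec_comp_free_part)

lemma vec_comp_id:
  assumes "u \<in> free_part n sh d"
  shows "vec_comp sh d u = u"
  using hom_comp_id[OF free_part_homogeneous[OF assms]] by (simp add: vec_comp_def)

lemma sum_vec_comp:
  assumes "u \<in> free_vecs n"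
  obtains D where "finite D" "(\<Sum>d\<in>D. vec_comp sh d u) = u"
proof
  define D where "D = (\<Union>l<n. (\<lambda>d. d + sh l) ` {d. hom_comp d (u l) \<noteq> 0})"
  show "finite D"
    by (simp add: D_def finite_hom_comp_nonzero)
  show "(\<Sum>d\<in>D. vec_comp sh d u) = u"
  proof
    fix l
    have "(\<Sum>d\<in>D. hom_comp (d - sh l) (u l)) = u l"
    proof (cases "l < n")
      case True
      have "(\<Sum>d\<in>D. hom_comp (d - sh l) (u l)) = (\<Sum>d\<in>(\<lambda>d. d - sh l) ` D. hom_comp d (u l))"
        by (subst sum.reindex) (auto simp: inj_on_def)
      also have "\<dots> = u l"
      proof (rule sum_hom_comp)
        show "{d. hom_comp d (u l) \<noteq> 0} \<subseteq> (\<lambda>d. d - sh l) ` D"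
          using True by (force simp: D_def)
      qed (use \<open>finite D\<close> in simp)
      finally show ?thesis .
    qed (use assms in \<open>simp add: free_vecs_def\<close>)
    then show "(\<Sum>d\<in>D. vec_comp sh d u) l = u l"
      by (simp add: sum_fun_apply vec_comp_def)
  qed
qed

lemma free_part_bounded:
  obtains d0 where "\<And>d. d < d0 \<Longrightarrow> free_part n sh d \<subseteq> {0 :: ('v::finite, 'k::field) mvec}"
proof
  fix d assume d: "d < Min (insert 0 (sh ` {..<n}))"
  show "free_part n sh d \<subseteq> {0 :: ('v, 'k) mvec}"
  proof
    fix u :: "('v, 'k) mvec" assume u: "u \<in> free_part n sh d"
    have "u l = 0" for l
    proof (cases "l < n")
      case True
      then have "d - sh l < 0"
        using d by simp
      then show ?thesis
        using homogeneous_neg free_part_homogeneous[OF u] by blast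
    qed (use u in \<open>simp add: free_part_def free_vecs_def\<close>)
    then show "u \<in> {0}"
      by (simp add: fun_eq_iff)
  qed
qed

text \<open>The degree d part of the submodule (x_v : v in V) F, in monomial form.
  \<open>avoid_vars_insert\<close> identifies it with what adjoining the variables produces.\<close>

definition avoid_vars :: "nat \<Rightarrow> (nat \<Rightarrow> int) \<Rightarrow> 'v set \<Rightarrow> int \<Rightarrow> ('v::finite, 'k::field) mvec set" where
  "avoid_vars n sh V d = {u \<in> free_part n sh d. \<forall>l. u l \<in> avoid {m. \<forall>v\<in>V. coeff m v = 0}}"

lemma avoid_vars_empty: "avoid_vars n sh {} = zero_part"
proof
  fix d
  have "f = 0" if "f \<in> avoid UNIV" for f :: "('a, 'b) mpoly"
    using that by (intro poly_mapping_eqI) (simp add: avoid_iff)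
  then show "avoid_vars n sh {} d = ({0} :: ('a, 'b) mvec set)"
    using lin.graded_0[OF graded_free_part[of n sh], of d] by (auto simp: avoid_vars_def fun_eq_iff avoid_iff)
qed

lemma avoid_vars_insert: "avoid_vars n sh (insert x V) = avoid_vars n sh V \<oplus> scale (Var x) \<bullet> free_part n sh"
proof (intro ext set_eqI iffI)
  fix d and u :: "('a, 'b) mvec"
  let ?S = "{m :: 'a \<Rightarrow>\<^sub>0 nat. \<forall>v\<in>V. coeff m v = 0}"
  let ?T = "{m :: 'a \<Rightarrow>\<^sub>0 nat. \<forall>v\<in>insert x V. coeff m v = 0}"
  {
    assume u: "u \<in> avoid_vars n sh (insert x V) d"
    \<comment> \<open>\<open>a\<close> collects the monomials divisible by a variable of V; x
      divides all the others, and \<open>b\<close> is their quotient.\<close>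
    define a where "a = (\<lambda>l. restrict (- ?S) (u l))"
    define b where "b = (\<lambda>l. divide_Var x (restrict ?S (u l)))"
    have hom: "homogeneous (d - sh l) (u l)" for l
      using u by (auto simp: avoid_vars_def free_part_homogeneous)
    have zero: "u l = 0" if "n \<le> l" for l
      using u that by (auto simp: avoid_vars_def free_part_def free_vecs_def)
    have hom_restr: "homogeneous (d - sh l) (restrict A (u l))" for A l
      using hom[of l] by (simp add: homogeneous_def keys_restrict)
    have "a \<in> avoid_vars n sh V d"
      using hom_restr zero by (auto simp: a_def avoid_vars_def free_part_def free_vecs_def avoid_def keys_restrict)
    moreover have "b \<in> free_part n sh (d - 1)"
    proof -
      have "homogeneous (d - 1 - sh l) (b l)" for l
        using homogeneous_divide_Var[OF hom_restr[of l ?S], of x] by (simp add: b_def algebra_simps)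
      moreover have "b l = 0" if "n \<le> l" for l
        using zero[OF that] by (simp add: b_def divide_Var_def map_key_zero inj_def)
      ultimately show ?thesis
        by (simp add: free_part_def free_vecs_def)
    qed
    moreover have "Var x * b l = restrict ?S (u l)" for l
      unfolding b_def
    proof (rule Var_mult_divide_Var)
      fix m assume "m \<in> keys (restrict ?S (u l))"
      moreover have "u l \<in> avoid ?T"
        using u by (simp add: avoid_vars_def)
      ultimately show "0 < coeff m x"
        by (auto simp: keys_restrict avoid_def)
    qed
    then have "u = a + scale (Var x) b"
      by (simp add: fun_eq_iff scale_apply a_def restrict_compl[of "- ?S", simplified])
    ultimately show "u \<in> (avoid_vars n sh V \<oplus> scale (Var x) \<bullet> free_part n sh) d"
      by (auto simp: fam_sum_def shift_image_def)
  next
    assume "u \<in> (avoid_vars n sh V \<oplus> scale (Var x) \<bullet> free_part n sh) d"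
    then obtain a b where a: "a \<in> avoid_vars n sh V d" and b: "b \<in> free_part n sh (d - 1)"
      and u: "u = a + scale (Var x) b"
      by (rule fam_sum_shiftE)
    have "scale (Var x) b \<in> free_part n sh d"
      using scale_free_part[OF homogeneous_Var b] by simp
    then have "u \<in> free_part n sh d"
      unfolding u using a by (intro lin.graded_add[OF graded_free_part]) (auto simp: avoid_vars_def)
    moreover have "coeff (Var x * b l) m = 0" if "coeff m x = 0" for l m
      unfolding Var_def using that by (intro coeff_single_mult_eq_0) (auto simp: lookup_add)
    then have "u l \<in> avoid ?T" for l
      using a by (simp add: u scale_def avoid_vars_def avoid_iff lookup_add)
    ultimately show "u \<in> avoid_vars n sh (insert x V) d"
      by (simp add: avoid_vars_def)
  }
qed

text \<open>In this order regularity can be read off from exponents: a variable is regular modulo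
  others, and modulo all variables except \<open>v0\<close> the form acts as x_v0, which
  \<open>avoid_primary\<close> makes precise.\<close>

lemma regular_seq_vars:
  fixes V :: "'v::finite set"
  shows "distinct xs \<Longrightarrow> set xs \<inter> V = {} \<Longrightarrow> set xs \<union> V = - {v0} \<Longrightarrow>
    regular_seq (free_part n sh) (avoid_vars n sh V)
      (map (\<lambda>v. scale (Var v)) xs @ [scale (linear_form :: ('v, 'k::field) mpoly)])"
proof (induction xs arbitrary: V)
  case Nil
  have "u \<in> avoid_vars n sh V d"
    if u: "u \<in> free_part n sh d" and lu: "scale linear_form u \<in> avoid_vars n sh V (d + 1)"
    for u :: "('v, 'k) mvec" and d
  proof -
    have "u l \<in> avoid {m. \<forall>v\<in>V. coeff m v = 0}" for l
    proof (rule avoid_primary[where i = v0, OF _ _ linear_form_key])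
      show "linear_form * u l \<in> avoid {m. \<forall>v\<in>V. coeff m v = 0}"
        using lu by (simp add: avoid_vars_def scale_def)
    qed (use Nil in \<open>auto simp: lookup_add lookup_single "when_def"\<close>)
    then show ?thesis
      using u by (simp add: avoid_vars_def)
  qed
  then show ?case by simp
next
  case (Cons x xs)
  have "u \<in> avoid_vars n sh V d"
    if u: "u \<in> free_part n sh d" and xu: "scale (Var x) u \<in> avoid_vars n sh V (d + 1)"
    for u :: "('v, 'k) mvec" and d
  proof -
    have "coeff (u l) m = 0" if "\<forall>v\<in>V. coeff m v = 0" for l m
    proof -
      have "\<forall>v\<in>V. coeff (single x 1 + m) v = 0"
        using that Cons.prems(2) by (auto simp: lookup_add lookup_single "when_def")
      then have "coeff (Var x * u l) (single x 1 + m) = 0"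
        using xu by (simp add: avoid_vars_def scale_def avoid_iff)
      then show ?thesis
        by (simp add: Var_def coeff_single_mult_add)
    qed
    then show ?thesis
      using u by (simp add: avoid_vars_def avoid_iff)
  qed
  moreover have "regular_seq (free_part n sh) (avoid_vars n sh (insert x V))
      (map (\<lambda>v. scale (Var v)) xs @ [scale (linear_form :: ('v, 'k) mpoly)])"
    using Cons.prems by (intro Cons.IH) auto
  ultimately show ?case
    unfolding avoid_vars_insert by simp
qed

text \<open>
  \<open>undefined\<close> is an arbitrary vertex: the sum of all variables and the other variables span the linear forms.
\<close>

definition forms :: "(('v::{finite,linorder}, 'k::field) mvec \<Rightarrow> ('v, 'k) mvec) list" where
  "forms = scale linear_form # map (\<lambda>v. scale (Var v)) (sorted_list_of_set (- {undefined}))"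

lemma forms_linear_ops: "set forms \<subseteq> linear_ops"
  by (auto simp: forms_def scale_linear_ops homogeneous_linear_form homogeneous_Var)

lemma regular_seq_forms: "regular_seq (free_part n sh) zero_part forms"
proof -
  obtain d0 where "\<And>d. d < d0 \<Longrightarrow> free_part n sh d \<subseteq> {0 :: ('a, 'b) mvec}"
    using free_part_bounded[where n = n and sh = sh] by blast
  then show ?thesis
    unfolding forms_def
    using regular_seq_vars[of "sorted_list_of_set (- {undefined})" "{}" undefined n sh]
    by (intro lin.regular_seq_rotate[OF graded_free_part])
      (auto simp: avoid_vars_empty scale_linear_ops homogeneous_linear_form homogeneous_Var)
qed

lemma Var_adjoin_forms:
  fixes X :: "int \<Rightarrow> ('v::{finite,linorder}, 'k::field) mvec set"
  assumes X: "lin.graded X" and u: "u \<in> X d"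
  shows "scale (Var v) u \<in> adjoin X zero_part forms (d + 1)"
proof -
  let ?v0 = "undefined :: 'v"
  note gen = lin.adjoin_generator[OF X graded_zero_part forms_linear_ops _ u]
  have other: "scale (Var v) u \<in> adjoin X zero_part forms (d + 1)" if "v \<noteq> ?v0" for v
    using that by (intro gen) (auto simp: forms_def)
  show ?thesis
  proof (cases "v = ?v0")
    case True
    have g: "lin.graded (adjoin X zero_part forms)"
      by (intro lin.graded_adjoin X graded_zero_part forms_linear_ops)
    have lf: "(linear_form :: ('v, 'k) mpoly) = Var ?v0 + (\<Sum>v\<in>-{?v0}. Var v)"
      unfolding linear_form_def by (subst sum.remove[of _ ?v0]) (auto simp: Compl_eq_Diff_UNIV)
    have "scale linear_form u = scale (Var v) u + (\<Sum>v\<in>-{?v0}. scale (Var v) u)"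
      unfolding True by (subst lf) (simp only: vec.scale_left_distrib vec.scale_sum_left)
    then have "scale (Var v) u = scale linear_form u - (\<Sum>v\<in>-{?v0}. scale (Var v) u)"
      by (rule add_implies_diff[OF sym])
    also have "\<dots> \<in> adjoin X zero_part forms (d + 1)"
      by (intro lin.graded_diff[OF g] lin.graded_sum[OF g] other gen) (auto simp: forms_def)
    finally show ?thesis .
  qed (use other in blast)
qed

text \<open>The forms span all linear forms, so they generate the irrelevant ideal. This converts
  minimality, a statement on constant terms, into the inclusion that
  \<open>linear_regular_syzygy\<close> asks for.\<close>

lemma const_free_adjoin:
  fixes u :: "('v::{finite,linorder}, 'k::field) mvec"
  assumes u: "u \<in> free_part n sh d" and const: "\<And>l. coeff (u l) 0 = 0"
  shows "u \<in> adjoin (free_part n sh) zero_part forms d"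
proof -
  let ?A = "adjoin (free_part n sh) zero_part (forms :: (('v, 'k) mvec \<Rightarrow> _) list)"
  have g: "lin.graded ?A"
    by (intro lin.graded_adjoin graded_free_part graded_zero_part forms_linear_ops)
  have "avoid_vars n sh V d \<subseteq> ?A d" if "finite V" for V
    using that
  proof (induction V rule: finite_induct)
    case empty
    then show ?case
      using lin.graded_0[OF g] unfolding avoid_vars_empty by blast
  next
    case (insert x V)
    show ?case
    proof
      fix u :: "('v, 'k) mvec" assume "u \<in> avoid_vars n sh (insert x V) d"
      then obtain a b where "a \<in> avoid_vars n sh V d" "b \<in> free_part n sh (d - 1)" "u = a + scale (Var x) b"
        unfolding avoid_vars_insert by (rule fam_sum_shiftE)
      then show "u \<in> ?A d"
        using insert.IH Var_adjoin_forms[OF graded_free_part, of b n sh "d - 1" x] lin.graded_add[OF g] by auto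
    qed
  qed
  moreover have "u \<in> avoid_vars n sh UNIV d"
  proof -
    have "m = 0" if "\<forall>v. coeff m v = 0" for m :: "'v \<Rightarrow>\<^sub>0 nat"
      using that by (intro poly_mapping_eqI) simp
    then show ?thesis
      using u const by (force simp: avoid_vars_def avoid_iff)
  qed
  ultimately show ?thesis
    using finite by blast
qed

section \<open>Minimal covers by graded free modules\<close>

definition mat_vec :: "nat \<Rightarrow> nat \<Rightarrow> (nat \<Rightarrow> nat \<Rightarrow> ('v, 'k::field) mpoly) \<Rightarrow> ('v, 'k) mvec \<Rightarrow> ('v, 'k) mvec" where
  "mat_vec n m D u = (\<lambda>p. if p < n then \<Sum>l<m. D p l * u l else 0)"

definition syzygies :: "nat \<Rightarrow> nat \<Rightarrow> (nat \<Rightarrow> nat \<Rightarrow> ('v, 'k::field) mpoly) \<Rightarrow> ('v, 'k) mvec set" where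
  "syzygies n m D = {u \<in> free_vecs m. mat_vec n m D u = 0}"

lemma mat_vec_add: "mat_vec n m D (u + v) = mat_vec n m D u + mat_vec n m D v"
  by (simp add: mat_vec_def fun_eq_iff distrib_left sum.distrib)

lemma mat_vec_diff: "mat_vec n m D (u - v) = mat_vec n m D u - mat_vec n m D v"
  by (simp add: mat_vec_def fun_eq_iff right_diff_distrib sum_subtractf)

lemma mat_vec_scale: "mat_vec n m D (scale p u) = scale p (mat_vec n m D u)"
  by (auto simp: mat_vec_def fun_eq_iff scale_apply sum_distrib_left mult.left_commute intro!: sum.cong)

lemma mat_vec_0 [simp]: "mat_vec n m D 0 = 0"
  by (simp add: mat_vec_def fun_eq_iff)

lemma mat_vec_linear_op: "f \<in> linear_ops \<Longrightarrow> mat_vec n m D (f u) = f (mat_vec n m D u)"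
  by (auto simp: linear_ops_def mat_vec_scale)

lemma vec_comp_mat_vec:
  assumes "\<And>p l. p < n \<Longrightarrow> l < m \<Longrightarrow> homogeneous (sh' l - sh p) (D p l)"
  shows "vec_comp sh d (mat_vec n m D u) = mat_vec n m D (vec_comp sh' d u)"
proof
  fix p
  have "hom_comp (d - sh p) (D p l * u l) = D p l * hom_comp (d - sh' l) (u l)" if "p < n" "l < m" for l
    using hom_comp_mult[OF assms[OF that], of "d - sh p" "u l"] by simp
  then show "vec_comp sh d (mat_vec n m D u) p = mat_vec n m D (vec_comp sh' d u) p"
    by (simp add: vec_comp_def mat_vec_def hom_comp_sum)
qed

lemma vec_comp_zero [simp]: "vec_comp sh d 0 = 0"
  by (simp add: vec_comp_def fun_eq_iff)

lemma graded_submodule_syzygies: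
  assumes "\<And>p l. p < n \<Longrightarrow> l < m \<Longrightarrow> homogeneous (sh' l - sh p) (D p l)"
  shows "graded_submodule m sh' (syzygies n m D)"
  unfolding graded_submodule_def
proof (intro conjI ballI allI)
  show "vec.subspace (syzygies n m D)"
    using subspace_free_vecs[of m]
    by (auto simp: vec.subspace_def syzygies_def mat_vec_add mat_vec_scale)
  show "syzygies n m D \<subseteq> free_vecs m"
    by (auto simp: syzygies_def)
  fix u d assume u: "u \<in> syzygies n m D"
  then have "vec_comp sh' d u \<in> free_vecs m"
    using vec_comp_free_part[of u m sh' d] by (auto simp: syzygies_def intro: free_part_free_vecs)
  moreover have "vec_comp sh d (mat_vec n m D u) = mat_vec n m D (vec_comp sh' d u)"
    by (rule vec_comp_mat_vec) (rule assms)
  then have "mat_vec n m D (vec_comp sh' d u) = 0"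
    using u by (simp add: syzygies_def)
  ultimately show "vec_comp sh' d u \<in> syzygies n m D"
    by (simp add: syzygies_def)
qed

definition unit_vec :: "nat \<Rightarrow> ('v, 'k::field) mvec" where
  "unit_vec l = (\<lambda>i. if i = l then 1 else 0)"

lemma unit_vec_free_part: "l < m \<Longrightarrow> unit_vec l \<in> free_part m sh (sh l)"
  using homogeneous_const[of 1] by (auto simp: unit_vec_def free_part_def free_vecs_def)

text \<open>One step of a minimal resolution. Minimality is a condition on the kernel, not on the
  matrix of the cover, since that matrix may have unit entries when Z is an arbitrary
  submodule.\<close>

locale minimal_cover =
  fixes n :: nat and sh :: "nat \<Rightarrow> int" and Z :: "('v::{finite,linorder}, 'k::field) mvec set"
    and m :: nat and sh' :: "nat \<Rightarrow> int" and D :: "nat \<Rightarrow> nat \<Rightarrow> ('v, 'k) mpoly"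
  assumes Z: "graded_submodule n sh Z"
    and hom: "\<And>p l. p < n \<Longrightarrow> l < m \<Longrightarrow> homogeneous (sh' l - sh p) (D p l)"
    and image: "mat_vec n m D ` free_vecs m = Z"
    and minimal: "\<And>u l. u \<in> syzygies n m D \<Longrightarrow> coeff (u l) 0 = 0"
begin

lemma graded_syzygies: "graded_submodule m sh' (syzygies n m D)"
  using hom by (rule graded_submodule_syzygies)

lemma vec_comp_mat: "vec_comp sh d (mat_vec n m D u) = mat_vec n m D (vec_comp sh' d u)"
  by (rule vec_comp_mat_vec) (rule hom)

lemma mat_vec_free_part: "u \<in> free_part m sh' d \<Longrightarrow> mat_vec n m D u \<in> part n sh Z d"
proof -
  assume u: "u \<in> free_part m sh' d"
  have "vec_comp sh d (mat_vec n m D u) = mat_vec n m D u"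
    using vec_comp_id[OF u] by (simp add: vec_comp_mat)
  moreover have "mat_vec n m D u \<in> Z"
    using image free_part_free_vecs[OF u] by blast
  ultimately show ?thesis
    using vec_comp_part[OF Z] by metis
qed

lemma image_part: "mat_vec n m D ` free_part m sh' d = part n sh Z d"
proof
  show "mat_vec n m D ` free_part m sh' d \<subseteq> part n sh Z d"
    using mat_vec_free_part by blast
  show "part n sh Z d \<subseteq> mat_vec n m D ` free_part m sh' d"
  proof
    fix z assume z: "z \<in> part n sh Z d"
    then obtain u where u: "u \<in> free_vecs m" "z = mat_vec n m D u"
      using image by (auto simp: part_def)
    have "z = vec_comp sh d z"
      using z vec_comp_id by (metis IntD2 part_def)
    also have "\<dots> = mat_vec n m D (vec_comp sh' d u)"
      using u by (simp add: vec_comp_mat)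
    finally show "z \<in> mat_vec n m D ` free_part m sh' d"
      using vec_comp_free_part[OF u(1)] by blast
  qed
qed

text \<open>The cover identifies the free module modulo its syzygies with Z.\<close>

lemma linear_regular_cover:
  "linear_regular (free_part m sh') (part m sh' (syzygies n m D)) forms p r \<longleftrightarrow>
   linear_regular (part n sh Z) zero_part forms p r"
  by (rule lin.linear_regular_transport[where \<phi> = "mat_vec n m D"])
    (use free_part_free_vecs in \<open>auto simp: mat_vec_add mat_vec_linear_op graded_free_part image_part forms_linear_ops part_def syzygies_def\<close>)

lemma linear_regular_syzygies:
  assumes "linear_regular (part n sh Z) zero_part forms p r"
  shows "linear_regular (part m sh' (syzygies n m D)) zero_part forms (Suc p) (r + 1)"
proof (rule lin.linear_regular_syzygy[OF graded_free_part[of m sh'] graded_part[OF graded_syzygies]])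
  show "part m sh' (syzygies n m D) d \<subseteq> adjoin (free_part m sh') zero_part forms d" for d
    using minimal by (auto simp: part_def intro!: const_free_adjoin)
  show "linear_regular (free_part m sh') (part m sh' (syzygies n m D) \<oplus> zero_part) forms p r"
    using assms by (simp add: linear_regular_cover)
qed (simp_all add: forms_linear_ops regular_seq_forms, simp add: part_def)

lemma linear_regular_of_syzygies:
  assumes reg: "linear_regular (part n sh Z) zero_part forms p r"
    and le: "\<And>l. l < m \<Longrightarrow> sh' l \<le> s"
    and syz: "linear_regular (part m sh' (syzygies n m D)) zero_part forms 0 (s + 1)"
  shows "linear_regular (part n sh Z) zero_part forms 0 s"
proof -
  have "linear_regular (free_part m sh') (part m sh' (syzygies n m D) \<oplus> zero_part) forms 0 s"
  proof (rule lin.linear_regular_of_syzygy[OF graded_free_part[of m sh'] graded_part[OF graded_syzygies]])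
    show "free_part m sh' d \<subseteq> adjoin (free_part m sh') zero_part (forms :: (('v, 'k) mvec \<Rightarrow> _) list) d"
      if d: "s < d" for d
    proof
      fix u :: "('v, 'k) mvec" assume u: "u \<in> free_part m sh' d"
      have "coeff (u l) 0 = 0" for l
      proof (cases "l < m")
        case True
        then have "d - sh' l \<noteq> 0"
          using le[of l] d by simp
        then show ?thesis
          using free_part_homogeneous[OF u, of l] by (force simp: homogeneous_def in_keys_iff)
      qed (use u in \<open>simp add: free_part_def free_vecs_def\<close>)
      then show "u \<in> adjoin (free_part m sh') zero_part forms d"
        using u by (intro const_free_adjoin)
    qed
    show "linear_regular (free_part m sh') (part m sh' (syzygies n m D) \<oplus> zero_part) forms 0 r"
      using linear_regular_mono[OF reg] by (simp add: linear_regular_cover)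
  qed (simp_all add: forms_linear_ops regular_seq_forms syz, simp add: part_def)
  then show ?thesis
    by (simp add: linear_regular_cover)
qed

text \<open>A generator of degree above r would be a combination of forms times elements of Z. Its
  unit vector would then differ by a syzygy from a vector without constant terms, against
  minimality.\<close>

lemma shift_le:
  assumes reg: "linear_regular (part n sh Z) zero_part forms p r" and l: "l < m"
  shows "sh' l \<le> r"
proof (rule ccontr)
  assume "\<not> sh' l \<le> r"
  then have "part n sh Z (sh' l) \<subseteq> adjoin (part n sh Z) zero_part forms (sh' l)"
    using linear_regular_adjoin[OF reg] by simp
  also have "\<dots> \<subseteq> mat_vec n m D ` {u \<in> free_vecs m. \<forall>i. coeff (u i) 0 = 0}" (is "_ \<subseteq> _ ` ?C")
  proof (rule adjoin_least)
    show "x + y \<in> mat_vec n m D ` ?C" if "x \<in> mat_vec n m D ` ?C" "y \<in> mat_vec n m D ` ?C" for x y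
    proof -
      obtain a b where "a \<in> ?C" "b \<in> ?C" "x = mat_vec n m D a" "y = mat_vec n m D b"
        using \<open>x \<in> _\<close> \<open>y \<in> _\<close> by (elim imageE)
      then have "x + y = mat_vec n m D (a + b)"
        by (simp add: mat_vec_add)
      moreover have "a + b \<in> ?C"
        using \<open>a \<in> ?C\<close> \<open>b \<in> ?C\<close> by (simp add: free_vecs_def lookup_add)
      ultimately show ?thesis by blast
    qed
    show "{0} \<subseteq> mat_vec n m D ` ?C"
      using mat_vec_0[of n m D] by (force simp: free_vecs_def image_iff)
    fix f :: "('v, 'k) mvec \<Rightarrow> ('v, 'k) mvec" and x
    assume f: "f \<in> set forms" and x: "x \<in> part n sh Z (sh' l - 1)"
    obtain p where p: "homogeneous 1 p" "f = scale p"
      using f forms_linear_ops by (auto simp: linear_ops_def)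
    obtain u where u: "u \<in> free_part m sh' (sh' l - 1)" "x = mat_vec n m D u"
      using x image_part by blast
    have "coeff p 0 = 0"
      using p(1) by (force simp: homogeneous_def in_keys_iff)
    then have "scale p u \<in> ?C"
      using u(1) by (simp add: scale_apply coeff_zero_mult free_part_def free_vecs_def)
    then show "f x \<in> mat_vec n m D ` ?C"
      unfolding p(2) u(2) mat_vec_scale[symmetric] by (rule imageI)
  qed
  finally have "mat_vec n m D (unit_vec l) \<in> mat_vec n m D ` ?C"
    using mat_vec_free_part[OF unit_vec_free_part[OF l]] by blast
  then obtain u where u: "u \<in> ?C" "mat_vec n m D (unit_vec l) = mat_vec n m D u"
    by blast
  have "unit_vec l - u \<in> syzygies n m D"
    using u free_part_free_vecs[OF unit_vec_free_part[OF l, of sh']]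
    by (auto simp: syzygies_def mat_vec_diff intro: vec.subspace_diff[OF subspace_free_vecs])
  from minimal[OF this, of l] show False
    using u(1) by (simp add: unit_vec_def lookup_minus)
qed

text \<open>A nonzero entry of the image of a unit vector has no constant term, hence positive
  degree. The resulting lower bound on all shifts makes the set in \<open>reg\<close>
  finite.\<close>

lemma shift_ge:
  assumes const: "\<And>u p. u \<in> Z \<Longrightarrow> coeff (u p) 0 = 0" and ge: "\<And>p. p < n \<Longrightarrow> i \<le> sh p" and l: "l < m"
  shows "i + 1 \<le> sh' l"
proof -
  let ?z = "mat_vec n m D (unit_vec l)"
  have z: "?z \<in> part n sh Z (sh' l)"
    using mat_vec_free_part[OF unit_vec_free_part[OF l]] .
  have "?z \<noteq> 0"
  proof
    assume "?z = 0"
    then have "unit_vec l \<in> syzygies n m D"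
      using free_part_free_vecs[OF unit_vec_free_part[OF l, of sh']] by (simp add: syzygies_def)
    from minimal[OF this, of l] show False
      by (simp add: unit_vec_def)
  qed
  then obtain p where "?z p \<noteq> 0"
    by (auto simp: fun_eq_iff)
  then have p: "p < n"
    by (simp add: mat_vec_def split: if_splits)
  obtain e where e: "e \<in> keys (?z p)"
    using \<open>?z p \<noteq> 0\<close> by (metis poly_mapping_eqI in_keys_iff lookup_zero)
  have "e \<noteq> 0"
    using e const z by (auto simp: in_keys_iff part_def)
  then have "monom_deg e \<noteq> 0"
    by (simp add: monom_deg_eq_0)
  moreover have "int (monom_deg e) = sh' l - sh p"
    using z free_part_homogeneous[of ?z n sh "sh' l" p] e by (auto simp: part_def homogeneous_def)
  ultimately show ?thesis
    using ge[OF p] by linarith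
qed

end

text \<open>Linear algebra over the constants: in a fixed degree the vectors \<open>e l a\<close>
  with a single monomial entry are finite in number and span, so independent subsets are
  finite.\<close>

lemma finite_part_generators:
  fixes Z :: "('v::{finite,linorder}, 'k::field) mvec set"
  assumes Z: "graded_submodule n sh Z"
  obtains B where "finite B" "B \<subseteq> part n sh Z d" "part n sh Z d \<subseteq> vec.span B"
proof -
  interpret K: vector_space "\<lambda>c. scale (single 0 c :: ('v, 'k) mpoly)"
    by (rule vector_space_scale_const)
  define e where "e l a = (\<lambda>i. if i = l then single a 1 else 0 :: ('v, 'k) mpoly)" for l :: nat and a :: "'v \<Rightarrow>\<^sub>0 nat"
  define T where "T = (\<Union>l<n. e l ` {a. int (monom_deg a) = d - sh l})"
  have T: "finite T"
    by (simp add: T_def finite_monom_deg)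
  have sub: "part n sh Z d \<subseteq> K.span T"
  proof
    fix u assume "u \<in> part n sh Z d"
    then have u: "u \<in> free_part n sh d"
      by (simp add: part_def)
    have "u = (\<Sum>l<n. \<Sum>a\<in>keys (u l). scale (single 0 (coeff (u l) a)) (e l a))"
    proof
      fix i
      have "(\<Sum>a\<in>keys (u l). scale (single 0 (coeff (u l) a)) (e l a)) i = (if l = i then u i else 0)" for l
      proof (cases "l = i")
        case True
        then have "(\<Sum>a\<in>keys (u l). scale (single 0 (coeff (u l) a)) (e l a)) i = (\<Sum>a\<in>keys (u i). single a (coeff (u i) a))"
          by (simp add: sum_fun_apply scale_apply e_def mult_single)
        then show ?thesis
          using True by (simp add: poly_mapping_sum_single)
      qed (simp add: sum_fun_apply scale_apply e_def)
      then have "(\<Sum>l<n. \<Sum>a\<in>keys (u l). scale (single 0 (coeff (u l) a)) (e l a)) i = (\<Sum>l<n. if l = i then u i else 0)"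
        by (subst sum_fun_apply) simp
      also have "\<dots> = u i"
        using u by (auto simp: free_part_def free_vecs_def)
      finally show "u i = (\<Sum>l<n. \<Sum>a\<in>keys (u l). scale (single 0 (coeff (u l) a)) (e l a)) i" ..
    qed
    moreover have "e l a \<in> T" if "l < n" "a \<in> keys (u l)" for l a
      using u that by (auto simp: T_def free_part_def homogeneous_def)
    ultimately show "u \<in> K.span T"
      by (metis (no_types, lifting) K.span_base K.span_scale K.span_sum lessThan_iff)
  qed
  obtain B where B: "B \<subseteq> part n sh Z d" "K.independent B" "part n sh Z d \<subseteq> K.span B"
    using K.maximal_independent_subset by blast
  have "finite B"
    using K.independent_span_bound[OF T B(2)] B(1) sub by blast
  moreover have "K.subspace (vec.span B)"
    by (auto simp: K.subspace_def vec.span_zero vec.span_add vec.span_scale)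
  then have "K.span B \<subseteq> vec.span B"
    by (intro K.span_minimal vec.span_superset)
  ultimately show ?thesis
    using that B by blast
qed

lemma finite_generators:
  fixes Z :: "('v::{finite,linorder}, 'k::field) mvec set"
  assumes Z: "graded_submodule n sh Z"
    and gen: "\<And>d. r < d \<Longrightarrow> part n sh Z d \<subseteq> adjoin (part n sh Z) zero_part forms d"
  obtains B where "finite B" "B \<subseteq> (\<Union>d. part n sh Z d)" "vec.span B = Z"
proof -
  obtain d0 where d0: "\<And>d. d < d0 \<Longrightarrow> free_part n sh d \<subseteq> {0 :: ('v, 'k) mvec}"
    using free_part_bounded[where n = n and sh = sh] by blast
  have "\<exists>G. finite G \<and> G \<subseteq> part n sh Z d \<and> part n sh Z d \<subseteq> vec.span G" for d
    using finite_part_generators[OF Z] by metis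
  then obtain G where G: "\<And>d. finite (G d)" "\<And>d. G d \<subseteq> part n sh Z d" "\<And>d. part n sh Z d \<subseteq> vec.span (G d)"
    by metis
  define B where "B = (\<Union>d\<in>{d0..r}. G d)"
  have low: "part n sh Z d \<subseteq> vec.span B" if "d \<le> r" for d
  proof (cases "d < d0")
    case True
    then show ?thesis
      using d0[of d] vec.span_zero by (auto simp: part_def)
  next
    case False
    then have "G d \<subseteq> B"
      unfolding B_def using that by (intro UN_upper) simp
    then show ?thesis
      using G(3) vec.span_mono by blast
  qed
  \<comment> \<open>Above r every element is a combination of forms times elements one degree lower,
    so induction on the degree reduces to the pieces up to r.\<close>
  have all: "part n sh Z d \<subseteq> vec.span B" for d
  proof (induction "nat (d - r)" arbitrary: d rule: less_induct)
    case less
    show ?case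
    proof (cases "d \<le> r")
      case False
      then have "part n sh Z d \<subseteq> adjoin (part n sh Z) zero_part forms d"
        using gen by simp
      also have "\<dots> \<subseteq> vec.span B"
      proof (rule adjoin_least)
        fix f x assume "f \<in> set (forms :: (('v, 'k) mvec \<Rightarrow> _) list)" and x: "x \<in> part n sh Z (d - 1)"
        then obtain p where "f = scale p"
          using forms_linear_ops by (auto simp: linear_ops_def)
        moreover have "x \<in> vec.span B"
          using less[of "d - 1"] False x by auto
        ultimately show "f x \<in> vec.span B"
          by (simp add: vec.span_scale)
      qed (auto simp: vec.span_add vec.span_zero)
      finally show ?thesis .
    qed (use low in blast)
  qed
  have "B \<subseteq> Z"
    using G(2) by (auto simp: B_def part_def)
  then have "vec.span B \<subseteq> Z"
    using Z by (intro vec.span_minimal) (simp_all add: graded_submodule_def)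
  moreover have "Z \<subseteq> vec.span B"
  proof
    fix u assume u: "u \<in> Z"
    then obtain E where "finite E" "(\<Sum>d\<in>E. vec_comp sh d u) = u"
      using Z sum_vec_comp[of u n sh] by (auto simp: graded_submodule_def)
    moreover have "vec_comp sh d u \<in> vec.span B" for d
      using vec_comp_part[OF Z u] all by blast
    ultimately show "u \<in> vec.span B"
      by (metis vec.span_sum)
  qed
  ultimately have "vec.span B = Z"
    by (rule subset_antisym)
  moreover have "finite B"
    by (simp add: B_def G(1))
  moreover have "B \<subseteq> (\<Union>d. part n sh Z d)"
    unfolding B_def using G(2) by (intro UN_mono) auto
  ultimately show ?thesis
    using that by metis
qed

text \<open>A homogeneous generating set of least cardinality is irredundant, whereas a syzygy with
  a nonzero constant term would make one generator redundant.\<close>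

lemma minimal_cover_exists:
  fixes Z :: "('v::{finite,linorder}, 'k::field) mvec set"
  assumes Z: "graded_submodule n sh Z"
    and gen: "\<And>d. r < d \<Longrightarrow> part n sh Z d \<subseteq> adjoin (part n sh Z) zero_part forms d"
  obtains m sh' D where "minimal_cover n sh Z m sh' D"
proof -
  let ?gens = "\<lambda>B. finite B \<and> B \<subseteq> (\<Union>d. part n sh Z d) \<and> vec.span B = Z"
  obtain B0 where "?gens B0"
    using finite_generators[OF Z gen] by metis
  then obtain B where B: "finite B" "B \<subseteq> (\<Union>d. part n sh Z d)" "vec.span B = Z"
    and B_min: "\<And>C. ?gens C \<Longrightarrow> card B \<le> card C"
    using ex_has_least_nat[of ?gens B0 card] by blast
  have irredundant: "b \<notin> vec.span (B - {b})" if "b \<in> B" for b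
  proof
    assume b: "b \<in> vec.span (B - {b})"
    have "B \<subseteq> vec.span (B - {b})"
    proof
      fix x assume "x \<in> B"
      then show "x \<in> vec.span (B - {b})"
        using b vec.span_base[of x "B - {b}"] by (cases "x = b") simp_all
    qed
    then have "Z \<subseteq> vec.span (B - {b})"
      unfolding B(3)[symmetric] by (rule vec.span_minimal) (rule vec.subspace_span)
    moreover have "vec.span (B - {b}) \<subseteq> Z"
      unfolding B(3)[symmetric] by (rule vec.span_mono) (rule Diff_subset)
    ultimately have "vec.span (B - {b}) = Z"
      by (rule subset_antisym[rotated])
    then have "card B \<le> card (B - {b})"
      using B(1,2) by (intro B_min conjI finite_Diff subset_trans[OF Diff_subset])
    then show False
      using B(1) that by (metis card_Diff1_less not_le)
  qed
  define m where "m = card B"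
  obtain g where g: "bij_betw g {..<m} B"
    using ex_bij_betw_nat_finite[OF B(1)] by (auto simp: m_def lessThan_atLeast0)
  have "\<exists>d. g l \<in> part n sh Z d" if "l < m" for l
    using bij_betwE[OF g] B(2) that by blast
  then obtain sh' where sh': "\<And>l. l < m \<Longrightarrow> g l \<in> part n sh Z (sh' l)"
    by metis
  define D where "D p l = g l p" for p l
  have mat_vec: "mat_vec n m D u = (\<Sum>l<m. scale (u l) (g l))" for u
  proof
    fix p
    show "mat_vec n m D u p = (\<Sum>l<m. scale (u l) (g l)) p"
    proof (cases "p < n")
      case False
      then have "g l p = 0" if "l < m" for l
        using sh'[OF that] by (auto simp: part_def free_part_def free_vecs_def)
      then show ?thesis
        using False by (simp add: mat_vec_def sum_fun_apply scale_apply)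
    qed (simp add: mat_vec_def D_def sum_fun_apply scale_apply mult.commute)
  qed
  have hom: "homogeneous (sh' l - sh p) (D p l)" if "p < n" "l < m" for p l
    using sh'[OF that(2)] by (auto simp: D_def part_def free_part_homogeneous)
  have "mat_vec n m D ` free_vecs m = Z"
  proof
    show "mat_vec n m D ` free_vecs m \<subseteq> Z"
      using Z sh' unfolding mat_vec graded_submodule_def part_def
      by (auto intro!: vec.subspace_sum vec.subspace_scale)
    show "Z \<subseteq> mat_vec n m D ` free_vecs m"
    proof
      fix z assume "z \<in> Z"
      then obtain c where "z = (\<Sum>b\<in>B. scale (c b) b)"
        using vec.span_finite[OF B(1)] B(3) by auto
      also have "\<dots> = (\<Sum>l<m. scale (c (g l)) (g l))"
        using sum.reindex_bij_betw[OF g, of "\<lambda>b. scale (c b) b"] by simp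
      also have "\<dots> = mat_vec n m D (\<lambda>l. if l < m then c (g l) else 0)"
        unfolding mat_vec by (intro sum.cong) auto
      finally show "z \<in> mat_vec n m D ` free_vecs m"
        by (auto simp: free_vecs_def)
    qed
  qed
  moreover have "coeff (u l) 0 = 0" if u: "u \<in> syzygies n m D" for u l
  proof (rule ccontr)
    assume c: "coeff (u l) 0 \<noteq> 0"
    \<comment> \<open>In the component of degree \<open>sh' l\<close> the entry at l has degree 0,
      so it is the nonzero constant term itself and can be inverted.\<close>
    define v where "v = vec_comp sh' (sh' l) u"
    have l: "l < m"
      using u c free_vecsD[of u m l] by (cases "l < m") (simp_all add: syzygies_def)
    have "v \<in> syzygies n m D"
      using u graded_submodule_syzygies[of n m sh' sh D] hom by (simp add: v_def graded_submodule_def)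
    then have "(\<Sum>l<m. scale (v l) (g l)) = 0"
      by (simp add: syzygies_def mat_vec)
    then have "scale (v l) (g l) = - (\<Sum>i\<in>{..<m} - {l}. scale (v i) (g i))"
      using l by (simp add: sum.remove[of _ l] eq_neg_iff_add_eq_0)
    also have "\<dots> \<in> vec.span (B - {g l})"
      using g l by (intro vec.span_neg vec.span_sum vec.span_scale vec.span_base)
        (auto simp: bij_betw_def inj_on_def)
    finally have "scale (single 0 (inverse (coeff (u l) 0))) (scale (v l) (g l)) \<in> vec.span (B - {g l})"
      by (rule vec.span_scale)
    moreover have "v l = single 0 (coeff (u l) 0)"
      by (rule poly_mapping_eqI)
        (auto simp: v_def vec_comp_def coeff_hom_comp monom_deg_eq_0 lookup_single "when_def")
    ultimately have "g l \<in> vec.span (B - {g l})"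
      using c by (simp add: mult_single)
    then show False
      using irredundant bij_betwE[OF g] l by blast
  qed
  ultimately have "minimal_cover n sh Z m sh' D"
    using Z hom by unfold_locales auto
  then show ?thesis
    by (rule that)
qed

section \<open>Minimal graded free resolutions\<close>

definition ideal_vecs :: "('v, 'k::field) mpoly set \<Rightarrow> ('v, 'k) mvec set" where
  "ideal_vecs J = {u \<in> free_vecs 1. u 0 \<in> J}"

definition homogeneous_ideal :: "('v::finite, 'k::field) mpoly set \<Rightarrow> bool" where
  "homogeneous_ideal J \<longleftrightarrow> is_ideal J \<and> (\<forall>f\<in>J. \<forall>d. hom_comp d f \<in> J)"

lemma graded_submodule_ideal_vecs: "homogeneous_ideal J \<Longrightarrow> graded_submodule 1 0 (ideal_vecs J)"
  by (auto simp: graded_submodule_def homogeneous_ideal_def ideal_subspace_iff vec.subspace_def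
      ideal_vecs_def free_vecs_def scale_apply vec_comp_def)

text \<open>The resolution continued by \<open>R\<close> on the right, so that it resolves the ideal as a submodule of \<open>R\<close>.\<close>

definition ext_rank :: "('v, 'k::field) mpoly free_res \<Rightarrow> nat \<Rightarrow> nat" where
  "ext_rank F i = (case i of 0 \<Rightarrow> 1 | Suc j \<Rightarrow> res_rank F j)"

definition ext_shift :: "('v, 'k::field) mpoly free_res \<Rightarrow> nat \<Rightarrow> nat \<Rightarrow> int" where
  "ext_shift F i = (case i of 0 \<Rightarrow> 0 | Suc j \<Rightarrow> res_shift F j)"

definition ext_diff :: "('v, 'k::field) mpoly free_res \<Rightarrow> nat \<Rightarrow> nat \<Rightarrow> nat \<Rightarrow> ('v, 'k) mpoly" where
  "ext_diff F i = (case i of 0 \<Rightarrow> (\<lambda>_. res_aug F) | Suc j \<Rightarrow> res_diff F j)"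

text \<open>With the ideal as the zeroth syzygy module, exactness at all places becomes one family
  of equations.\<close>

definition ext_syz :: "('v, 'k::field) mpoly set \<Rightarrow> ('v, 'k) mpoly free_res \<Rightarrow> nat \<Rightarrow> ('v, 'k) mvec set" where
  "ext_syz J F i = (case i of 0 \<Rightarrow> ideal_vecs J
     | Suc j \<Rightarrow> syzygies (ext_rank F j) (ext_rank F i) (ext_diff F j))"

lemma free_module_eq: "free_module F i = free_vecs (res_rank F i)"
  by (simp add: free_module_def free_vecs_def)

lemma apply_diff_eq: "apply_diff F i = mat_vec (res_rank F i) (res_rank F (Suc i)) (res_diff F i)"
  by (simp add: apply_diff_def mat_vec_def fun_eq_iff)

lemma apply_aug_eq: "mat_vec (Suc 0) (res_rank F 0) (\<lambda>_. res_aug F) u = (\<lambda>p. if p = 0 then apply_aug F u else 0)"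
  by (simp add: apply_aug_def mat_vec_def fun_eq_iff mult.commute)

lemma ext_exact_0:
  fixes J :: "('v, 'k::field) mpoly set"
  shows "mat_vec (ext_rank F 0) (ext_rank F (Suc 0)) (ext_diff F 0) ` free_vecs (ext_rank F (Suc 0)) = ext_syz J F 0
     \<longleftrightarrow> apply_aug F ` free_module F 0 = J"
proof -
  let ?v = "\<lambda>f :: ('v, 'k) mpoly. \<lambda>p::nat. if p = 0 then f else 0"
  have "mat_vec (ext_rank F 0) (ext_rank F (Suc 0)) (ext_diff F 0) ` free_vecs (ext_rank F (Suc 0)) =
      ?v ` apply_aug F ` free_module F 0"
    by (simp add: ext_rank_def ext_diff_def apply_aug_eq free_module_eq image_image)
  moreover have "ext_syz J F 0 = ?v ` J"
    by (force simp: ext_syz_def ideal_vecs_def free_vecs_def fun_eq_iff image_iff)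
  moreover have "inj ?v"
    by (rule injI) (metis (full_types))
  ultimately show ?thesis
    by (simp add: inj_image_eq_iff)
qed

lemma ext_exact_Suc:
  "mat_vec (ext_rank F (Suc i)) (ext_rank F (Suc (Suc i))) (ext_diff F (Suc i)) ` free_vecs (ext_rank F (Suc (Suc i)))
     = apply_diff F i ` free_module F (Suc i)"
  by (simp add: ext_rank_def ext_diff_def apply_diff_eq free_module_eq)

lemma ext_syz_Suc_0: "ext_syz J F (Suc 0) = {u \<in> free_module F 0. apply_aug F u = 0}"
  by (simp add: ext_syz_def syzygies_def ext_rank_def ext_diff_def apply_aug_eq free_module_eq fun_eq_iff)

lemma ext_syz_Suc_Suc: "ext_syz J F (Suc (Suc i)) = {u \<in> free_module F (Suc i). apply_diff F i u = (\<lambda>_. 0)}"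
  by (simp add: ext_syz_def syzygies_def ext_rank_def ext_diff_def apply_diff_eq free_module_eq)

lemma all_nat_Suc: "(\<forall>i. P i) \<longleftrightarrow> P 0 \<and> (\<forall>i. P (Suc i))"
  by (metis nat.exhaust)

lemma free_resolution_iff:
  "free_resolution J F \<longleftrightarrow>
    (\<forall>i. mat_vec (ext_rank F i) (ext_rank F (Suc i)) (ext_diff F i) ` free_vecs (ext_rank F (Suc i)) = ext_syz J F i)"
  (is "_ \<longleftrightarrow> (\<forall>i. ?P i)")
proof -
  have "(\<forall>i. ?P i) \<longleftrightarrow> ?P 0 \<and> ?P (Suc 0) \<and> (\<forall>i. ?P (Suc (Suc i)))"
    by (subst all_nat_Suc, subst all_nat_Suc) (rule refl)
  moreover have "?P (Suc 0) \<longleftrightarrow> {u \<in> free_module F 0. apply_aug F u = 0} = apply_diff F 0 ` free_module F (Suc 0)"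
    unfolding ext_exact_Suc ext_syz_Suc_0 by (rule eq_commute)
  moreover have "?P (Suc (Suc i)) \<longleftrightarrow>
      {u \<in> free_module F (Suc i). apply_diff F i u = (\<lambda>_. 0)} = apply_diff F (Suc i) ` free_module F (Suc (Suc i))" for i
    unfolding ext_exact_Suc ext_syz_Suc_Suc by (rule eq_commute)
  ultimately show ?thesis
    unfolding free_resolution_def by (simp only: ext_exact_0)
qed

lemma graded_res_iff:
  "graded_res F \<longleftrightarrow> (\<forall>i. \<forall>p<ext_rank F i. \<forall>l<ext_rank F (Suc i).
     homogeneous (ext_shift F (Suc i) l - ext_shift F i p) (ext_diff F i p l))" (is "_ \<longleftrightarrow> (\<forall>i. ?P i)")
proof -
  have "(\<forall>i. ?P i) \<longleftrightarrow> ?P 0 \<and> (\<forall>i. ?P (Suc i))"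
    by (rule all_nat_Suc)
  then show ?thesis
    by (simp add: graded_res_def ext_rank_def ext_shift_def ext_diff_def)
qed

lemma mat_vec_irrelevant:
  assumes "\<And>p l. p < n \<Longrightarrow> l < m \<Longrightarrow> D p l \<in> irrelevant_ideal"
  shows "coeff (mat_vec n m D u p) 0 = 0"
  using assms by (auto simp: mat_vec_def lookup_sum coeff_zero_mult irrelevant_ideal_iff)

text \<open>By exactness the kernel of a cover is the image of the next matrix, whose entries lie in
  the irrelevant ideal.\<close>

lemma minimal_cover_resolution:
  fixes J :: "('v::{finite,linorder}, 'k::field) mpoly set"
  assumes J: "homogeneous_ideal J" and F: "minimal_graded_free_resolution J F"
  shows "minimal_cover (ext_rank F i) (ext_shift F i) (ext_syz J F i)
    (ext_rank F (Suc i)) (ext_shift F (Suc i)) (ext_diff F i)"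
proof
  have hom: "homogeneous (ext_shift F (Suc i) l - ext_shift F i p) (ext_diff F i p l)"
    if "p < ext_rank F i" "l < ext_rank F (Suc i)" for i p l
    using F that by (simp add: minimal_graded_free_resolution_def graded_res_iff)
  have exact: "mat_vec (ext_rank F i) (ext_rank F (Suc i)) (ext_diff F i) ` free_vecs (ext_rank F (Suc i)) = ext_syz J F i" for i
    using F by (simp add: minimal_graded_free_resolution_def free_resolution_iff)
  show "graded_submodule (ext_rank F i) (ext_shift F i) (ext_syz J F i)"
  proof (cases i)
    case 0
    then show ?thesis
      using graded_submodule_ideal_vecs[OF J] by (simp add: ext_rank_def ext_shift_def ext_syz_def)
  next
    case (Suc j)
    have "graded_submodule (ext_rank F (Suc j)) (ext_shift F (Suc j)) (syzygies (ext_rank F j) (ext_rank F (Suc j)) (ext_diff F j))"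
      by (rule graded_submodule_syzygies) (rule hom)
    then show ?thesis
      unfolding Suc by (simp add: ext_syz_def)
  qed
  show "homogeneous (ext_shift F (Suc i) l - ext_shift F i p) (ext_diff F i p l)"
    if "p < ext_rank F i" "l < ext_rank F (Suc i)" for p l
    using hom that .
  show "mat_vec (ext_rank F i) (ext_rank F (Suc i)) (ext_diff F i) ` free_vecs (ext_rank F (Suc i)) = ext_syz J F i"
    by (rule exact)
  fix u l assume u: "u \<in> syzygies (ext_rank F i) (ext_rank F (Suc i)) (ext_diff F i)"
  then have "u \<in> ext_syz J F (Suc i)"
    by (simp add: ext_syz_def)
  then obtain v where v: "u = mat_vec (ext_rank F (Suc i)) (ext_rank F (Suc (Suc i))) (ext_diff F (Suc i)) v"
    using exact[of "Suc i"] by blast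
  show "coeff (u l) 0 = 0"
    unfolding v
  proof (rule mat_vec_irrelevant)
    fix p l assume "p < ext_rank F (Suc i)" "l < ext_rank F (Suc (Suc i))"
    then show "ext_diff F (Suc i) p l \<in> irrelevant_ideal"
      using F by (simp add: minimal_graded_free_resolution_def minimal_res_def ext_rank_def ext_diff_def)
  qed
qed

lemma mat_vec_unit_vec: "p < n \<Longrightarrow> l < m \<Longrightarrow> mat_vec n m D (unit_vec l) p = D p l"
  by (simp add: mat_vec_def unit_vec_def if_distrib cong: if_cong)

text \<open>The columns of each matrix after the first are syzygies of the preceding cover, so the
  minimality of that cover removes their constant terms.\<close>

lemma minimal_resolution_of_covers:
  fixes J :: "('v::{finite,linorder}, 'k::field) mpoly set"
  assumes cover: "\<And>i. minimal_cover (ext_rank F i) (ext_shift F i) (ext_syz J F i)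
    (ext_rank F (Suc i)) (ext_shift F (Suc i)) (ext_diff F i)"
  shows "minimal_graded_free_resolution J F"
  unfolding minimal_graded_free_resolution_def
proof (intro conjI)
  show "free_resolution J F"
    unfolding free_resolution_iff using minimal_cover.image[OF cover] by blast
  show "graded_res F"
    unfolding graded_res_iff using minimal_cover.hom[OF cover] by blast
  show "minimal_res F"
    unfolding minimal_res_def
  proof (intro allI impI)
    fix i p l assume pl: "p < res_rank F i" "l < res_rank F (Suc i)"
    let ?z = "mat_vec (ext_rank F (Suc i)) (ext_rank F (Suc (Suc i))) (ext_diff F (Suc i)) (unit_vec l)"
    have "unit_vec l \<in> free_vecs (ext_rank F (Suc (Suc i)))"
      using pl(2) by (auto simp: unit_vec_def free_vecs_def ext_rank_def)
    then have "?z \<in> ext_syz J F (Suc i)"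
      using minimal_cover.image[OF cover, of "Suc i"] by blast
    then have "?z \<in> syzygies (ext_rank F i) (ext_rank F (Suc i)) (ext_diff F i)"
      by (simp add: ext_syz_def)
    from minimal_cover.minimal[OF cover this, of p]
    show "res_diff F i p l \<in> irrelevant_ideal"
      using pl by (simp add: mat_vec_unit_vec ext_rank_def ext_diff_def irrelevant_ideal_iff)
  qed
qed

text \<open>Dependent choice on tuples of rank, shifts, matrix and syzygy module. The regularity
  bound is carried along, growing by one per step, because it provides finite generators for the
  next cover.\<close>

lemma minimal_resolution_exists:
  fixes J :: "('v::{finite,linorder}, 'k::field) mpoly set"
  assumes J: "homogeneous_ideal J"
    and reg: "linear_regular (part 1 0 (ideal_vecs J)) zero_part forms 0 r"
  obtains F where "minimal_graded_free_resolution J F"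
proof -
  define P :: "nat \<Rightarrow> nat \<times> (nat \<Rightarrow> int) \<times> (nat \<Rightarrow> nat \<Rightarrow> ('v, 'k) mpoly) \<times> ('v, 'k) mvec set \<Rightarrow> bool" where
    "P i s = (case s of (n, sh, _, Z) \<Rightarrow> graded_submodule n sh Z \<and> linear_regular (part n sh Z) zero_part forms 0 (r + int i)
       \<and> (i = 0 \<longrightarrow> n = 1 \<and> sh = 0 \<and> Z = ideal_vecs J))" for i s
  define Q :: "nat \<Rightarrow> nat \<times> (nat \<Rightarrow> int) \<times> (nat \<Rightarrow> nat \<Rightarrow> ('v, 'k) mpoly) \<times> ('v, 'k) mvec set \<Rightarrow>
      nat \<times> (nat \<Rightarrow> int) \<times> (nat \<Rightarrow> nat \<Rightarrow> ('v, 'k) mpoly) \<times> ('v, 'k) mvec set \<Rightarrow> bool" where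
    "Q i s s' = (case (s, s') of ((n, sh, _, Z), (m, sh', D, Z')) \<Rightarrow>
       minimal_cover n sh Z m sh' D \<and> Z' = syzygies n m D)" for i s s'
  have base: "\<exists>s. P 0 s"
    using graded_submodule_ideal_vecs[OF J] reg by (auto simp: P_def)
  have step: "\<exists>s'. P (Suc i) s' \<and> Q i s s'" if "P i s" for i s
  proof -
    obtain n sh D0 Z where s: "s = (n, sh, D0, Z)"
      by (cases s)
    have Z: "graded_submodule n sh Z" and Zreg: "linear_regular (part n sh Z) zero_part forms 0 (r + int i)"
      using that by (simp_all add: P_def s)
    obtain m sh' D where "minimal_cover n sh Z m sh' D"
      using minimal_cover_exists[OF Z linear_regular_adjoin[OF Zreg]] by blast
    then interpret minimal_cover n sh Z m sh' D .
    have "linear_regular (part m sh' (syzygies n m D)) zero_part forms 0 (r + int (Suc i))"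
      using linear_regular_mono[OF linear_regular_syzygies[OF Zreg], of 0 "r + int (Suc i)"] by simp
    then have "P (Suc i) (m, sh', D, syzygies n m D)"
      using graded_syzygies by (simp add: P_def)
    moreover have "Q i s (m, sh', D, syzygies n m D)"
      using minimal_cover_axioms by (simp add: Q_def s)
    ultimately show ?thesis
      by blast
  qed
  obtain f where f: "\<And>i. P i (f i)" "\<And>i. Q i (f i) (f (Suc i))"
    using dependent_nat_choice[of P Q, OF base step] by blast
  \<comment> \<open>The zeroth tuple is the ideal inside R, so the resolution starts at index 1; the
    augmentation is the only row of the first matrix.\<close>
  define F where "F = \<lparr>res_rank = (\<lambda>i. fst (f (Suc i))), res_shift = (\<lambda>i. fst (snd (f (Suc i)))),
    res_aug = fst (snd (snd (f (Suc 0)))) 0, res_diff = (\<lambda>i. fst (snd (snd (f (Suc (Suc i))))))\<rparr>"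
  have f0: "fst (f 0) = 1" "fst (snd (f 0)) = 0" "snd (snd (snd (f 0))) = ideal_vecs J"
    using f(1)[of 0] by (auto simp: P_def split: prod.splits)
  have rank: "ext_rank F i = fst (f i)" for i
    by (simp add: ext_rank_def F_def f0 split: nat.split)
  have shift: "ext_shift F i = fst (snd (f i))" for i
    by (simp add: ext_shift_def F_def f0 split: nat.split)
  \<comment> \<open>\<open>ext_diff F 0\<close> repeats the augmentation in every row, so agreement
    can be claimed only for rows below the rank.\<close>
  have diff: "ext_diff F i p = fst (snd (snd (f (Suc i)))) p" if "p < ext_rank F i" for i p
    using that by (simp add: ext_diff_def ext_rank_def F_def f0 split: nat.splits)
  have mat: "mat_vec (ext_rank F i) m (ext_diff F i) = mat_vec (ext_rank F i) m (fst (snd (snd (f (Suc i)))))" for i m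
    by (auto simp: mat_vec_def fun_eq_iff diff)
  have syz: "ext_syz J F i = snd (snd (snd (f i)))" for i
  proof (cases i)
    case (Suc j)
    then show ?thesis
      using f(2)[of j] mat[of j] by (auto simp: ext_syz_def Q_def rank syzygies_def split: prod.splits)
  qed (simp add: ext_syz_def f0)
  have "minimal_cover (ext_rank F i) (ext_shift F i) (ext_syz J F i)
    (ext_rank F (Suc i)) (ext_shift F (Suc i)) (ext_diff F i)" for i
  proof -
    have c: "minimal_cover (ext_rank F i) (ext_shift F i) (ext_syz J F i)
        (ext_rank F (Suc i)) (ext_shift F (Suc i)) (fst (snd (snd (f (Suc i)))))"
      unfolding rank shift syz using f(2)[of i] by (auto simp: Q_def split: prod.splits)
    show ?thesis
    proof
      show "homogeneous (ext_shift F (Suc i) l - ext_shift F i p) (ext_diff F i p l)"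
        if "p < ext_rank F i" "l < ext_rank F (Suc i)" for p l
        using minimal_cover.hom[OF c that] diff[OF that(1)] by simp
      show "coeff (u l) 0 = 0" if "u \<in> syzygies (ext_rank F i) (ext_rank F (Suc i)) (ext_diff F i)" for u l
        using minimal_cover.minimal[OF c] that mat by (simp add: syzygies_def)
    qed (use minimal_cover.Z[OF c] minimal_cover.image[OF c] mat in simp_all)
  qed
  then have "minimal_graded_free_resolution J F"
    by (rule minimal_resolution_of_covers)
  then show ?thesis
    by (rule that)
qed

section \<open>Regularity of one-dimensional Cohen--Macaulay ideals\<close>

declare One_nat_def [simp del]

lemma const_vec_free_part:
  "homogeneous d f \<Longrightarrow> (\<lambda>p. if p = 0 then f else 0) \<in> free_part 1 0 d"
  by (simp add: free_part_def free_vecs_def)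

text \<open>R/J has the regular element l, and R/(J + (l)) has top degree exactly t:
  \<open>top\<close> makes it vanish above t, and \<open>f0\<close> represents a nonzero class in
  degree t.\<close>

locale linear_cm_ideal =
  fixes J :: "('v::{finite,linorder}, 'k::field) mpoly set" and t :: int and f0 :: "('v, 'k) mpoly"
  assumes J: "homogeneous_ideal J"
    and nonzerodivisor: "\<And>f. linear_form * f \<in> J \<Longrightarrow> f \<in> J"
    and top: "\<And>d f. t < d \<Longrightarrow> homogeneous d f \<Longrightarrow> \<exists>g. f - linear_form * g \<in> J"
    and f0: "homogeneous t f0" "\<And>g. f0 - linear_form * g \<notin> J"
    and t: "1 \<le> t"
    and card: "2 \<le> CARD('v)"
begin

abbreviation R_part :: "int \<Rightarrow> ('v, 'k) mvec set" where
  "R_part \<equiv> free_part 1 0"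

abbreviation J_part :: "int \<Rightarrow> ('v, 'k) mvec set" where
  "J_part \<equiv> part 1 0 (ideal_vecs J)"

lemma J_part_iff: "u \<in> J_part d \<longleftrightarrow> u \<in> R_part d \<and> u 0 \<in> J"
  by (auto simp: part_def ideal_vecs_def free_part_def)

lemma graded_J_part: "lin.graded J_part"
  using graded_part[OF graded_submodule_ideal_vecs[OF J]] .

text \<open>A nonzero constant term would be a homogeneous component of degree 0 in J, so J would be
  the whole ring and contain \<open>f0\<close>.\<close>

lemma J_const_free:
  assumes "f \<in> J"
  shows "coeff f 0 = 0"
proof (rule ccontr)
  assume c: "coeff f 0 \<noteq> 0"
  have "hom_comp 0 f = single 0 (coeff f 0)"
    by (rule poly_mapping_eqI) (auto simp: coeff_hom_comp monom_deg_eq_0 lookup_single "when_def")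
  then have "single 0 (coeff f 0) \<in> J"
    using J assms by (metis homogeneous_ideal_def)
  then have "(f0 * single 0 (inverse (coeff f 0))) * single 0 (coeff f 0) \<in> J"
    using J unfolding homogeneous_ideal_def ideal_subspace_iff by blast
  then have "f0 \<in> J"
    using c by (simp add: mult.assoc mult_single)
  then show False
    using f0(2)[of 0] by simp
qed

text \<open>The quotient provided by \<open>top\<close> need not be homogeneous; as J is, its
  component of degree d - 1 serves as well.\<close>

lemma R_part_cover:
  assumes "t < d"
  shows "R_part d \<subseteq> (J_part \<oplus> scale linear_form \<bullet> R_part) d"
proof
  fix u assume u: "u \<in> R_part d"
  have hu: "homogeneous d (u 0)"
    using free_part_homogeneous[OF u, of 0] by simp
  then obtain g where g: "u 0 - linear_form * g \<in> J"
    using top assms by blast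
  let ?g = "\<lambda>p::nat. if p = 0 then hom_comp (d - 1) g else 0"
  have g': "?g \<in> R_part (d - 1)"
    by (intro const_vec_free_part homogeneous_hom_comp)
  have "hom_comp d (u 0 - linear_form * g) = u 0 - linear_form * hom_comp (d - 1) g"
    using hom_comp_add[of d "u 0 - linear_form * g" "linear_form * g"] hom_comp_id[OF hu]
      hom_comp_mult[OF homogeneous_linear_form, of d g] by (simp add: algebra_simps)
  then have "u 0 - linear_form * hom_comp (d - 1) g \<in> J"
    using J g by (metis homogeneous_ideal_def)
  moreover have "u - scale linear_form ?g \<in> R_part d"
    using scale_free_part[OF homogeneous_linear_form g'] lin.graded_diff[OF graded_free_part u] by simp
  ultimately have "u - scale linear_form ?g \<in> J_part d"
    by (simp add: J_part_iff scale_apply)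
  then show "u \<in> (J_part \<oplus> scale linear_form \<bullet> R_part) d"
    using g' unfolding extend_iff by blast
qed

lemma not_covered: "(\<lambda>p. if p = 0 then f0 else 0) \<notin> (J_part \<oplus> scale linear_form \<bullet> R_part) t"
  using f0(2) by (auto simp: extend_iff J_part_iff scale_apply)

lemma linear_regular_quotient: "linear_regular R_part J_part forms 1 t"
proof -
  have "u \<in> J_part d" if "u \<in> R_part d" "scale linear_form u \<in> J_part (d + 1)" for u d
    using that nonzerodivisor by (simp add: J_part_iff scale_apply)
  moreover have "linear_regular R_part (J_part \<oplus> scale linear_form \<bullet> R_part)
      (map (\<lambda>v. scale (Var v)) (sorted_list_of_set (- {undefined}))) 0 t"
    using R_part_cover by (intro lin.linear_regular_bounded graded_free_part)
      (auto simp: scale_linear_ops homogeneous_Var)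
  ultimately show ?thesis
    by (simp add: forms_def)
qed

lemma J_part_const_free: "J_part d \<subseteq> adjoin R_part zero_part forms d"
proof
  fix u assume u: "u \<in> J_part d"
  have "coeff (u l) 0 = 0" for l
    using u J_const_free by (cases "l = 0") (auto simp: J_part_iff free_part_def free_vecs_def)
  then show "u \<in> adjoin R_part zero_part forms d"
    using u by (intro const_free_adjoin) (simp_all add: J_part_iff)
qed

text \<open>J is the first syzygy module of R/J, which has depth 1 and regularity bound t.\<close>

lemma linear_regular_ideal: "linear_regular J_part zero_part forms (Suc 1) (t + 1)"
  using lin.linear_regular_syzygy[OF graded_free_part graded_J_part _ graded_zero_part forms_linear_ops
      regular_seq_forms J_part_const_free, of 1 t] linear_regular_quotient
  by (simp add: J_part_iff subset_iff)

text \<open>If J were t-regular, R/J would be (t - 1)-regular, and the form after l would be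
  injective on R/(J + (l)) in degree t. It kills the class of \<open>f0\<close>, since nothing is
  left in degree t + 1. Two variables are needed for such a form to exist.\<close>

lemma ideal_not_regular: "\<not> linear_regular J_part zero_part forms 0 t"
proof
  assume reg: "linear_regular J_part zero_part forms 0 t"
  have "linear_regular R_part (J_part \<oplus> zero_part) forms 0 (t - 1)"
  proof (rule lin.linear_regular_of_syzygy[OF graded_free_part graded_J_part])
    show "R_part d \<subseteq> adjoin R_part zero_part (forms :: (('v, 'k) mvec \<Rightarrow> _) list) d" if d: "t - 1 < d" for d
    proof
      fix u assume u: "u \<in> R_part d"
      have "coeff (u l) 0 = 0" for l
        using free_part_homogeneous[OF u, of l] d t by (force simp: homogeneous_def in_keys_iff)
      then show "u \<in> adjoin R_part zero_part (forms :: (('v, 'k) mvec \<Rightarrow> _) list) d"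
        using u by (intro const_free_adjoin)
    qed
    show "linear_regular R_part (J_part \<oplus> zero_part) forms 0 t"
      using linear_regular_mono[OF linear_regular_quotient] by simp
  qed (use reg in \<open>auto simp: forms_linear_ops regular_seq_forms J_part_iff\<close>)
  then have *: "linear_regular R_part (J_part \<oplus> scale linear_form \<bullet> R_part)
      (map (\<lambda>v. scale (Var v)) (sorted_list_of_set (- {undefined}))) 0 (t - 1)"
    by (simp add: forms_def)
  have "- {undefined :: 'v} \<noteq> {}"
  proof
    assume "- {undefined :: 'v} = {}"
    then have "(UNIV :: 'v set) = {undefined}" by blast
    then have "CARD('v) = card {undefined :: 'v}" by (rule arg_cong)
    then show False
      using card by simp
  qed
  then obtain v vs where vs: "sorted_list_of_set (- {undefined :: 'v}) = v # vs"
    by (metis finite list.exhaust sorted_list_of_set_eq_Nil_iff)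
  let ?u = "\<lambda>p::nat. if p = 0 then f0 else 0"
  have u: "?u \<in> R_part t"
    using f0(1) by (rule const_vec_free_part)
  \<comment> \<open>Degree t + 1 lies above the top degree of R/(J + (l)).\<close>
  have "scale (Var v) ?u \<in> (J_part \<oplus> scale linear_form \<bullet> R_part) (t + 1)"
    using R_part_cover[of "t + 1"] scale_free_part[OF homogeneous_Var u, of v] by (simp add: subset_iff)
  then have "?u \<in> (J_part \<oplus> scale linear_form \<bullet> R_part) t"
    using * u unfolding vs by (simp add: algebra_simps)
  then show False
    using not_covered by blast
qed

section \<open>Shifts of a minimal resolution of J\<close>

context
  fixes F
  assumes F: "minimal_graded_free_resolution J F"
begin

lemmas cover = minimal_cover_resolution[OF J F]

abbreviation Syz_part :: "nat \<Rightarrow> int \<Rightarrow> ('v, 'k) mvec set" where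
  "Syz_part i \<equiv> part (ext_rank F i) (ext_shift F i) (ext_syz J F i)"

lemma Syz_part_0: "Syz_part 0 = J_part"
  by (simp add: ext_rank_def ext_shift_def ext_syz_def)

lemma ext_syz_Suc: "ext_syz J F (Suc i) = syzygies (ext_rank F i) (ext_rank F (Suc i)) (ext_diff F i)"
  by (simp add: ext_syz_def)

text \<open>\<open>Syz_part 0\<close> is J, of depth two; each further syzygy module gains one in
  depth and one in the regularity bound.\<close>

lemma linear_regular_Syz: "linear_regular (Syz_part i) zero_part forms (Suc (Suc i)) (t + 1 + int i)"
proof (induction i)
  case 0
  then show ?case
    unfolding Syz_part_0 using linear_regular_ideal by (simp add: One_nat_def)
next
  case (Suc i)
  show ?case
    unfolding ext_syz_Suc using minimal_cover.linear_regular_syzygies[OF cover Suc] by (simp add: ac_simps)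
qed

lemma res_shift_le: "l < res_rank F i \<Longrightarrow> res_shift F i l \<le> t + 1 + int i"
  using minimal_cover.shift_le[OF cover linear_regular_Syz] by (simp add: ext_rank_def ext_shift_def)

lemma ext_syz_const_free: "u \<in> ext_syz J F i \<Longrightarrow> coeff (u p) 0 = 0"
proof (cases i)
  case 0
  assume "u \<in> ext_syz J F i"
  then show ?thesis
    using J_const_free 0 by (cases "p = 0") (auto simp: ext_syz_def ideal_vecs_def free_vecs_def)
next
  case (Suc j)
  assume "u \<in> ext_syz J F i"
  then show ?thesis
    using minimal_cover.minimal[OF cover] by (simp add: Suc ext_syz_Suc)
qed

lemma ext_shift_ge: "l < ext_rank F i \<Longrightarrow> int i \<le> ext_shift F i l"
proof (induction i arbitrary: l)
  case 0
  then show ?case by (simp add: ext_shift_def)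
next
  case (Suc i)
  then show ?case
    using minimal_cover.shift_ge[OF cover, of i "int i" l] ext_syz_const_free by (simp add: add.commute)
qed

lemma res_shift_ge: "l < res_rank F i \<Longrightarrow> int i + 1 \<le> res_shift F i l"
  using ext_shift_ge[of l "Suc i"] by (simp add: ext_rank_def ext_shift_def)

text \<open>Otherwise all shifts are at most t + i. For i = N, the number of forms, the depth
  exceeds N and any bound holds; from there \<open>linear_regular_of_syzygies\<close> improves each
  \<open>Syz_part i\<close> to bound t + i, down to J, against
  \<open>ideal_not_regular\<close>.\<close>

lemma res_shift_attained: "\<exists>i. \<exists>l<res_rank F i. res_shift F i l = t + 1 + int i"
proof (rule ccontr)
  assume "\<not> ?thesis"
  then have less: "res_shift F i l \<le> t + int i" if "l < res_rank F i" for i l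
    using res_shift_le[OF that] that by force
  define N where "N = length (forms :: (('v, 'k) mvec \<Rightarrow> _) list)"
  have "j \<le> N \<Longrightarrow> linear_regular (Syz_part (N - j)) zero_part forms 0 (t + int (N - j))" for j
  proof (induction j)
    case 0
    then show ?case
      using linear_regular_long[OF linear_regular_Syz[of N]] by (simp add: N_def)
  next
    case (Suc j)
    let ?i = "N - Suc j"
    have i: "N - j = Suc ?i"
      using Suc.prems by simp
    have "linear_regular (Syz_part (Suc ?i)) zero_part forms 0 (t + int ?i + 1)"
      using Suc i by (simp add: ac_simps)
    then show ?case
      unfolding ext_syz_Suc
      by (intro minimal_cover.linear_regular_of_syzygies[OF cover linear_regular_Syz])
        (simp_all add: ext_rank_def ext_shift_def less)
  qed
  from this[of N] show False
    using ideal_not_regular unfolding diff_self_eq_0 Syz_part_0 by simp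
qed

end

theorem reg_eq: "reg J = t + 1"
proof -
  define F where "F = (SOME F. minimal_graded_free_resolution J F)"
  obtain F' where "minimal_graded_free_resolution J F'"
    using minimal_resolution_exists[OF J] linear_regular_mono[OF linear_regular_ideal, of 0 "t + 1"] by auto
  then have F: "minimal_graded_free_resolution J F"
    unfolding F_def by (rule someI)
  have betti: "0 < betti J i j \<longleftrightarrow> (\<exists>l<res_rank F i. res_shift F i l = j)" for i j
    by (auto simp: betti_def F_def[symmetric] Let_def card_gt_0_iff)
  let ?S = "{j - int i | i j. betti J i j \<noteq> 0}"
  \<comment> \<open>The lower end of the interval is there for finiteness, without which
    \<open>Max\<close> has no meaning.\<close>
  have "?S \<subseteq> {1..t + 1}"
  proof
    fix x assume "x \<in> ?S"
    then obtain i l where "l < res_rank F i" "x = res_shift F i l - int i"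
      by (auto simp: betti)
    then show "x \<in> {1..t + 1}"
      using res_shift_le[OF F, of l i] res_shift_ge[OF F, of l i] by simp
  qed
  then have "finite ?S" "\<forall>x\<in>?S. x \<le> t + 1"
    using finite_subset by fastforce+
  moreover have "t + 1 \<in> ?S"
  proof -
    obtain i l where "l < res_rank F i" "res_shift F i l = t + 1 + int i"
      using res_shift_attained[OF F] by blast
    then have "betti J i (t + 1 + int i) \<noteq> 0"
      using betti by auto
    then show ?thesis
      by force
  qed
  ultimately show ?thesis
    unfolding reg_def by (intro Max_eqI) auto
qed

end

declare One_nat_def [simp]

section \<open>Symbolic powers of the edge ideal\<close>

lemma is_ideal_power: "is_ideal I \<Longrightarrow> is_ideal (ideal_power I k)"
  by (cases k) (auto simp: ideal_mult_def ideal.subspace_UNIV)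

lemma one_notin_prime_ideal:
  assumes "prime_ideal P"
  shows "1 \<notin> P"
proof
  assume "1 \<in> P"
  then have "y \<in> P" for y
    using ideal.subspace_scale[of P 1 y] assms by (simp add: prime_ideal_def)
  then have "P = UNIV" by blast
  then show False
    using assms by (simp add: prime_ideal_def)
qed

text \<open>Finitely many fractions have a common denominator outside P, so every element of the
  extension is a single fraction with numerator in J.\<close>

lemma contraction_extended_ideal_iff:
  assumes P: "prime_ideal P" and J: "is_ideal J"
  shows "f \<in> contraction (extended_ideal J P) \<longleftrightarrow> (\<exists>s. s \<notin> P \<and> s * f \<in> J)"
proof
  have "0 \<in> P"
    using P by (auto simp: prime_ideal_def ideal.subspace_0)
  then have nonzero: "s \<noteq> 0" if "s \<notin> P" for s
    using that by blast
  {
    fix m :: nat and c :: "nat \<Rightarrow> 'a fract" and a :: "nat \<Rightarrow> 'a"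
    assume "\<forall>i<m. c i \<in> localization P \<and> a i \<in> J"
    then have "\<exists>b s. b \<in> J \<and> s \<notin> P \<and> (\<Sum>i<m. c i * Fract (a i) 1) = Fract b s"
    proof (induction m)
      case 0
      then show ?case
        using one_notin_prime_ideal[OF P] ideal.subspace_0[OF J]
        by (intro exI[of _ 0] exI[of _ 1]) (simp add: Zero_fract_def)
    next
      case (Suc m)
      then obtain b s where b: "b \<in> J" "s \<notin> P" "(\<Sum>i<m. c i * Fract (a i) 1) = Fract b s"
        by auto
      have "c m \<in> localization P" and am: "a m \<in> J"
        using Suc.prems by auto
      then obtain b' s' where b': "s' \<notin> P" "c m = Fract b' s'"
        by (auto simp: localization_def)
      have "(\<Sum>i<Suc m. c i * Fract (a i) 1) = Fract (b * s' + b' * a m * s) (s * s')"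
        using b b' nonzero by simp
      moreover have "s' * b + (b' * s) * a m \<in> J"
        by (intro ideal.subspace_add[OF J] ideal.subspace_scale[OF J] b(1) am)
      then have "b * s' + b' * a m * s \<in> J"
        by (simp only: mult_ac)
      moreover have "s * s' \<notin> P"
        using P b(2) b'(1) unfolding prime_ideal_def by blast
      ultimately show ?case
        by blast
    qed
  } note sum = this
  {
    assume "f \<in> contraction (extended_ideal J P)"
    then obtain b s where b: "b \<in> J" "s \<notin> P" "Fract f 1 = Fract b s"
      unfolding contraction_def extended_ideal_def using sum by auto metis
    then have "s * f = b"
      using nonzero by (simp add: eq_fract mult.commute)
    then show "\<exists>s. s \<notin> P \<and> s * f \<in> J"
      using b by blast
  next
    assume "\<exists>s. s \<notin> P \<and> s * f \<in> J"
    then obtain s where s: "s \<notin> P" "s * f \<in> J" by blast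
    have "Fract f 1 = (\<Sum>i<1::nat. (\<lambda>_. Fract 1 s) i * Fract ((\<lambda>_. s * f) i) 1)"
      using nonzero[OF s(1)] by (simp add: eq_fract)
    moreover have "\<forall>i<1::nat. (\<lambda>_. Fract 1 s) i \<in> localization P \<and> (\<lambda>_. s * f) i \<in> J"
      using s by (auto simp: localization_def)
    ultimately show "f \<in> contraction (extended_ideal J P)"
      unfolding contraction_def extended_ideal_def mem_Collect_eq by (intro exI conjI)
  }
qed

lemma ideal_of_monomials:
  fixes f :: "('v, 'k::field) mpoly"
  assumes I: "is_ideal I" and m: "\<And>m. m \<in> keys f \<Longrightarrow> single m 1 \<in> I"
  shows "f \<in> I"
proof -
  have "single 0 (coeff f m) * single m 1 \<in> I" if "m \<in> keys f" for m
    using ideal.subspace_scale[OF I m[OF that]] .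
  then have "(\<Sum>m\<in>keys f. single m (coeff f m)) \<in> I"
    by (intro ideal.subspace_sum[OF I]) (simp add: mult_single)
  then show ?thesis
    by (simp add: poly_mapping_sum_single)
qed

lemma monomial_multiple:
  fixes I :: "('v, 'k::field) mpoly set"
  shows "is_ideal I \<Longrightarrow> single m 1 \<in> I \<Longrightarrow> single (a + m) 1 \<in> I"
  using ideal.subspace_scale[of I "single m 1" "single a 1"] by (simp add: mult_single)

lemma Var_power: "Var v ^ n = (single (single v n) 1 :: ('v, 'k::field) mpoly)"
  by (induction n) (simp_all add: Var_def mult_single flip: single_add)

lemma prime_ideal_power: "prime_ideal P \<Longrightarrow> x ^ n \<in> P \<Longrightarrow> x \<in> P"
proof (induction n)
  case 0
  then show ?case
    using one_notin_prime_ideal by auto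
next
  case (Suc n)
  then show ?case by (auto simp: prime_ideal_def)
qed

text \<open>\<open>avoid (axis i)\<close> is the prime ideal generated by all variables except \<open>x\<^sub>i\<close>.\<close>

definition axis :: "'v \<Rightarrow> ('v \<Rightarrow>\<^sub>0 nat) set" where
  "axis i = {m. \<forall>j. j \<noteq> i \<longrightarrow> coeff m j = 0}"

lemma axis_iff: "m \<in> axis i \<longleftrightarrow> m = single i (coeff m i)"
proof
  assume "m \<in> axis i"
  then show "m = single i (coeff m i)"
    by (intro poly_mapping_eqI) (auto simp: axis_def lookup_single "when_def")
next
  assume m: "m = single i (coeff m i)"
  show "m \<in> axis i"
    by (subst m) (auto simp: axis_def lookup_single "when_def")
qed

lemma axis_closed: "a + b \<in> axis i \<Longrightarrow> b \<in> axis i"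
  by (auto simp: axis_def lookup_add)

lemma not_avoid_axis: "p \<notin> avoid (axis i) \<longleftrightarrow> (\<exists>e. single i e \<in> keys p)"
proof -
  have "single i e \<in> axis i" for e
    by (auto simp: axis_def lookup_single "when_def")
  then show ?thesis
    by (auto simp: avoid_def axis_iff) (metis axis_iff)
qed

text \<open>Primality is \<open>avoid_primary\<close> for the exponents on one axis: a polynomial
  outside the ideal contains a power of x_i.\<close>

lemma prime_ideal_axis: "prime_ideal (avoid (axis i) :: ('v::finite, 'k::field) mpoly set)"
  unfolding prime_ideal_def
proof (intro conjI allI impI)
  show "is_ideal (avoid (axis i) :: ('v, 'k) mpoly set)"
    by (rule is_ideal_avoid) (rule axis_closed)
  have "0 \<in> axis i"
    by (simp add: axis_def)
  then have "(1 :: ('v, 'k) mpoly) \<notin> avoid (axis i)"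
    by (auto simp: avoid_def)
  then show "avoid (axis i) \<noteq> (UNIV :: ('v, 'k) mpoly set)"
    by blast
  fix a b :: "('v, 'k) mpoly"
  assume ab: "a * b \<in> avoid (axis i)"
  show "a \<in> avoid (axis i) \<or> b \<in> avoid (axis i)"
  proof (rule disjCI)
    assume "b \<notin> avoid (axis i)"
    then obtain e where "single i e \<in> keys b"
      by (auto simp: not_avoid_axis)
    then show "a \<in> avoid (axis i)"
      using ab by (intro avoid_primary[where p = b and f = a and i = i])
        (auto simp: mult.commute axis_closed, auto simp: axis_def lookup_add lookup_single "when_def")
  qed
qed

locale weighted_tournament =
  fixes E :: "('v::{finite,linorder} \<times> 'v) set" and w :: "'v \<Rightarrow> nat"
  assumes graph: "weighted_oriented_complete_graph E w"
    and cover: "out_nbrs_set E (V_plus w) \<noteq> UNIV"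
begin

lemma no_loop: "(i, i) \<notin> E"
  and antisym_edge: "(i, j) \<in> E \<Longrightarrow> (j, i) \<notin> E"
  and total_edge: "i \<noteq> j \<Longrightarrow> (i, j) \<notin> E \<Longrightarrow> (j, i) \<in> E"
  and weight_pos: "1 \<le> w i"
  using graph unfolding weighted_oriented_complete_graph_def weighted_oriented_graph_def by blast+

lemma edge_neq: "(i, j) \<in> E \<Longrightarrow> i \<noteq> j"
  using no_loop by blast

text \<open>
  Localizing \<open>I(K\<^sub>n)\<close> at \<open>x\<^sub>i\<close> gives the complete intersection generated by the \<open>x\<^sub>j\<close> to the power
  \<open>axis_exp i j\<close>, \<open>j \<noteq> i\<close>; its \<open>k\<close>-th power is \<open>avoid (ray k i)\<close>.
\<close>

definition axis_exp :: "'v \<Rightarrow> 'v \<Rightarrow> nat" where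
  "axis_exp i j = (if (i, j) \<in> E then w j else 1)"

text \<open>The order of a monomial along the complete intersection at i: how many of its generators
  can be split off, with repetition and ignoring x_i. Membership in the k-th power means order at
  least k.\<close>

definition axis_val :: "'v \<Rightarrow> ('v \<Rightarrow>\<^sub>0 nat) \<Rightarrow> nat" where
  "axis_val i m = (\<Sum>j\<in>-{i}. coeff m j div axis_exp i j)"

definition ray :: "nat \<Rightarrow> 'v \<Rightarrow> ('v \<Rightarrow>\<^sub>0 nat) set" where
  "ray k i = {m. axis_val i m < k}"

lemma axis_exp_pos: "0 < axis_exp i j"
  using weight_pos[of j] by (simp add: axis_exp_def)

lemma axis_exp_le: "axis_exp i j \<le> w j"
  using weight_pos[of j] by (simp add: axis_exp_def)

lemma axis_val_add: "axis_val i a + axis_val i b \<le> axis_val i (a + b)"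
  unfolding axis_val_def lookup_add sum.distrib[symmetric]
  by (intro sum_mono) (metis div_add1_eq le_add1)

lemma axis_val_single [simp]: "axis_val i (single i e + m) = axis_val i m"
  by (auto simp: axis_val_def lookup_add lookup_single "when_def" intro!: sum.cong)

lemma axis_val_ge: "j \<noteq> i \<Longrightarrow> coeff m j div axis_exp i j \<le> axis_val i m"
  unfolding axis_val_def by (rule member_le_sum) auto

lemma ray_closed: "a + b \<in> ray k i \<Longrightarrow> b \<in> ray k i"
  using axis_val_add[of i a b] by (simp add: ray_def)

lemma ray_single: "single i e + m \<in> ray k i \<longleftrightarrow> m \<in> ray k i"
  by (simp add: ray_def)

lemma ray_primary:
  fixes f p :: "('v, 'k::field) mpoly"
  assumes "single i e \<in> keys p" "p * f \<in> avoid (ray k i)"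
  shows "f \<in> avoid (ray k i)"
  using ray_closed ray_single[THEN iffD2] assms by (rule avoid_primary)

lemma avoid_rays: "avoid (\<Union>i. ray k i) = (\<Inter>i. avoid (ray k i))"
  by (auto simp: avoid_def)

lemma is_ideal_avoid_rays: "is_ideal (avoid (\<Union>i. ray k i) :: ('v, 'k::field) mpoly set)"
  by (rule is_ideal_avoid) (use ray_closed in blast)

lemma is_ideal_edge_ideal: "is_ideal (edge_ideal E w :: ('v, 'k::field) mpoly set)"
  by (simp add: edge_ideal_def)

lemma edge_monomial:
  assumes "(x, y) \<in> E"
  shows "single (single x 1 + single y (w y)) 1 \<in> (edge_ideal E w :: ('v, 'k::field) mpoly set)"
proof -
  have "(single (single x 1 + single y (w y)) 1 :: ('v, 'k) mpoly) = Var x * Var y ^ w y"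
    unfolding Var_power by (simp add: Var_def mult_single)
  then show ?thesis
    unfolding edge_ideal_def using assms by (intro ideal.span_base) auto
qed

text \<open>If y = i, then x dominates i, so the exponent at x is 1 and x_x alone counts; otherwise
  the factor at y counts, since \<open>axis_exp i y\<close> is at most w y.\<close>

lemma edge_monomial_axis_val:
  assumes "(x, y) \<in> E"
  shows "1 \<le> axis_val i (single x 1 + single y (w y))"
proof (cases "i = y")
  case True
  have "coeff (single x 1 + single y (w y)) x div axis_exp i x = 1"
    using assms True antisym_edge edge_neq by (auto simp: axis_exp_def lookup_add lookup_single "when_def")
  then show ?thesis
    using axis_val_ge[of x i "single x 1 + single y (w y)"] True assms edge_neq by auto
next
  case False
  have "1 \<le> w y div axis_exp i y"
    using axis_exp_le[of i y] axis_exp_pos[of i y] by (simp add: Suc_le_eq div_greater_zero_iff)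
  then show ?thesis
    using axis_val_ge[of y i "single x 1 + single y (w y)"] False assms edge_neq
    by (auto simp: lookup_add lookup_single "when_def")
qed

text \<open>
  If no edge monomial divides \<open>m\<close>, then either the support \<open>S\<close> of \<open>m\<close> has a source \<open>i\<close>, or
  \<open>S \<subseteq> V\<^sup>+\<close> and any vertex \<open>i\<close> outside \<open>N\<^sup>+(V\<^sup>+)\<close> dominates \<open>S\<close>; in both cases \<open>m\<close> lies on the ray of \<open>i\<close>.
\<close>

lemma edge_monomial_divides:
  assumes m: "\<And>i. m \<notin> ray 1 i"
  obtains x y where "(x, y) \<in> E" "0 < coeff m x" "w y \<le> coeff m y"
proof (rule ccontr)
  assume "\<not> thesis"
  note divides = that
  have less: "coeff m y < w y" if "(x, y) \<in> E" "0 < coeff m x" for x y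
    using \<open>\<not> thesis\<close> divides[of x y] that by (cases "w y \<le> coeff m y") auto
  obtain i where i: "\<And>j. (j, i) \<in> E \<Longrightarrow> coeff m j = 0" "\<And>j. (i, j) \<in> E \<Longrightarrow> coeff m j < w j"
  proof (cases "\<exists>i. 0 < coeff m i \<and> (\<forall>j. (j, i) \<in> E \<longrightarrow> coeff m j = 0)")
    case True
    then show ?thesis
      using that less by blast
  next
    case False
    then have in_nbr: "\<exists>x. (x, j) \<in> E \<and> 0 < coeff m x" if "0 < coeff m j" for j
      using that by (meson gr0I)
    obtain i where i: "i \<notin> out_nbrs_set E (V_plus w)"
      using cover by blast
    have "coeff m j = 0" if "(j, i) \<in> E" for j
    proof (rule ccontr)
      assume "coeff m j \<noteq> 0"
      then have "0 < coeff m j" by simp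
      then have "coeff m j < w j"
        using in_nbr less by blast
      then have "j \<in> V_plus w"
        using \<open>0 < coeff m j\<close> by (simp add: V_plus_def)
      then show False
        using i that by (auto simp: out_nbrs_set_def out_nbrs_def)
    qed
    moreover have "coeff m j < w j" for j
      using in_nbr[of j] less weight_pos[of j] by (cases "0 < coeff m j") auto
    ultimately show ?thesis
      using that by blast
  qed
  have "coeff m j div axis_exp i j = 0" if "j \<noteq> i" for j
    using i[of j] total_edge[of i j] that by (auto simp: axis_exp_def)
  then have "axis_val i m = 0"
    by (simp add: axis_val_def)
  then show False
    using m[of i] by (simp add: ray_def)
qed

text \<open>The primary decomposition of the edge ideal. The hypothesis on N^+(V^+) enters here
  through \<open>edge_monomial_divides\<close>; it excludes an embedded component at the irrelevant
  ideal.\<close>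

lemma edge_ideal_eq: "(edge_ideal E w :: ('v, 'k::field) mpoly set) = avoid (\<Union>i. ray 1 i)"
proof
  show "(edge_ideal E w :: ('v, 'k) mpoly set) \<subseteq> avoid (\<Union>i. ray 1 i)"
    unfolding edge_ideal_def
  proof (rule ideal.span_minimal[OF _ is_ideal_avoid_rays], clarify)
    fix x y assume "(x, y) \<in> E"
    then have "single x 1 + single y (w y) \<notin> (\<Union>i. ray 1 i)"
      using edge_monomial_axis_val[of x y] by (auto simp: ray_def not_less Suc_le_eq)
    then show "Var x * Var y ^ w y \<in> (avoid (\<Union>i. ray 1 i) :: ('v, 'k) mpoly set)"
      unfolding Var_power by (simp add: Var_def mult_single single_avoid)
  qed
  show "avoid (\<Union>i. ray 1 i) \<subseteq> (edge_ideal E w :: ('v, 'k) mpoly set)"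
  proof
    fix f :: "('v, 'k) mpoly" assume f: "f \<in> avoid (\<Union>i. ray 1 i)"
    show "f \<in> edge_ideal E w"
    proof (rule ideal_of_monomials[OF is_ideal_edge_ideal])
      fix m assume "m \<in> keys f"
      then have "m \<notin> ray 1 i" for i
        using f by (auto simp: avoid_def)
      then obtain x y where xy: "(x, y) \<in> E" "0 < coeff m x" "w y \<le> coeff m y"
        by (rule edge_monomial_divides)
      obtain m1 where m1: "m = single y (w y) + m1"
        using xy(3) by (rule exp_split)
      have "1 \<le> coeff m1 x"
        using xy(2) edge_neq[OF xy(1)] by (auto simp: m1 lookup_add lookup_single "when_def")
      then obtain m2 where "m1 = single x 1 + m2"
        by (rule exp_split)
      then have "m = m2 + (single x 1 + single y (w y))"
        using m1 by (simp add: ac_simps)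
      then show "single m 1 \<in> (edge_ideal E w :: ('v, 'k) mpoly set)"
        using monomial_multiple[OF is_ideal_edge_ideal edge_monomial[OF xy(1)]] by simp
    qed
  qed
qed

section \<open>Powers of the edge ideal localized at the associated primes\<close>

abbreviation edge_power :: "nat \<Rightarrow> ('v, 'k::field) mpoly set" where
  "edge_power k \<equiv> ideal_power (edge_ideal E w) k"

lemma is_ideal_edge_power: "is_ideal (edge_power k :: ('v, 'k::field) mpoly set)"
  by (rule is_ideal_power) (rule is_ideal_edge_ideal)

lemma edge_power_subset: "edge_power k \<subseteq> (avoid (ray k i) :: ('v, 'k::field) mpoly set)"
proof (induction k)
  case 0
  then show ?case by (auto simp: ray_def avoid_def)
next
  case (Suc k)
  show ?case
    unfolding ideal_power.simps ideal_mult_def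
  proof (rule ideal.span_minimal, clarify)
    fix a b :: "('v, 'k) mpoly"
    assume a: "a \<in> edge_ideal E w" and b: "b \<in> edge_power k"
    have "m \<notin> ray (Suc k) i" if m: "m \<in> keys (a * b)" for m
    proof -
      obtain x y where xy: "x \<in> keys a" "y \<in> keys b" "m = x + y"
        using m keys_mult[of a b] by blast
      have "a \<in> avoid (ray 1 i)"
        using a unfolding edge_ideal_eq avoid_rays by blast
      then have "x \<notin> ray 1 i" "y \<notin> ray k i"
        using subsetD[OF Suc b] xy by (auto simp: avoid_def)
      then show ?thesis
        using axis_val_add[of i x y] xy(3) by (simp add: ray_def)
    qed
    then show "a * b \<in> avoid (ray (Suc k) i)"
      by (auto simp: avoid_def)
  next
    show "is_ideal (avoid (ray (Suc k) i) :: ('v, 'k) mpoly set)"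
      by (rule is_ideal_avoid) (rule ray_closed)
  qed
qed

text \<open>A power of x_i is a unit at the prime of i. Up to such a factor the edge between i and
  j, in either direction, supplies the generator in x_j.\<close>

lemma axis_edge_monomial:
  assumes "j \<noteq> i"
  obtains N where "single (single i N + single j (axis_exp i j)) 1 \<in> (edge_ideal E w :: ('v, 'k::field) mpoly set)"
proof (cases "(i, j) \<in> E")
  case True
  then show ?thesis
    using that[of 1] edge_monomial[OF True] by (simp add: axis_exp_def)
next
  case False
  then have "(j, i) \<in> E"
    using assms total_edge by blast
  then show ?thesis
    using that[of "w i"] edge_monomial[of j i] False by (simp add: axis_exp_def add.commute)
qed

text \<open>Splitting off one generator in some x_j lowers \<open>axis_val\<close> by exactly one
  and costs a power of x_i.\<close>

lemma localized_monomial: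
  "m \<notin> ray k i \<Longrightarrow> \<exists>N. single (single i N + m) 1 \<in> (edge_power k :: ('v, 'k::field) mpoly set)"
proof (induction k arbitrary: m)
  case 0
  then show ?case by simp
next
  case (Suc k)
  have "axis_val i m \<noteq> 0"
    using Suc.prems by (simp add: ray_def)
  then obtain j where j: "j \<noteq> i" "coeff m j div axis_exp i j \<noteq> 0"
    by (auto simp: axis_val_def)
  then have "axis_exp i j \<le> coeff m j"
    by (metis div_less not_le)
  then obtain m' where m: "m = single j (axis_exp i j) + m'"
    by (rule exp_split)
  have "axis_val i m = (\<Sum>l\<in>-{i}. coeff m' l div axis_exp i l + (if l = j then 1 else 0))"
    unfolding axis_val_def m using axis_exp_pos[of i j]
    by (intro sum.cong) (auto simp: lookup_add lookup_single "when_def")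
  also have "\<dots> = axis_val i m' + 1"
    using j(1) by (simp add: sum.distrib axis_val_def)
  finally have "m' \<notin> ray k i"
    using Suc.prems by (simp add: ray_def)
  then obtain N' where N': "single (single i N' + m') 1 \<in> (edge_power k :: ('v, 'k) mpoly set)"
    using Suc.IH by blast
  obtain N where N: "single (single i N + single j (axis_exp i j)) 1 \<in> (edge_ideal E w :: ('v, 'k) mpoly set)"
    using j(1) by (rule axis_edge_monomial)
  have "single (single i N + single j (axis_exp i j)) 1 * single (single i N' + m') 1 \<in> (edge_power (Suc k) :: ('v, 'k) mpoly set)"
    unfolding ideal_power.simps ideal_mult_def using N N' by (intro ideal.span_base) blast
  then have "single (single i (N + N') + m) 1 \<in> (edge_power (Suc k) :: ('v, 'k) mpoly set)"
    by (simp add: mult_single m single_add ac_simps)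
  then show ?case ..
qed

lemma localized_poly:
  fixes f :: "('v, 'k::field) mpoly"
  assumes f: "f \<in> avoid (ray k i)"
  obtains N where "single (single i N) 1 * f \<in> edge_power k"
proof -
  have "\<exists>N. single (single i N + m) 1 \<in> (edge_power k :: ('v, 'k) mpoly set)" if "m \<in> keys f" for m
    using f that by (intro localized_monomial) (auto simp: avoid_def)
  then obtain N where N: "\<And>m. m \<in> keys f \<Longrightarrow> single (single i (N m) + m) 1 \<in> (edge_power k :: ('v, 'k) mpoly set)"
    by metis
  \<comment> \<open>The sum dominates every \<open>N m\<close>, so one power of x_i serves all
    monomials.\<close>
  define M where "M = (\<Sum>m\<in>keys f. N m)"
  have M: "single (single i M + m) 1 \<in> (edge_power k :: ('v, 'k) mpoly set)" if "m \<in> keys f" for m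
  proof -
    have "N m \<le> M"
      unfolding M_def using that by (intro member_le_sum) auto
    then have "single i M + m = single i (M - N m) + (single i (N m) + m)"
      by (simp add: add.assoc[symmetric] single_add[symmetric])
    then show ?thesis
      using monomial_multiple[OF is_ideal_edge_power N[OF that]] by simp
  qed
  have "single (single i M) 1 * f \<in> edge_power k"
  proof (rule ideal_of_monomials[OF is_ideal_edge_power])
    fix m assume "m \<in> keys (single (single i M) 1 * f)"
    then obtain b where "b \<in> keys f" "m = single i M + b"
      using keys_mult[of "single (single i M) (1 :: 'k)" f] by auto
    then show "single m 1 \<in> (edge_power k :: ('v, 'k) mpoly set)"
      using M by simp
  qed
  then show ?thesis
    by (rule that)
qed

text \<open>A denominator outside the prime contains a pure power of x_i, so
  \<open>ray_primary\<close> cancels it; conversely a power of x_i is itself an admissible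
  denominator.\<close>

lemma contraction_axis:
  "contraction (extended_ideal (edge_power k) (avoid (axis i))) = (avoid (ray k i) :: ('v, 'k::field) mpoly set)"
proof (intro set_eqI iffI)
  fix f :: "('v, 'k) mpoly"
  note iff = contraction_extended_ideal_iff[OF prime_ideal_axis is_ideal_edge_power]
  {
    assume "f \<in> contraction (extended_ideal (edge_power k) (avoid (axis i)))"
    then obtain s where s: "s \<notin> avoid (axis i)" "s * f \<in> edge_power k"
      unfolding iff by blast
    obtain e where "single i e \<in> keys s"
      using s(1) by (auto simp: not_avoid_axis)
    moreover have "s * f \<in> avoid (ray k i)"
      using s(2) edge_power_subset by blast
    ultimately show "f \<in> avoid (ray k i)"
      by (rule ray_primary)
  next
    assume "f \<in> avoid (ray k i)"
    then obtain N where "single (single i N) 1 * f \<in> edge_power k"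
      by (rule localized_poly)
    moreover have "single (single i N) (1 :: 'k) \<notin> avoid (axis i)"
      by (auto simp: not_avoid_axis)
    ultimately show "f \<in> contraction (extended_ideal (edge_power k) (avoid (axis i)))"
      unfolding iff by blast
  }
qed

section \<open>Associated primes\<close>

definition exp_of :: "('v \<Rightarrow> nat) \<Rightarrow> 'v \<Rightarrow>\<^sub>0 nat" where
  "exp_of g = Poly_Mapping.Abs_poly_mapping g"

lemma coeff_exp_of [simp]: "coeff (exp_of g) = g"
  by (simp add: exp_of_def)

lemma axis_associated: "(avoid (axis i) :: ('v, 'k::field) mpoly set) \<in> Ass (edge_ideal E w)"
proof -
  \<comment> \<open>The prime is the annihilator of x^c: the exponents
    \<open>axis_exp i j - 1\<close> keep c on the ray of i but leave no room for a further x_j, and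
    the exponent of x_i, being at least w i, takes c off every other ray.\<close>
  define c where "c = exp_of (\<lambda>j. if j = i then (\<Sum>j\<in>UNIV. w j) else axis_exp i j - 1)"
  have "coeff c j div axis_exp i j = 0" if "j \<noteq> i" for j
    using that axis_exp_pos[of i j] by (simp add: c_def)
  then have c_axis: "c + m \<in> ray 1 i" if "m \<in> axis i" for m
    using that by (simp add: ray_def axis_val_def lookup_add axis_def)
  have c_off: "c + m \<notin> ray 1 l" if m: "m \<notin> axis i" for m l
  proof -
    obtain j where j: "j \<noteq> i" "0 < coeff m j"
      using m by (auto simp: axis_def)
    have "\<exists>j. j \<noteq> l \<and> axis_exp l j \<le> coeff (c + m) j"
    proof (cases "l = i")
      case True
      then show ?thesis
        using j by (intro exI[of _ j]) (simp add: lookup_add c_def)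
    next
      case False
      have "w i \<le> (\<Sum>j\<in>UNIV. w j)"
        by (intro member_le_sum) auto
      then show ?thesis
        using False axis_exp_le[of l i] by (intro exI[of _ i]) (simp add: lookup_add c_def)
    qed
    then obtain j where "j \<noteq> l" "axis_exp l j \<le> coeff (c + m) j" by blast
    then have "1 \<le> coeff (c + m) j div axis_exp l j"
      using axis_exp_pos[of l j] by (simp add: Suc_le_eq div_greater_zero_iff)
    then show ?thesis
      using axis_val_ge[OF \<open>j \<noteq> l\<close>, of "c + m"] by (simp add: ray_def)
  qed
  have "r \<in> avoid (axis i) \<longleftrightarrow> r * single c 1 \<in> edge_ideal E w" for r :: "('v, 'k) mpoly"
  proof
    assume r: "r \<in> avoid (axis i)"
    have "m \<notin> ray 1 l" if m: "m \<in> keys (r * single c 1)" for m l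
    proof -
      obtain a where "a \<in> keys r" "m = c + a"
        using m keys_mult[of r "single c (1 :: 'k)"] by (auto simp: add.commute)
      then show ?thesis
        using c_off[of a l] r by (auto simp: avoid_def)
    qed
    then show "r * single c 1 \<in> edge_ideal E w"
      unfolding edge_ideal_eq by (auto simp: avoid_def)
  next
    assume r: "r * single c 1 \<in> edge_ideal E w"
    have "coeff r m = 0" if "m \<in> axis i" for m
    proof -
      have "coeff (r * single c 1) (c + m) = 0"
        using r c_axis[OF that] unfolding edge_ideal_eq avoid_iff by blast
      then show ?thesis
        by (simp add: mult.commute[of r] coeff_single_mult_add)
    qed
    then show "r \<in> avoid (axis i)"
      by (simp add: avoid_iff)
  qed
  then have "avoid (axis i) = {r. r * single c 1 \<in> (edge_ideal E w :: ('v, 'k) mpoly set)}"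
    by blast
  then show ?thesis
    unfolding Ass_def using prime_ideal_axis by blast
qed

text \<open>If P annihilates f modulo the edge ideal, f lies outside the component of some i, and
  \<open>ray_primary\<close> gives the inclusion of P in the prime of i.\<close>

lemma Ass_edge_ideal: "Ass (edge_ideal E w :: ('v, 'k::field) mpoly set) = range (\<lambda>i. avoid (axis i))"
proof
  show "range (\<lambda>i. avoid (axis i)) \<subseteq> Ass (edge_ideal E w :: ('v, 'k) mpoly set)"
    using axis_associated by blast
  show "Ass (edge_ideal E w :: ('v, 'k) mpoly set) \<subseteq> range (\<lambda>i. avoid (axis i))"
  proof
    fix P assume "P \<in> Ass (edge_ideal E w :: ('v, 'k) mpoly set)"
    then obtain f where P: "prime_ideal P" and Pf: "P = {r. r * f \<in> edge_ideal E w}"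
      by (auto simp: Ass_def)
    have P_ideal: "is_ideal P"
      using P by (simp add: prime_ideal_def)
    have "f \<notin> edge_ideal E w"
    proof
      assume "f \<in> edge_ideal E w"
      then have "P = UNIV"
        unfolding Pf using ideal.subspace_scale[OF is_ideal_edge_ideal] by blast
      then show False
        using P by (simp add: prime_ideal_def)
    qed
    then obtain i where i: "f \<notin> avoid (ray 1 i)"
      unfolding edge_ideal_eq avoid_rays by blast
    have sub: "P \<subseteq> avoid (axis i)"
    proof
      fix r assume r: "r \<in> P"
      show "r \<in> avoid (axis i)"
      proof (rule ccontr)
        assume "r \<notin> avoid (axis i)"
        then obtain e where "single i e \<in> keys r"
          by (auto simp: not_avoid_axis)
        moreover have "r * f \<in> avoid (ray 1 i)"
          using r unfolding Pf edge_ideal_eq avoid_rays by blast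
        ultimately show False
          using ray_primary i by blast
      qed
    qed
    have "Var i \<notin> (avoid (axis i) :: ('v, 'k) mpoly set)"
      by (auto simp: not_avoid_axis Var_def)
    then have Var_i: "Var i \<notin> P"
      using sub by blast
    have I_sub: "edge_ideal E w \<subseteq> P"
    proof
      fix r :: "('v, 'k) mpoly" assume "r \<in> edge_ideal E w"
      then show "r \<in> P"
        unfolding Pf using ideal.subspace_scale[OF is_ideal_edge_ideal, of r f] by (simp add: mult.commute)
    qed
    \<comment> \<open>The edge monomial between i and j lies in P, while x_i does not; primality
      leaves x_j.\<close>
    have Var_P: "Var j \<in> P" if "j \<noteq> i" for j
    proof -
      obtain N where "single (single i N + single j (axis_exp i j)) 1 \<in> (edge_ideal E w :: ('v, 'k) mpoly set)"
        using axis_edge_monomial[OF \<open>j \<noteq> i\<close>] by blast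
      then have "Var i ^ N * Var j ^ axis_exp i j \<in> P"
        using I_sub unfolding Var_power by (auto simp: mult_single)
      then have "Var i ^ N \<in> P \<or> Var j ^ axis_exp i j \<in> P"
        using P by (simp add: prime_ideal_def)
      then show ?thesis
        using prime_ideal_power[OF P] Var_i by blast
    qed
    have "avoid (axis i) \<subseteq> P"
    proof
      fix g :: "('v, 'k) mpoly" assume g: "g \<in> avoid (axis i)"
      show "g \<in> P"
      proof (rule ideal_of_monomials[OF P_ideal])
        fix m assume "m \<in> keys g"
        then have "m \<notin> axis i"
          using g by (auto simp: avoid_def)
        then obtain j where j: "j \<noteq> i" "1 \<le> coeff m j"
          by (auto simp: axis_def Suc_le_eq)
        obtain m' where "m = single j 1 + m'"
          using j(2) by (rule exp_split)
        then show "single m 1 \<in> P"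
          using monomial_multiple[OF P_ideal, of "single j 1" m'] Var_P[OF j(1)] by (simp add: Var_def add.commute)
      qed
    qed
    then show "P \<in> range (\<lambda>i. avoid (axis i))"
      using sub by blast
  qed
qed

lemma symbolic_power_eq: "symbolic_power (edge_ideal E w :: ('v, 'k::field) mpoly set) k = avoid (\<Union>i. ray k i)"
  unfolding symbolic_power_def Ass_edge_ideal avoid_rays by (simp add: contraction_axis)

end

section \<open>Degrees of monomials on the rays\<close>

context weighted_tournament
begin

lemma monom_deg_split: "monom_deg m = coeff m i + (\<Sum>j\<in>-{i}. coeff m j)"
  unfolding monom_deg_def by (subst sum.remove[of _ i]) (auto simp: Compl_eq_Diff_UNIV)

abbreviation top_exp :: "'v \<Rightarrow> nat" where
  "top_exp i \<equiv> (if out_nbrs E i = {} then 1 else Max (w ` out_nbrs E i))"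

lemma axis_exp_le_top: "axis_exp i j \<le> top_exp i"
proof (cases "(i, j) \<in> E")
  case True
  then have "j \<in> out_nbrs E i" by (simp add: out_nbrs_def)
  then show ?thesis
    using True by (auto simp: axis_exp_def)
next
  case False
  have "1 \<le> Max (w ` out_nbrs E i)" if "x \<in> out_nbrs E i" for x
    using weight_pos[of x] that by (meson Max_ge finite finite_imageI image_eqI le_trans)
  then show ?thesis
    using False by (auto simp: axis_exp_def)
qed

lemma sum_axis_exp: "(\<Sum>j\<in>-{i}. axis_exp i j - 1) = (\<Sum>x\<in>out_nbrs E i. w x - 1)"
  by (rule sum.mono_neutral_cong_right) (auto simp: axis_exp_def out_nbrs_def no_loop)

text \<open>In c = d q + r the first term is at most M q and the remainder at most d - 1. These two
  parts become the multiple of k - 1 and the sum of the w(x) - 1 in r_i(k) and r_ij(k).\<close>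

lemma le_mult_div_add: "0 < d \<Longrightarrow> d \<le> M \<Longrightarrow> (c::nat) \<le> M * (c div d) + (d - 1)"
proof -
  assume d: "0 < d" "d \<le> M"
  have "c = d * (c div d) + c mod d" by simp
  also have "\<dots> \<le> M * (c div d) + (d - 1)"
    using d mod_less_divisor[OF d(1), of c] by (intro add_mono mult_right_mono) auto
  finally show ?thesis .
qed

lemma div_pred_add_mult: "0 < d \<Longrightarrow> (d - 1 + d * q) div d = (q::nat)"
  by (subst div_mult_self2) auto

lemma monom_deg_le_r_vertex:
  assumes "m \<in> ray k i"
  shows "monom_deg m \<le> coeff m i + r_vertex E w k i"
proof -
  have "(\<Sum>j\<in>-{i}. coeff m j) \<le> (\<Sum>j\<in>-{i}. top_exp i * (coeff m j div axis_exp i j) + (axis_exp i j - 1))"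
    using axis_exp_pos axis_exp_le_top by (intro sum_mono le_mult_div_add)
  also have "\<dots> = top_exp i * axis_val i m + (\<Sum>x\<in>out_nbrs E i. w x - 1)"
    by (simp only: sum.distrib sum_distrib_left axis_val_def sum_axis_exp)
  also have "\<dots> \<le> r_vertex E w k i"
    using assms unfolding r_vertex_def by (intro add_right_mono mult_left_mono) (auto simp: ray_def)
  finally show ?thesis
    unfolding monom_deg_split[of m i] by simp
qed

lemma r_vertex_attained:
  assumes k: "1 \<le> k" and j: "j \<noteq> i"
  obtains m where "m \<in> ray k i" "coeff m i = 0" "monom_deg m = r_vertex E w k i"
proof -
  \<comment> \<open>Without out-neighbours of i all exponents are 1, and any other vertex attains
    the conventional maximum 1.\<close>
  obtain j0 where j0: "j0 \<noteq> i" "axis_exp i j0 = top_exp i"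
  proof (cases "out_nbrs E i = {}")
    case True
    then show ?thesis
      using that[of j] j by (auto simp: axis_exp_def out_nbrs_def)
  next
    case False
    then have "Max (w ` out_nbrs E i) \<in> w ` out_nbrs E i"
      by (intro Max_in) auto
    then obtain x where "(i, x) \<in> E" "w x = Max (w ` out_nbrs E i)"
      by (auto simp: out_nbrs_def)
    then show ?thesis
      using that[of x] False edge_neq by (auto simp: axis_exp_def)
  qed
  \<comment> \<open>All remainders are as large as possible, and the k - 1 available quotients are
    spent at \<open>j0\<close>, where each gives the most degree.\<close>
  define m where "m = exp_of (\<lambda>l. if l = i then 0 else axis_exp i l - 1 + (if l = j0 then axis_exp i j0 * (k - 1) else 0))"
  have "coeff m l div axis_exp i l = (if l = j0 then k - 1 else 0)" if "l \<noteq> i" for l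
  proof (cases "l = j0")
    case True
    then have "coeff m l = axis_exp i l - 1 + axis_exp i l * (k - 1)"
      using that by (simp add: m_def)
    then show ?thesis
      using True div_pred_add_mult[OF axis_exp_pos] by metis
  qed (use that axis_exp_pos[of i l] in \<open>simp add: m_def\<close>)
  then have "axis_val i m = (\<Sum>l\<in>-{i}. if l = j0 then k - 1 else 0)"
    by (simp add: axis_val_def)
  also have "\<dots> = k - 1"
    using j0(1) by simp
  finally have "m \<in> ray k i"
    using k by (simp add: ray_def)
  moreover have "monom_deg m = r_vertex E w k i"
  proof -
    have "monom_deg m = (\<Sum>l\<in>-{i}. axis_exp i l - 1 + (if l = j0 then axis_exp i j0 * (k - 1) else 0))"
      unfolding monom_deg_split[of m i] by (simp add: m_def)
    also have "\<dots> = (\<Sum>l\<in>-{i}. axis_exp i l - 1) + axis_exp i j0 * (k - 1)"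
      using j0(1) by (simp add: sum.distrib)
    also have "\<dots> = r_vertex E w k i"
      unfolding sum_axis_exp j0(2) r_vertex_def by simp
    finally show ?thesis .
  qed
  ultimately show ?thesis
    using that[of m] by (simp add: m_def)
qed

section \<open>Monomials common to the rays of the two ends of an edge\<close>

context
  fixes i j :: 'v
  assumes ij: "(i, j) \<in> E"
begin

abbreviation common :: "'v set" where
  "common \<equiv> out_nbrs E i \<inter> out_nbrs E j"

abbreviation rest :: "'v set" where
  "rest \<equiv> - (insert i (insert j common))"

lemma axis_exp_ij: "axis_exp i j = w j" "axis_exp j i = 1"
  using ij antisym_edge[OF ij] by (simp_all add: axis_exp_def)

lemma not_common: "i \<notin> common" "j \<notin> common"
  using no_loop by (auto simp: out_nbrs_def)

lemma i_neq_j: "i \<noteq> j"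
  using ij edge_neq by blast

lemma axis_exp_common: "l \<in> common \<Longrightarrow> axis_exp i l = w l" "l \<in> common \<Longrightarrow> axis_exp j l = w l"
  by (simp_all add: axis_exp_def out_nbrs_def)

lemma axis_exp_rest: "l \<in> rest \<Longrightarrow> axis_exp i l = 1 \<or> axis_exp j l = 1"
  by (auto simp: axis_exp_def out_nbrs_def)

lemma sum_insert_common_rest:
  fixes f :: "'v \<Rightarrow> nat"
  assumes "x \<notin> common" "x \<in> {i, j}"
  shows "sum f (insert x (common \<union> rest)) = f x + sum f common + sum f rest"
proof -
  have "sum f (insert x (common \<union> rest)) = f x + sum f (common \<union> rest)"
    using assms by (intro sum.insert) auto
  also have "sum f (common \<union> rest) = sum f common + sum f rest"
    by (intro sum.union_disjoint) auto
  finally show ?thesis by simp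
qed

lemma axis_val_i: "axis_val i m = coeff m j div w j + (\<Sum>l\<in>common. coeff m l div w l) + (\<Sum>l\<in>rest. coeff m l div axis_exp i l)"
proof -
  have "- {i} = insert j (common \<union> rest)"
    using i_neq_j not_common by blast
  then show ?thesis
    unfolding axis_val_def using sum_insert_common_rest[of j] not_common axis_exp_ij axis_exp_common by simp
qed

lemma axis_val_j: "axis_val j m = coeff m i + (\<Sum>l\<in>common. coeff m l div w l) + (\<Sum>l\<in>rest. coeff m l div axis_exp j l)"
proof -
  have "- {j} = insert i (common \<union> rest)"
    using i_neq_j not_common by blast
  then show ?thesis
    unfolding axis_val_def using sum_insert_common_rest[of i] not_common axis_exp_ij axis_exp_common by simp
qed

lemma monom_deg_ij: "monom_deg m = coeff m i + coeff m j + (\<Sum>l\<in>common. coeff m l) + (\<Sum>l\<in>rest. coeff m l)"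
proof -
  have "- {i} = insert j (common \<union> rest)"
    using i_neq_j not_common by blast
  then show ?thesis
    unfolding monom_deg_split[of m i] using sum_insert_common_rest[of j] not_common by simp
qed

lemma sum_weights_ij: "(\<Sum>x\<in>out_nbrs E i \<inter> closed_out_nbrs E j. w x - 1) = (w j - 1) + (\<Sum>l\<in>common. w l - 1)"
proof -
  have "out_nbrs E i \<inter> closed_out_nbrs E j = insert j common"
    using ij by (auto simp: out_nbrs_def closed_out_nbrs_def)
  then show ?thesis
    using not_common by simp
qed

text \<open>Each of the two rays has a budget k - 1 of quotients. A factor at l in
  \<open>common\<close> spends one unit of both and gives degree w l. Elsewhere a unit from the
  budget of i gives at most w j and a unit from that of j at most 1, together w j + 1. This is the
  origin of the maximum in r_ij(k).\<close>

lemma monom_deg_le_r_edge: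
  assumes "m \<in> ray k i" "m \<in> ray k j"
  shows "monom_deg m \<le> r_edge E w k i j"
proof -
  define M where "M = Max (insert (w j + 1) (w ` common))"
  define X where "X = (\<Sum>l\<in>common. coeff m l div w l)"
  define P where "P = (\<Sum>l\<in>rest. coeff m l div axis_exp i l)"
  define Q where "Q = (\<Sum>l\<in>rest. coeff m l div axis_exp j l)"
  have M: "w j + 1 \<le> M" "\<And>l. l \<in> common \<Longrightarrow> w l \<le> M"
    by (auto simp: M_def)
  have i: "coeff m j div w j + X + P \<le> k - 1"
    using assms(1) unfolding ray_def by (simp add: axis_val_i X_def P_def)
  have j: "coeff m i + X + Q \<le> k - 1"
    using assms(2) unfolding ray_def by (simp add: axis_val_j X_def Q_def)
  have "(\<Sum>l\<in>common. coeff m l) \<le> (\<Sum>l\<in>common. M * (coeff m l div w l) + (w l - 1))"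
    using M(2) weight_pos by (intro sum_mono le_mult_div_add) (auto simp: Suc_le_eq)
  then have common: "(\<Sum>l\<in>common. coeff m l) \<le> M * X + (\<Sum>l\<in>common. w l - 1)"
    by (simp add: sum.distrib X_def sum_distrib_left)
  have "coeff m l \<le> coeff m l div axis_exp i l + coeff m l div axis_exp j l" if "l \<in> rest" for l
    using axis_exp_rest[OF that] by auto
  then have "(\<Sum>l\<in>rest. coeff m l) \<le> (\<Sum>l\<in>rest. coeff m l div axis_exp i l + coeff m l div axis_exp j l)"
    by (rule sum_mono)
  then have rest: "(\<Sum>l\<in>rest. coeff m l) \<le> P + Q"
    by (simp add: sum.distrib P_def Q_def)
  have w: "coeff m j \<le> w j * (coeff m j div w j) + (w j - 1)"
    using weight_pos[of j] by (intro le_mult_div_add) auto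
  \<comment> \<open>What remains of either budget after the common factors.\<close>
  define Z where "Z = k - 1 - X"
  have Z: "k - 1 = Z + X" "coeff m j div w j + P \<le> Z" "coeff m i + Q \<le> Z"
    using i j by (auto simp: Z_def)
  have "w j * (coeff m j div w j) + P \<le> w j * (coeff m j div w j + P)"
    using weight_pos[of j] by (simp add: distrib_left)
  also have "\<dots> \<le> w j * Z"
    using Z(2) by (rule mult_left_mono) simp
  finally have "monom_deg m \<le> Z + w j * Z + (w j - 1) + M * X + (\<Sum>l\<in>common. w l - 1)"
    unfolding monom_deg_ij using common rest w Z(3) by linarith
  also have "Z + w j * Z = (w j + 1) * Z"
    by simp
  also have "(w j + 1) * Z \<le> M * Z"
    using M(1) by (rule mult_right_mono) simp
  finally have "monom_deg m \<le> M * (Z + X) + ((w j - 1) + (\<Sum>l\<in>common. w l - 1))"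
    by (simp add: distrib_left)
  then show ?thesis
    unfolding r_edge_def sum_weights_ij Z(1)[symmetric] M_def .
qed

lemma r_edge_attained:
  assumes k: "1 \<le> k"
  obtains m where "m \<in> ray k i" "m \<in> ray k j" "monom_deg m = r_edge E w k i j"
proof -
  define M where "M = Max (insert (w j + 1) (w ` common))"
  have "M \<in> insert (w j + 1) (w ` common)"
    unfolding M_def by (rule Max_in) auto
  then consider "M = w j + 1" | l0 where "l0 \<in> common" "M = w l0"
    by blast
  then show ?thesis
  proof cases
    case 1
    \<comment> \<open>The budget of j is spent on x_i and that of i on x_j, independently.\<close>
    define m where "m = exp_of (\<lambda>l. if l = i then k - 1 else if l = j then w j - 1 + w j * (k - 1)
      else if l \<in> common then w l - 1 else 0)"
    have i: "coeff m i = k - 1" and j: "coeff m j = w j - 1 + w j * (k - 1)"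
      and c: "l \<in> common \<Longrightarrow> coeff m l = w l - 1" and r: "l \<in> rest \<Longrightarrow> coeff m l = 0" for l
      using i_neq_j not_common by (auto simp: m_def)
    have "coeff m j div w j = k - 1"
      unfolding j using weight_pos[of j] by (intro div_pred_add_mult) simp
    moreover have "(\<Sum>l\<in>common. coeff m l div w l) = 0" "(\<Sum>l\<in>rest. coeff m l div axis_exp p l) = 0" for p
      using c r weight_pos by (auto simp: Suc_le_eq)
    ultimately have "axis_val i m = k - 1" "axis_val j m = k - 1"
      by (simp_all add: axis_val_i axis_val_j i)
    moreover have "monom_deg m = r_edge E w k i j"
      unfolding r_edge_def sum_weights_ij M_def[symmetric] 1 monom_deg_ij i j
      by (simp add: c r)
    ultimately show ?thesis
      using that[of m] k by (simp add: ray_def)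
  next
    case (2 l0)
    \<comment> \<open>Both budgets are spent at once on the common out-neighbour of largest
      weight.\<close>
    define m where "m = exp_of (\<lambda>l. if l = j then w j - 1
      else if l \<in> common then w l - 1 + (if l = l0 then w l0 * (k - 1) else 0) else 0)"
    have i: "coeff m i = 0" and j: "coeff m j = w j - 1"
      and c: "l \<in> common \<Longrightarrow> coeff m l = w l - 1 + (if l = l0 then w l0 * (k - 1) else 0)"
      and r: "l \<in> rest \<Longrightarrow> coeff m l = 0" for l
      using i_neq_j not_common by (auto simp: m_def)
    have "coeff m l div w l = (if l = l0 then k - 1 else 0)" if "l \<in> common" for l
    proof (cases "l = l0")
      case True
      then have "coeff m l = w l - 1 + w l * (k - 1)"
        using c[OF that] by simp
      then show ?thesis
        using True div_pred_add_mult[of "w l"] weight_pos[of l] by (metis Suc_le_eq One_nat_def)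
    qed (use c[OF that] weight_pos[of l] in \<open>simp add: Suc_le_eq\<close>)
    then have "(\<Sum>l\<in>common. coeff m l div w l) = k - 1"
      using 2(1) by simp
    moreover have "coeff m j div w j = 0" "(\<Sum>l\<in>rest. coeff m l div axis_exp p l) = 0" for p
      using j r weight_pos[of j] by (auto simp: Suc_le_eq)
    ultimately have "axis_val i m = k - 1" "axis_val j m = k - 1"
      by (simp_all add: axis_val_i axis_val_j i)
    moreover have "(\<Sum>l\<in>common. coeff m l) = (\<Sum>l\<in>common. w l - 1) + w l0 * (k - 1)"
      using 2(1) by (simp add: c sum.distrib)
    then have "monom_deg m = r_edge E w k i j"
      unfolding r_edge_def sum_weights_ij M_def[symmetric] 2(2) monom_deg_ij i j
      by (simp add: r)
    ultimately show ?thesis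
      using that[of m] k by (simp add: ray_def)
  qed
qed

end

lemma monom_deg_le_of_two_rays:
  assumes "i \<noteq> j" "m \<in> ray k i" "m \<in> ray k j"
  shows "monom_deg m \<le> Max ((\<lambda>(i, j). r_edge E w k i j) ` E)"
proof -
  have "\<exists>e\<in>E. monom_deg m \<le> (\<lambda>(i, j). r_edge E w k i j) e"
    using assms total_edge[of i j] monom_deg_le_r_edge by (cases "(i, j) \<in> E") force+
  then show ?thesis
    by (meson Max_ge finite finite_imageI image_eqI le_trans)
qed

end

section \<open>The regularity of the symbolic powers\<close>

lemma linear_form_mult_single:
  "linear_form * single a 1 = (\<Sum>v\<in>UNIV. single (single v 1 + a) 1 :: ('v::finite, 'k::field) mpoly)"
  by (simp add: linear_form_def Var_def sum_distrib_right mult_single)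

lemma homogeneous_ideal_avoid:
  assumes "\<And>a b. a + b \<in> U \<Longrightarrow> b \<in> U"
  shows "homogeneous_ideal (avoid U)"
  unfolding homogeneous_ideal_def using is_ideal_avoid[OF assms]
  by (simp add: hom_comp_def restrict_avoid)

context weighted_tournament
begin

lemma nonzerodivisor_avoid_ray:
  fixes f :: "('v, 'k::field) mpoly"
  shows "linear_form * f \<in> avoid (ray k i) \<Longrightarrow> f \<in> avoid (ray k i)"
  using ray_primary[OF linear_form_key] .

section \<open>The top degree modulo the ideal and \<open>linear_form\<close>\<close>

context
  fixes k :: nat and t :: nat
  assumes vertex_le: "\<And>i. r_vertex E w k i \<le> t"
    and edge_le: "\<And>i j m. i \<noteq> j \<Longrightarrow> m \<in> ray k i \<Longrightarrow> m \<in> ray k j \<Longrightarrow> monom_deg m < t"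
begin

text \<open>
  On the ray of \<open>i\<close> write \<open>m = x\<^sub>i a\<close>. As \<open>a\<close> has too large a degree to lie on another ray, the
  monomials of \<open>l a - m\<close> outside the ideal are on the ray of \<open>i\<close> with a smaller \<open>x\<^sub>i\<close>-exponent.
\<close>

lemma monomial_reduces:
  "m \<in> ray k i \<Longrightarrow> t < monom_deg m \<Longrightarrow>
    \<exists>g. single m 1 - linear_form * g \<in> (avoid (\<Union>i. ray k i) :: ('v, 'k::field) mpoly set)"
proof (induction "coeff m i" arbitrary: m)
  case 0
  \<comment> \<open>Void: a monomial on the ray of i that is free of x_i has degree at most r_i(k),
    hence at most t.\<close>
  then show ?case
    using monom_deg_le_r_vertex[of m k i] vertex_le[of i] by simp
next
  case (Suc n)
  let ?J = "avoid (\<Union>i. ray k i) :: ('v, 'k) mpoly set"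
  have "1 \<le> coeff m i"
    using Suc.hyps(2) by simp
  then obtain a where m: "m = single i 1 + a"
    by (rule exp_split)
  have a: "a \<in> ray k i"
    using Suc.prems(1) by (simp only: m ray_single)
  have deg: "monom_deg m = Suc (monom_deg a)"
    by (simp add: m monom_deg_add)
  have "\<exists>g. single (single v 1 + a) 1 - linear_form * g \<in> ?J" if v: "v \<noteq> i" for v
  proof (cases "single v 1 + a \<in> (\<Union>i. ray k i)")
    case False
    then show ?thesis
      by (intro exI[of _ 0]) (simp add: single_avoid)
  next
    case True
    then obtain l where l: "single v 1 + a \<in> ray k l" by blast
    then have "a \<in> ray k l"
      by (rule ray_closed)
    then have "l = i"
      using edge_le[of l i a] a Suc.prems(2) deg by auto
    moreover have "n = coeff (single v 1 + a) i"
      using Suc.hyps(2) v by (simp add: m lookup_add lookup_single "when_def")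
    moreover have "t < monom_deg (single v 1 + a)"
      using Suc.prems(2) by (simp add: m monom_deg_add)
    ultimately show ?thesis
      using Suc.hyps(1) l by blast
  qed
  then obtain g where g: "\<And>v. v \<noteq> i \<Longrightarrow> single (single v 1 + a) 1 - linear_form * g v \<in> ?J"
    by metis
  have "linear_form * single a 1 = single m 1 + (\<Sum>v\<in>-{i}. single (single v 1 + a) (1 :: 'k))"
    unfolding linear_form_mult_single m
    by (subst sum.remove[of _ i]) (auto simp: Compl_eq_Diff_UNIV)
  then have "single m 1 - linear_form * (single a 1 - (\<Sum>v\<in>-{i}. g v)) =
      - (\<Sum>v\<in>-{i}. single (single v 1 + a) 1 - linear_form * g v)"
    by (simp add: right_diff_distrib sum_distrib_left sum_subtractf)
  also have "\<dots> \<in> ?J"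
    using g by (intro ideal.subspace_neg[OF is_ideal_avoid_rays] ideal.subspace_sum[OF is_ideal_avoid_rays]) simp
  finally show ?case
    by blast
qed

lemma homogeneous_reduces:
  fixes f :: "('v, 'k::field) mpoly"
  assumes d: "int t < d" and f: "homogeneous d f"
  shows "\<exists>g. f - linear_form * g \<in> avoid (\<Union>i. ray k i)"
proof -
  let ?J = "avoid (\<Union>i. ray k i) :: ('v, 'k) mpoly set"
  have "\<exists>g. single m 1 - linear_form * g \<in> ?J" if "m \<in> keys f" for m
  proof (cases "m \<in> (\<Union>i. ray k i)")
    case True
    moreover have "t < monom_deg m"
      using f that d by (auto simp: homogeneous_def)
    ultimately show ?thesis
      using monomial_reduces by blast
  next
    case False
    then show ?thesis
      by (intro exI[of _ 0]) (simp add: single_avoid)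
  qed
  then obtain g where g: "\<And>m. m \<in> keys f \<Longrightarrow> single m 1 - linear_form * g m \<in> ?J"
    by metis
  have "f - linear_form * (\<Sum>m\<in>keys f. single 0 (coeff f m) * g m) =
      (\<Sum>m\<in>keys f. single m (coeff f m)) - linear_form * (\<Sum>m\<in>keys f. single 0 (coeff f m) * g m)"
    by (simp add: poly_mapping_sum_single)
  also have "\<dots> = (\<Sum>m\<in>keys f. single 0 (coeff f m) * (single m 1 - linear_form * g m))"
    by (simp add: right_diff_distrib sum_distrib_left sum_subtractf mult_single) (simp only: mult_ac)
  also have "\<dots> \<in> ?J"
    using g by (intro ideal.subspace_sum[OF is_ideal_avoid_rays] ideal.subspace_scale[OF is_ideal_avoid_rays])
  finally show ?thesis
    by blast
qed

text \<open>If \<open>x\<^sup>b\<close> were \<open>l g\<close> modulo the ideal, then \<open>l (x\<^sup>b - x\<^sub>i g)\<close> and hence \<open>x\<^sup>b - x\<^sub>i g\<close> would vanish on the ray.\<close>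

lemma vertex_monomial_irreducible:
  fixes g :: "('v, 'k::field) mpoly"
  assumes b: "b \<in> ray k i" "coeff b i = 0" "monom_deg b = t"
  shows "single b 1 - linear_form * g \<notin> avoid (\<Union>i. ray k i)"
proof
  assume "single b 1 - linear_form * g \<in> avoid (\<Union>i. ray k i)"
  then have "single b 1 - linear_form * g \<in> avoid (ray k i)"
    by (auto simp: avoid_rays)
  then have 1: "Var i * (single b 1 - linear_form * g) \<in> avoid (ray k i)"
    by (rule avoid_mult[rotated]) (rule ray_closed)
  \<comment> \<open>Still free of x_i but of degree t + 1, this exponent exceeds the bound
    r_i(k).\<close>
  have "single v 1 + b \<notin> ray k i" if "v \<noteq> i" for v
  proof
    assume "single v 1 + b \<in> ray k i"
    then have "monom_deg (single v 1 + b) \<le> coeff (single v 1 + b) i + r_vertex E w k i"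
      by (rule monom_deg_le_r_vertex)
    then show False
      using that b vertex_le[of i] by (simp add: monom_deg_add lookup_add lookup_single "when_def")
  qed
  then have "(\<Sum>v\<in>-{i}. single (single v 1 + b) (1 :: 'k)) \<in> avoid (ray k i)"
    by (intro ideal.subspace_sum[OF is_ideal_avoid[OF ray_closed]]) (auto simp: single_avoid)
  moreover have eq: "linear_form * single b 1 = Var i * single b 1 + (\<Sum>v\<in>-{i}. single (single v 1 + b) (1 :: 'k))"
    unfolding linear_form_mult_single
    by (subst sum.remove[of _ i]) (auto simp: Compl_eq_Diff_UNIV Var_def mult_single)
  moreover have "linear_form * (single b 1 - Var i * g) =
      Var i * (single b 1 - linear_form * g) + (\<Sum>v\<in>-{i}. single (single v 1 + b) (1 :: 'k))"
    unfolding right_diff_distrib eq mult.left_commute[of linear_form] by simp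
  ultimately have "linear_form * (single b 1 - Var i * g) \<in> avoid (ray k i)"
    using avoid_add[OF 1] by metis
  then have "single b 1 - Var i * g \<in> avoid (ray k i)"
    by (rule nonzerodivisor_avoid_ray)
  then have "coeff (single b 1 - Var i * g) b = 0"
    using b(1) by (rule avoidD)
  moreover have "coeff (Var i * g) b = 0"
    unfolding Var_def using b(2) by (intro coeff_single_mult_eq_0) (auto simp: lookup_add)
  ultimately show False
    by (simp add: lookup_minus)
qed

text \<open>
  The polynomial below agrees with \<open>l x\<^sup>a\<close> on the ray of \<open>i\<close> and vanishes on that of \<open>j\<close>, so a
  quotient \<open>g\<close> would need the coefficient 1 and the coefficient 0 at the common point \<open>a\<close>.
\<close>

lemma edge_poly_irreducible:
  fixes g :: "('v, 'k::field) mpoly"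
  assumes a: "a \<in> ray k i" "a \<in> ray k j" and ij: "i \<noteq> j" and deg: "Suc (monom_deg a) = t"
  shows "restrict (ray k i) (linear_form * single a 1) - linear_form * g \<notin> avoid (\<Union>i. ray k i)"
    (is "?f - _ \<notin> _")
proof
  assume *: "?f - linear_form * g \<in> avoid (\<Union>i. ray k i)"
  have "linear_form * single a 1 - ?f \<in> avoid (ray k i)"
    by (simp add: avoid_iff lookup_minus coeff_restrict)
  moreover have "?f - linear_form * g \<in> avoid (ray k i)"
    using * by (auto simp: avoid_rays)
  ultimately have "linear_form * (single a 1 - g) \<in> avoid (ray k i)"
    using avoid_add by (fastforce simp: right_diff_distrib)
  from nonzerodivisor_avoid_ray[OF this] have one: "coeff (single a 1 - g) a = 0"
    using a(1) by (rule avoidD)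
  \<comment> \<open>The monomials of \<open>?f\<close> have degree t and lie on the ray of i, while
    common monomials of two rays have degree below t.\<close>
  have "?f \<in> avoid (ray k j)"
  proof -
    have "m \<notin> ray k j" if "m \<in> keys ?f" for m
    proof
      assume "m \<in> ray k j"
      have "m \<in> ray k i" "m \<in> keys (linear_form * single a (1 :: 'k))"
        using that by (auto simp: keys_restrict)
      moreover have "homogeneous (1 + int (monom_deg a)) (linear_form * single a (1 :: 'k))"
        by (intro homogeneous_mult homogeneous_linear_form homogeneous_single)
      ultimately have "monom_deg m = t"
        using deg by (auto simp: homogeneous_def)
      then show False
        using edge_le[OF ij \<open>m \<in> ray k i\<close> \<open>m \<in> ray k j\<close>] by simp
    qed
    then show ?thesis
      by (auto simp: avoid_def)
  qed
  moreover have "?f - linear_form * g \<in> avoid (ray k j)"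
    using * by (auto simp: avoid_rays)
  ultimately have "?f - (?f - linear_form * g) \<in> avoid (ray k j)"
    by (rule avoid_diff)
  then have "linear_form * g \<in> avoid (ray k j)"
    by simp
  from nonzerodivisor_avoid_ray[OF this] have "coeff g a = 0"
    using a(2) by (rule avoidD)
  then show False
    using one by (simp add: lookup_minus)
qed

end

lemma reg_symbolic_power:
  assumes card: "2 \<le> CARD('v)" and k: "1 \<le> k"
  shows "reg (symbolic_power (edge_ideal E w :: ('v, 'k::field) mpoly set) k) =
    int (max (Max ((\<lambda>(i, j). r_edge E w k i j) ` E) + 2) (Max (range (r_vertex E w k)) + 1))"
proof -
  let ?J = "avoid (\<Union>i. ray k i) :: ('v, 'k) mpoly set"
  let ?\<delta> = "Max ((\<lambda>(i, j). r_edge E w k i j) ` E)" and ?\<gamma> = "Max (range (r_vertex E w k))"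
  \<comment> \<open>The regularity is t + 1; the 1 added to the edge term is the degree of l in the
    witness belonging to an edge.\<close>
  define t where "t = max (?\<delta> + 1) ?\<gamma>"
  have vertex_le: "r_vertex E w k i \<le> t" for i
    by (simp add: t_def le_max_iff_disj)
  have edge_le: "monom_deg m < t" if "i \<noteq> j" "m \<in> ray k i" "m \<in> ray k j" for i j m
    using monom_deg_le_of_two_rays[OF that] by (simp add: t_def)
  have vertex_irr: "single b 1 - linear_form * g \<notin> ?J"
    if "b \<in> ray k i" "coeff b i = 0" "monom_deg b = t" for b i g
    using vertex_le edge_le that by (rule vertex_monomial_irreducible)
  have edge_irr: "restrict (ray k i) (linear_form * single a 1) - linear_form * g \<notin> ?J"
    if "a \<in> ray k i" "a \<in> ray k j" "i \<noteq> j" "Suc (monom_deg a) = t" for a i j g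
    using vertex_le edge_le that by (rule edge_poly_irreducible)
  have other: "\<exists>j. j \<noteq> i" for i :: 'v
  proof (rule ccontr)
    assume "\<not> ?thesis"
    then have "(UNIV :: 'v set) = {i}" by blast
    then have "CARD('v) = card {i}" by (rule arg_cong)
    then show False
      using card by simp
  qed
  \<comment> \<open>The witness depends on which term attains t: a monomial free of x_i for a
    vertex, and one half of l x^a for an edge.\<close>
  obtain f0 :: "('v, 'k) mpoly" where f0: "homogeneous (int t) f0" "\<And>g. f0 - linear_form * g \<notin> ?J"
  proof (cases "?\<delta> + 1 \<le> ?\<gamma>")
    case True
    have "?\<gamma> \<in> range (r_vertex E w k)"
      by (intro Max_in) auto
    then obtain i where "r_vertex E w k i = ?\<gamma>"
      by (metis imageE)
    then have i: "r_vertex E w k i = t"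
      using True by (simp add: t_def)
    obtain j where "j \<noteq> i"
      using other by blast
    then obtain b where "b \<in> ray k i" "coeff b i = 0" "monom_deg b = t"
      using r_vertex_attained[OF k] i by metis
    then show ?thesis
      using that[of "single b 1"] homogeneous_single[of b "1 :: 'k"] vertex_irr by simp
  next
    case False
    obtain i j :: 'v where "i \<noteq> j"
      using other by metis
    then have "E \<noteq> {}"
      using total_edge by auto
    then have "?\<delta> \<in> (\<lambda>(i, j). r_edge E w k i j) ` E"
      by (intro Max_in) auto
    then obtain i j where ij: "(i, j) \<in> E" "r_edge E w k i j = ?\<delta>"
      by auto
    obtain a where a: "a \<in> ray k i" "a \<in> ray k j" "monom_deg a = r_edge E w k i j"
      using r_edge_attained[OF ij(1) k] by metis
    then have deg: "Suc (monom_deg a) = t"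
      using False ij(2) by (simp add: t_def)
    let ?f = "restrict (ray k i) (linear_form * single a 1) :: ('v, 'k) mpoly"
    have "homogeneous (1 + int (monom_deg a)) (linear_form * single a (1 :: 'k))"
      by (intro homogeneous_mult homogeneous_linear_form homogeneous_single)
    then have "homogeneous (int t) ?f"
      using deg by (auto simp: homogeneous_def keys_restrict)
    moreover have "?f - linear_form * g \<notin> ?J" for g
      using a(1,2) edge_neq[OF ij(1)] deg by (rule edge_irr)
    ultimately show ?thesis
      by (rule that)
  qed
  interpret linear_cm_ideal ?J "int t" f0
  proof
    show "homogeneous_ideal ?J"
      by (rule homogeneous_ideal_avoid) (use ray_closed in blast)
    show "f \<in> ?J" if "linear_form * f \<in> ?J" for f
      using that nonzerodivisor_avoid_ray unfolding avoid_rays by blast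
    show "\<exists>g. f - linear_form * g \<in> ?J" if "int t < d" "homogeneous d f" for d f
      using vertex_le edge_le that by (rule homogeneous_reduces)
    show "1 \<le> int t"
      by (simp add: t_def)
  qed (use f0 card in auto)
  show ?thesis
    unfolding symbolic_power_eq reg_eq by (simp add: t_def max_def)
qed

end

theorem theorem5p5:
  fixes E :: "('v::{finite,linorder} \<times> 'v) set"
    and w :: "'v \<Rightarrow> nat"
    and k :: nat
  assumes "CARD('v) \<ge> 2"
    and "weighted_oriented_complete_graph E w"
    and "out_nbrs_set E (V_plus w) \<noteq> UNIV"
    and "k \<ge> 1"
  shows "reg (symbolic_power (edge_ideal E w :: ('v, 'k::field) mpoly set) k)
    = int (max (Max ((\<lambda>(i, j). r_edge E w k i j) ` E) + 2)
               (Max (range (r_vertex E w k)) + 1))"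
proof -
  interpret weighted_tournament E w
    using assms(2,3) by unfold_locales
  show ?thesis
    using assms(1,4) by (rule reg_symbolic_power)
qed

end
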